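(* By the identification $\mathcal{T}(n)\leftrightarrow\mathrm{SL}(n,\mathbb{R})/\mathrm{SO}(n)$, the Teichmüller metric $d_{Teich}$ is equal to the Hilbert projective metric $s$ of Liverani–Wojtkowski, and $d_{Teich}$ is a Finsler metric with norm defined, for $A$ in the tangent space at $Z$, by $$|A|_Z=\frac12\max\{|\lambda| : \lambda\text{ is an eigenvalue of }AZ^{-1}\}.$$ The paths $t\mapsto e^{tX}$ for $t\in[0,1]$ are geodesics.
   Context: Let $n\ge2$ and $\mathbb{T}^n=\mathbb{R}^n/\mathbb{Z}^n$. $\mathcal{T}(n)$ is the set of classes $[S,f]$, where $S$ is a flat $n$-torus of volume 1 and $f:S\to\mathbb{T}^n$ is an orientation-preserving homeomorphism; $[S,f]=[S',f']$ iff there is an isometry $h:S\to S'$ with $f'\circ h$ homotopic to $f$. Writing $S=\mathbb{R}^n/\Lambda$ and lifting $f$ to $\tilde f:\mathbb{R}^n\to\mathbb{R}^n$, the vectors $\zeta_i=\tilde f^{-1}(e_i)$ form an ordered basis of $\Lambda$; taking them as the columns of a matrix $g\in\mathrm{SL}(n,\mathbb{R})$ identifies $\mathcal{T}(n)$ with $\mathrm{SL}(n,\mathbb{R})/\mathrm{SO}(n)$. The latter is identified with the space $\mathcal{P}_n$ of real symmetric positive-definite $n\times n$ matrices of determinant 1 by $g\,\mathrm{SO}(n)\mapsto gg^T$. The tangent space at the identity is the space of traceless symmetric matrices (and $X$ above is such a matrix); other tangent spaces are obtained by translation by $\mathrm{SL}(n,\mathbb{R})$. Teichmüller metric: $d_{Teich}([S,f],[S',f'])=\frac1{2n}\log\inf_\phi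 K(\phi)$, where $\phi$ ranges over quasiconformal maps homotopic to $f'^{-1}\circ f$. Here $K$ is the maximal dilatation: for a diffeomorphism $\phi$, with $L(T)=\max_{|x|=1}|Tx|$ and $\ell(T)=\min_{|x|=1}|Tx|$ for linear $T$, one sets $K_I(\phi)=\sup_x|J_\phi(x)|/\ell(\phi'(x))^n$, $K_O(\phi)=\sup_xL(\phi'(x))^n/|J_\phi(x)|$, $K(\phi)=\max(K_I(\phi),K_O(\phi))$, with $J_\phi$ the Jacobian (computed in lifts to $\mathbb{R}^n$). Hilbert metric $s$: on $\mathbb{R}^n\times\mathbb{R}^n$ take the symplectic form $\omega((x,y),(w,z))=\langle x,z\rangle-\langle w,y\rangle$. A Lagrangian subspace is positive if it is the graph of a positive-definite symmetric linear map $U:\mathbb{R}^n\to\mathbb{R}^n$. The metric $s$ is the supremum of the symplectic angle between vectors in two positive Lagrangian subspaces; by Liverani–Wojtkowski, for the subspaces defined by $U,W$ it is given by $s(U,W)=\max\{\frac12\big|\log|\lambda|\big| : \lambda\text{ is an eigenvalue of }UW^{-1}\}$. A Finsler metric on a manifold $M$ is a continuous function $F:TM\to[0,\infty)$ whose restriction to each tangent space is positive-definite, subadditive and linear under scaling by positive scalars; a distance is Finsler if it is the induced path distance.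
   Formalization: The Teichmüller metric is normalised as (1/n) log inf K instead of (1/(2n)) log inf K, since the printed constant gives s/2; and the basis vectors ζ_i are taken as rows, so the point of P_n is the Gram matrix, since gg^T with ζ_i as columns is not well defined on T(n). *)

theory Defs
  imports "HOL-Analysis.Analysis" "HOL-Probability.Essential_Supremum" "HOL-Homology.Homology"
begin

section \<open>Flat tori\<close>

text \<open>The torus $\mathbb{R}^n/\Lambda$ is the set of cosets of \<open>\<Lambda>\<close>. The distance of two
  points in the flat metric is the distance \<^const>\<open>setdist\<close> of the two cosets as subsets of
  $\mathbb{R}^n$.\<close>

definition lattice_coset :: "(real^'n) set \<Rightarrow> real^'n \<Rightarrow> (real^'n) set" where
  "lattice_coset \<Lambda> x = (\<lambda>l. x + l) ` \<Lambda>"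

definition torus :: "(real^'n) set \<Rightarrow> (real^'n) set set" where
  "torus \<Lambda> = range (lattice_coset \<Lambda>)"

definition torus_topology :: "(real^'n) set \<Rightarrow> (real^'n) set topology" where
  "torus_topology \<Lambda> = Metric_space.mtopology (torus \<Lambda>) setdist"

definition int_lattice :: "(real^'n) set" where
  "int_lattice = {x. \<forall>i. x $ i \<in> \<int>}"

definition unit_covolume_lattice :: "(real^'n) set \<Rightarrow> bool" where
  "unit_covolume_lattice \<Lambda> \<longleftrightarrow> (\<exists>g::real^'n^'n. \<bar>det g\<bar> = 1 \<and> \<Lambda> = (\<lambda>z. g *v z) ` int_lattice)"

definition torus_isometry ::
    "(real^'n) set \<Rightarrow> (real^'n) set \<Rightarrow> ((real^'n) set \<Rightarrow> (real^'n) set) \<Rightarrow> bool" where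
  "torus_isometry \<Lambda> \<Lambda>' h \<longleftrightarrow> bij_betw h (torus \<Lambda>) (torus \<Lambda>') \<and>
     (\<forall>p\<in>torus \<Lambda>. \<forall>q\<in>torus \<Lambda>. setdist (h p) (h q) = setdist p q)"

definition torus_lift ::
    "(real^'n) set \<Rightarrow> (real^'n) set \<Rightarrow> ((real^'n) set \<Rightarrow> (real^'n) set) \<Rightarrow> (real^'n \<Rightarrow> real^'n) \<Rightarrow> bool"
  where "torus_lift \<Lambda> \<Lambda>' f F \<longleftrightarrow>
     continuous_on UNIV F \<and> (\<forall>x. lattice_coset \<Lambda>' (F x) = f (lattice_coset \<Lambda> x))"

text \<open>A homeomorphism of $\mathbb{R}^n$ preserves the orientation iff, at every point, it acts on
  the local homology group $H_n(\mathbb{R}^n, \mathbb{R}^n\setminus\{x\})$ as the translation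
  taking \<open>x\<close> to \<open>F x\<close>. Tori carry the orientation of $\mathbb{R}^n$.\<close>

definition orientation_preserving :: "(real^'n \<Rightarrow> real^'n) \<Rightarrow> bool" where
  "orientation_preserving F \<longleftrightarrow> (\<forall>x.
     hom_induced (int CARD('n)) euclidean (UNIV - {x}) euclidean (UNIV - {F x}) F =
     hom_induced (int CARD('n)) euclidean (UNIV - {x}) euclidean (UNIV - {F x}) (\<lambda>y. y + (F x - x)))"


section \<open>The Teichmueller space of flat tori\<close>

type_synonym 'n marked_torus = "(real^'n) set \<times> ((real^'n) set \<Rightarrow> (real^'n) set)"

definition marked_tori :: "'n::finite marked_torus set" where
  "marked_tori = {(\<Lambda>, f). unit_covolume_lattice \<Lambda> \<and>
     homeomorphic_map (torus_topology \<Lambda>) (torus_topology int_lattice) f \<and>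
     (\<exists>F. torus_lift \<Lambda> int_lattice f F \<and> orientation_preserving F)}"

definition marking_equiv :: "('n::finite marked_torus \<times> 'n marked_torus) set" where
  "marking_equiv = {((\<Lambda>, f), (\<Lambda>', f')). (\<Lambda>, f) \<in> marked_tori \<and> (\<Lambda>', f') \<in> marked_tori \<and>
     (\<exists>h. torus_isometry \<Lambda> \<Lambda>' h \<and>
       homotopic_with (\<lambda>_. True) (torus_topology \<Lambda>) (torus_topology int_lattice) (f' \<circ> h) f)}"

definition teich_space :: "'n::finite marked_torus set set" where
  "teich_space = marked_tori // marking_equiv"

text \<open>The columns $\zeta_i$ of \<open>g\<close> form the basis of \<open>\<Lambda>\<close> which the marking takes to the standard
  basis of $\mathbb{Z}^n$. If the lift \<open>F\<close> is normalised by \<open>F 0 = 0\<close>, then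
  $\zeta_i = F^{-1}(e_i)$; the equivariance stated here does not depend on the choice of the lift.\<close>

definition marking_matrix :: "'n::finite marked_torus \<Rightarrow> real^'n^'n \<Rightarrow> bool" where
  "marking_matrix m g \<longleftrightarrow> (\<exists>F. torus_lift (fst m) int_lattice (snd m) F \<and>
     (\<forall>x i. F (x + column i g) = F x + axis i 1))"

text \<open>A rotation \<open>k\<close> of the torus changes \<open>g\<close> to \<open>k ** g\<close>. The class therefore determines the
  left coset $g^T\,\mathrm{SO}(n)$ of the transposed matrix, whose rows are the $\zeta_i$. The
  point of $\mathcal{P}_n$ attached to a coset $h\,\mathrm{SO}(n)$ is $h h^T$, so for
  $h = g^T$ it is the Gram matrix of the basis.\<close>

definition teich_coset :: "'n::finite marked_torus set \<Rightarrow> (real^'n^'n) set" where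
  "teich_coset c = {transpose g | g. \<exists>m\<in>c. marking_matrix m g}"

definition teich_to_posdef :: "'n::finite marked_torus set \<Rightarrow> real^'n^'n" where
  "teich_to_posdef c = the_elem ((\<lambda>h. h ** transpose h) ` teich_coset c)"

definition posdef1 :: "(real^'n^'n) set" where
  "posdef1 = {P. transpose P = P \<and> (\<forall>x. x \<noteq> 0 \<longrightarrow> x \<bullet> (P *v x) > 0) \<and> det P = 1}"

definition traceless_sym :: "(real^'n^'n) set" where
  "traceless_sym = {X. transpose X = X \<and> trace X = 0}"

definition posdef1_tangent :: "real^'n^'n \<Rightarrow> (real^'n^'n) set" where
  "posdef1_tangent Z = {g ** X ** transpose g | g X.
     det g = 1 \<and> g ** transpose g = Z \<and> X \<in> traceless_sym}"


section \<open>The Teichmueller metric\<close>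

definition max_stretch :: "(real^'n \<Rightarrow> real^'n) \<Rightarrow> real" where
  "max_stretch T = (SUP x\<in>sphere 0 1. norm (T x))"

definition min_stretch :: "(real^'n \<Rightarrow> real^'n) \<Rightarrow> real" where
  "min_stretch T = (INF x\<in>sphere 0 1. norm (T x))"

definition jacobian :: "(real^'n \<Rightarrow> real^'n) \<Rightarrow> real^'n \<Rightarrow> real" where
  "jacobian F x = det (matrix (frechet_derivative F (at x)))"

text \<open>Quasiconformal maps need not be differentiable everywhere, so the suprema are essential
  suprema; for a $C^1$ diffeomorphism these are the ordinary suprema. The quotients are taken in
  the extended reals, where a positive number divided by \<open>0\<close> is \<open>\<infinity>\<close> and \<open>0 / 0 = 0\<close>. So the outer
  dilatation is the least \<open>K\<close> with $L^n \le K |J|$ almost everywhere, and the inner dilatation the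
  least \<open>K\<close> with $|J| \le K \ell^n$ almost everywhere.\<close>

definition inner_dilatation :: "(real^'n \<Rightarrow> real^'n) \<Rightarrow> ereal" where
  "inner_dilatation F = esssup lebesgue (\<lambda>x.
     ereal \<bar>jacobian F x\<bar> / ereal (min_stretch (frechet_derivative F (at x)) ^ CARD('n)))"

definition outer_dilatation :: "(real^'n \<Rightarrow> real^'n) \<Rightarrow> ereal" where
  "outer_dilatation F = esssup lebesgue (\<lambda>x.
     ereal (max_stretch (frechet_derivative F (at x)) ^ CARD('n)) / ereal \<bar>jacobian F x\<bar>)"

definition max_dilatation :: "(real^'n \<Rightarrow> real^'n) \<Rightarrow> ereal" where
  "max_dilatation F = max (inner_dilatation F) (outer_dilatation F)"

definition abs_continuous_between :: "real \<Rightarrow> real \<Rightarrow> (real \<Rightarrow> 'a::real_normed_vector) \<Rightarrow> bool" where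
  "abs_continuous_between a b h \<longleftrightarrow> (\<forall>\<epsilon>>0. \<exists>\<delta>>0. \<forall>D.
     finite D \<and> (\<forall>(s, t)\<in>D. a \<le> s \<and> s \<le> t \<and> t \<le> b) \<and>
     pairwise (\<lambda>(s, t) (s', t'). disjnt {s<..<t} {s'<..<t'}) D \<and>
     (\<Sum>(s, t)\<in>D. t - s) < \<delta> \<longrightarrow> (\<Sum>(s, t)\<in>D. norm (h t - h s)) < \<epsilon>)"

text \<open>Absolute continuity on almost every line parallel to a coordinate axis. The exceptional set is
  a union of such lines, so it is null in $\mathbb{R}^n$ iff the set of exceptional lines
  is null in dimension $n-1$.\<close>

definition abs_continuous_on_lines :: "(real^'n \<Rightarrow> real^'n) \<Rightarrow> bool" where
  "abs_continuous_on_lines F \<longleftrightarrow>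
     (\<forall>i. AE x in lebesgue. \<forall>a b. abs_continuous_between a b (\<lambda>t. F (x + t *\<^sub>R axis i 1)))"

text \<open>The analytic definition of quasiconformality. It is imposed on the inverse as well, which is
  no restriction, since inverses of quasiconformal maps are quasiconformal.\<close>

definition quasiconformal :: "(real^'n \<Rightarrow> real^'n) \<Rightarrow> bool" where
  "quasiconformal F \<longleftrightarrow> (\<exists>G. homeomorphism UNIV UNIV F G \<and>
     (\<forall>H\<in>{F, G}. abs_continuous_on_lines H \<and> (AE x in lebesgue. H differentiable (at x)) \<and>
        max_dilatation H < \<infinity>))"

text \<open>The dilatations of the quasiconformal maps homotopic to $f'^{-1} \circ f$, computed in lifts.\<close>

definition marked_dilatations :: "'n::finite marked_torus \<Rightarrow> 'n marked_torus \<Rightarrow> ereal set" where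
  "marked_dilatations = (\<lambda>(\<Lambda>, f) (\<Lambda>', f'). {max_dilatation F | F \<phi>.
     homeomorphic_map (torus_topology \<Lambda>) (torus_topology \<Lambda>') \<phi> \<and>
     homotopic_with (\<lambda>_. True) (torus_topology \<Lambda>) (torus_topology \<Lambda>')
       \<phi> (inv_into (torus \<Lambda>') f' \<circ> f) \<and>
     torus_lift \<Lambda> \<Lambda>' \<phi> F \<and> quasiconformal F})"

text \<open>The factor is $1/n$. For \<open>n = 2\<close> this is the classical $\frac12 \log K$. It is the only
  normalisation for which the distance agrees with the metric \<open>s\<close> below: for the linear map with
  singular values $\sigma_i$ one has $\log K = n \max_i |\log \sigma_i|$, while the eigenvalues of
  $U W^{-1}$ are the $\sigma_i^2$. The factor $1/(2n)$ would give $\frac12 s$.\<close>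

definition marked_teich_dist :: "'n::finite marked_torus \<Rightarrow> 'n marked_torus \<Rightarrow> real" where
  "marked_teich_dist m m' = 1 / real CARD('n) * ln (real_of_ereal (Inf (marked_dilatations m m')))"

definition teich_dist :: "'n::finite marked_torus set \<Rightarrow> 'n marked_torus set \<Rightarrow> real" where
  "teich_dist c c' = the_elem ((\<lambda>(m, m'). marked_teich_dist m m') ` (c \<times> c'))"


section \<open>The Hilbert metric\<close>

definition eigenvalues :: "real^'n^'n \<Rightarrow> complex set" where
  "eigenvalues A = {z. \<exists>v. v \<noteq> 0 \<and> map_matrix complex_of_real A *v v = z *s v}"

definition hilbert_dist :: "real^'n^'n \<Rightarrow> real^'n^'n \<Rightarrow> real" where
  "hilbert_dist U W = Max {1/2 * \<bar>ln (cmod z)\<bar> | z. z \<in> eigenvalues (U ** matrix_inv W)}"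


section \<open>Finsler metrics and geodesics\<close>

text \<open>A Finsler metric on a submanifold \<open>M\<close> of a normed space; \<open>T p\<close> is the tangent space at \<open>p\<close>,
  and \<open>Sigma M T\<close> with the subspace topology is the tangent bundle.\<close>

definition finsler_metric ::
    "'a::real_normed_vector set \<Rightarrow> ('a \<Rightarrow> 'a set) \<Rightarrow> ('a \<Rightarrow> 'a \<Rightarrow> real) \<Rightarrow> bool" where
  "finsler_metric M T F \<longleftrightarrow> continuous_on (Sigma M T) (\<lambda>(p, v). F p v) \<and>
     (\<forall>p\<in>M. (\<forall>v\<in>T p. 0 \<le> F p v \<and> (F p v = 0 \<longleftrightarrow> v = 0)) \<and>
       (\<forall>v\<in>T p. \<forall>w\<in>T p. F p (v + w) \<le> F p v + F p w) \<and>
       (\<forall>v\<in>T p. \<forall>r>0. F p (r *\<^sub>R v) = r * F p v))"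

text \<open>Integrability is required because \<^const>\<open>valid_path\<close> allows the velocity to be unbounded near the
  exceptional points, and \<^const>\<open>integral\<close> is \<open>0\<close> for a path of infinite length.\<close>

definition path_distance ::
    "'a::real_normed_vector set \<Rightarrow> ('a \<Rightarrow> 'a \<Rightarrow> real) \<Rightarrow> 'a \<Rightarrow> 'a \<Rightarrow> real" where
  "path_distance M F p q = Inf {integral {0..1} (\<lambda>t. F (\<gamma> t) (vector_derivative \<gamma> (at t))) | \<gamma>.
     valid_path \<gamma> \<and> path_image \<gamma> \<subseteq> M \<and> pathstart \<gamma> = p \<and> pathfinish \<gamma> = q \<and>
     (\<lambda>t. F (\<gamma> t) (vector_derivative \<gamma> (at t))) integrable_on {0..1}}"

definition teich_norm :: "real^'n^'n \<Rightarrow> real^'n^'n \<Rightarrow> real" where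
  "teich_norm Z A = 1/2 * Max {cmod z | z. z \<in> eigenvalues (A ** matrix_inv Z)}"

definition geodesic :: "'a set \<Rightarrow> ('a \<Rightarrow> 'a \<Rightarrow> real) \<Rightarrow> (real \<Rightarrow> 'a) \<Rightarrow> bool" where
  "geodesic M d \<gamma> \<longleftrightarrow> \<gamma> ` {0..1} \<subseteq> M \<and>
     (\<forall>t\<in>{0..1}. \<forall>u\<in>{0..1}. d (\<gamma> t) (\<gamma> u) = \<bar>t - u\<bar> * d (\<gamma> 0) (\<gamma> 1))"

text \<open>The multiplication of the type \<^typ>\<open>real^'n^'n\<close> is componentwise, so \<^const>\<open>power\<close> and
  \<^const>\<open>exp\<close> are not available for matrix powers and exponentials.\<close>

definition matrix_exp :: "real^'n^'n \<Rightarrow> real^'n^'n" where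
  "matrix_exp X = suminf (\<lambda>k. (1 / fact k) *\<^sub>R (((**) X) ^^ k) (mat 1))"

end

theory Submission
  imports Defs
begin

text \<open>A marking is determined up to homotopy by the equivariance of its lift, so a class of marked tori
  is the same as the Gram matrix of the marked lattice basis. Let \<open>A\<close> be the linear map taking one
  marked basis to another. Every lift of a quasiconformal map in the homotopy class is \<open>A\<close> plus a
  periodic map, and it is absolutely continuous on lines, so the average of its derivative over a
  fundamental domain is \<open>A\<close>. By convexity of the \<open>n\<close>-th power its outer dilatation is at least that
  of \<open>A\<close>; the inner dilatation is treated through the inverse map. Thus \<open>A\<close> is extremal, and its
  dilatation is expressed by the eigenvalues of one Gram matrix times the inverse of the other.

  Simultaneous diagonalization turns the Hilbert metric and the Teichmueller norm into bounds of
  quadratic forms: \<open>hilbert_dist U W \<le> c\<close> says that \<open>ln (y \<bullet> U y)\<close> and \<open>ln (y \<bullet> W y)\<close> differ by at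
  most \<open>2 * c\<close> for all \<open>y \<noteq> 0\<close>, and the norm is half the largest logarithmic derivative of these
  forms. Integration along a path gives one inequality for the path distance, and the paths
  \<open>h ** exp (t D) ** transpose h\<close> with \<open>D\<close> diagonal, which include \<open>exp (t X)\<close>, attain equality.\<close>

section \<open>Symmetric matrices and quadratic forms\<close>

text \<open>The two distances meet in one condition. With \<open>A = g' ** matrix_inv g\<close> for
  marked bases \<open>g\<close> and \<open>g'\<close>, the bound
  \<open>hilbert_dist (gram g) (gram g') \<le> c\<close> says that \<open>A\<close> and its inverse
  have operator norm at most \<open>exp c\<close>. Since \<open>A\<close> has determinant 1 up to
  sign, its maximal dilatation is the \<open>n\<close>-th power of the larger of the two norms; this
  is why the logarithm is divided by \<open>n\<close>. The obstacle is the weak regularity of the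
  competitors, which are differentiable only almost everywhere. Their Jacobian enters only through
  the inequality between its integral and the volume of the image, an inequality that survives
  exceptional null sets with large image. The volume itself needs no derivative: the image of a
  fundamental domain tiles space by a lattice of covolume 1. Such null sets also block a direct
  chain rule between a map and its inverse, so they are treated apart when the inner dilatation is
  passed to the inverse map.\<close>

abbreviation quad_form :: "real^'n^'n \<Rightarrow> real^'n \<Rightarrow> real" where
  "quad_form S x \<equiv> x \<bullet> (S *v x)"

definition diag_matrix :: "real^'n \<Rightarrow> real^'n^'n" where
  "diag_matrix d = (\<chi> i j. if i = j then d $ i else 0)"

definition pos_def :: "real^'n^'n \<Rightarrow> bool" where
  "pos_def P \<longleftrightarrow> transpose P = P \<and> (\<forall>x. x \<noteq> 0 \<longrightarrow> quad_form P x > 0)"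

lemma posdef1_iff: "P \<in> posdef1 \<longleftrightarrow> pos_def P \<and> det P = 1"
  by (auto simp: posdef1_def pos_def_def)

lemma inner_matrix_vector_transpose: "x \<bullet> ((A::real^'n^'m) *v y) = (transpose A *v x) \<bullet> y"
  by (simp add: dot_lmul_matrix)

lemma inner_symmetric_matrix:
  "transpose S = S \<Longrightarrow> x \<bullet> ((S::real^'n^'n) *v y) = (S *v x) \<bullet> y"
  by (metis inner_matrix_vector_transpose)

lemma quad_form_congruence: "quad_form (h ** D ** transpose h) y = quad_form D (transpose h *v y)"
  by (metis inner_matrix_vector_transpose matrix_vector_mul_assoc)

lemma quad_form_diag: "quad_form (diag_matrix d) x = (\<Sum>i\<in>UNIV. d $ i * (x $ i)\<^sup>2)"
proof -
  have "(diag_matrix d *v x) $ i = d $ i * x $ i" for i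
    by (simp add: diag_matrix_def matrix_vector_mult_def if_distrib[of "\<lambda>z. z * _"] cong: if_cong)
  then show ?thesis
    by (simp add: inner_vec_def power2_eq_square mult_ac)
qed

lemma diag_matrix_mult: "diag_matrix d ** diag_matrix e = diag_matrix (d * e)"
  unfolding diag_matrix_def matrix_matrix_mult_def
  by (auto simp: vec_eq_iff if_distrib[of "\<lambda>z. z * _"] cong: if_cong)

lemma diag_matrix_one: "diag_matrix 1 = mat 1"
  by (simp add: diag_matrix_def mat_def vec_eq_iff)

lemma transpose_diag_matrix: "transpose (diag_matrix d) = diag_matrix d"
  by (auto simp: diag_matrix_def transpose_def vec_eq_iff)

lemma det_diag_matrix: "det (diag_matrix d) = (\<Prod>i\<in>UNIV. d $ i)"
  by (subst det_diagonal) (auto simp: diag_matrix_def)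

lemma trace_diag_matrix: "trace (diag_matrix d) = (\<Sum>i\<in>UNIV. d $ i)"
  by (auto simp: diag_matrix_def trace_def)

lemma diag_matrix_axis: "diag_matrix d *v axis i 1 = d $ i *\<^sub>R axis i 1"
  unfolding matrix_vector_mult_basis by (auto simp: diag_matrix_def vec_eq_iff column_def axis_def)

section \<open>The spectral theorem for real symmetric matrices\<close>

lemma quadratic_nonpos_linear_coeff_zero:
  fixes a b :: real
  assumes "\<And>t. 2 * t * a + t\<^sup>2 * b \<le> 0"
  shows "a \<le> 0"
proof (rule ccontr)
  assume "\<not> a \<le> 0"
  \<comment> \<open>With this \<open>t\<close> the product \<open>t * \<bar>b\<bar>\<close> stays
    below \<open>a\<close>, so the quadratic term cancels less than one of the two copies of
    \<open>a\<close>.\<close>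
  define t where "t = a / (\<bar>b\<bar> + 1)"
  have t: "t > 0" "t * (\<bar>b\<bar> + 1) = a" using \<open>\<not> a \<le> 0\<close> by (auto simp: t_def)
  have "t * (2 * a + t * b) \<le> 0" using assms[of t] by (simp add: power2_eq_square algebra_simps)
  then have "2 * a + t * b \<le> 0" using t(1) by (simp add: mult_le_0_iff)
  moreover have "t * b \<ge> - (t * \<bar>b\<bar>)" using t(1) by (metis abs_ge_minus_self minus_le_iff minus_mult_right mult_left_mono less_imp_le)
  ultimately show False using t \<open>\<not> a \<le> 0\<close> by (simp add: algebra_simps)
qed

text \<open>An eigenvector is a maximiser of the quadratic form on the unit sphere.\<close>

lemma symmetric_eigenvector_in_subspace:
  fixes S :: "real^'n^'n"
  assumes sym: "transpose S = S" and V: "subspace V" and inv: "\<And>x. x \<in> V \<Longrightarrow> S *v x \<in> V"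
    and nz: "V \<noteq> {0}"
  obtains v c where "v \<in> V" "norm v = 1" "S *v v = c *\<^sub>R v"
proof -
  let ?K = "sphere 0 1 \<inter> V"
  have "compact ?K" using V by (simp add: closed_subspace compact_Int_closed)
  moreover have "?K \<noteq> {}"
  proof -
    obtain w where w: "w \<in> V" "w \<noteq> 0" using nz V by (metis subspace_0 equals0D singletonI subsetI subset_singletonD)
    then have "(1 / norm w) *\<^sub>R w \<in> ?K" using V by (simp add: subspace_scale)
    then show ?thesis by blast
  qed
  moreover have "continuous_on ?K (quad_form S)"
    by (intro continuous_intros matrix_vector_mult_linear_continuous_on)
  ultimately obtain v where v: "v \<in> ?K" and max: "\<And>y. y \<in> ?K \<Longrightarrow> quad_form S y \<le> quad_form S v"
    using continuous_attains_sup[of ?K "quad_form S"] by metis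
  define c where "c = quad_form S v"
  have le: "quad_form S y \<le> c * (y \<bullet> y)" if "y \<in> V" for y
  proof (cases "y = 0")
    case False
    have "(1 / norm y) *\<^sub>R y \<in> ?K" using V that False by (simp add: subspace_scale)
    from max[OF this] have "quad_form S y / (norm y)\<^sup>2 \<le> c"
      by (simp add: c_def matrix_vector_mult_scaleR power2_eq_square)
    then show ?thesis using False by (simp add: field_simps power2_norm_eq_inner)
  qed simp
  \<comment> \<open>The residual of the eigenvector equation serves as the direction of variation:
    the first-order coefficient in that direction is \<open>w \<bullet> w\<close>, so maximality at
    \<open>v\<close> forces the residual to vanish.\<close>
  define w where "w = S *v v - c *\<^sub>R v"
  have wV: "w \<in> V" using v V inv by (simp add: w_def subspace_diff subspace_scale)
  have vv: "v \<bullet> v = 1" using v by (simp add: dot_square_norm)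
  have "2 * t * (w \<bullet> w) + t\<^sup>2 * (quad_form S w - c * (w \<bullet> w)) \<le> 0" for t
  proof -
    have "v + t *\<^sub>R w \<in> V" using v wV V by (simp add: subspace_add subspace_scale)
    from le[OF this] have "quad_form S (v + t *\<^sub>R w) - c * ((v + t *\<^sub>R w) \<bullet> (v + t *\<^sub>R w)) \<le> 0" by simp
    moreover have "v \<bullet> (S *v w) = (S *v v) \<bullet> w" by (rule inner_symmetric_matrix[OF sym])
    then have "quad_form S (v + t *\<^sub>R w) - c * ((v + t *\<^sub>R w) \<bullet> (v + t *\<^sub>R w))
       = 2 * t * ((S *v v) \<bullet> w - c * (v \<bullet> w)) + t\<^sup>2 * (quad_form S w - c * (w \<bullet> w))"
      by (simp add: matrix_vector_right_distrib matrix_vector_mult_scaleR inner_add_left inner_add_right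
          c_def[symmetric] vv inner_commute power2_eq_square algebra_simps)
    moreover have "(S *v v) \<bullet> w - c * (v \<bullet> w) = w \<bullet> w"
      by (metis inner_diff_left inner_scaleR_left w_def)
    ultimately show ?thesis by simp
  qed
  then have "w \<bullet> w \<le> 0" by (rule quadratic_nonpos_linear_coeff_zero)
  then have "w = 0" using inner_ge_zero[of w] by (metis antisym inner_eq_zero_iff)
  then show thesis using v that[of v c] by (simp add: w_def)
qed

text \<open>By symmetry the part of \<open>V\<close> orthogonal to an eigenvector is again
  invariant, and its dimension is smaller. Inducting over invariant subspaces keeps \<open>S\<close>
  itself fixed, with no passage to smaller matrices.\<close>

lemma symmetric_eigenbasis_of_subspace:
  fixes S :: "real^'n^'n"
  assumes sym: "transpose S = S"
  shows "subspace V \<Longrightarrow> (\<And>x. x \<in> V \<Longrightarrow> S *v x \<in> V) \<Longrightarrow>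
    \<exists>B. B \<subseteq> V \<and> V \<subseteq> span B \<and> pairwise orthogonal B \<and> (\<forall>b\<in>B. norm b = 1 \<and> (\<exists>c. S *v b = c *\<^sub>R b))"
proof (induction "dim V" arbitrary: V rule: less_induct)
  case less
  show ?case
  proof (cases "V = {0}")
    case True
    then show ?thesis by (intro exI[of _ "{}"]) auto
  next
    case False
    obtain v c where v: "v \<in> V" "norm v = 1" "S *v v = c *\<^sub>R v"
      using symmetric_eigenvector_in_subspace[OF sym less.prems False] by blast
    define V' where "V' = V \<inter> {x. v \<bullet> x = 0}"
    have sub: "subspace V'" unfolding V'_def
      by (intro subspace_inter less.prems(1) subspace_hyperplane)
    have vv: "v \<bullet> v = 1" using v(2) by (simp add: dot_square_norm)
    have "v \<notin> V'" by (simp add: V'_def vv)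
    then have "V' \<subset> V" using v(1) V'_def by blast
    then have dl: "dim V' < dim V"
      by (simp add: dim_psubset less.prems(1) span_eq_iff[THEN iffD2] sub)
    have inv: "S *v x \<in> V'" if "x \<in> V'" for x
    proof -
      have "v \<bullet> (S *v x) = (S *v v) \<bullet> x" by (rule inner_symmetric_matrix[OF sym])
      then show ?thesis using that v(3) less.prems(2) by (simp add: V'_def)
    qed
    obtain B where B: "B \<subseteq> V'" "V' \<subseteq> span B" "pairwise orthogonal B"
        "\<forall>b\<in>B. norm b = 1 \<and> (\<exists>c. S *v b = c *\<^sub>R b)"
      using less.hyps[OF dl sub inv] by blast
    have "x \<in> span (insert v B)" if "x \<in> V" for x
    proof -
      have "x - (v \<bullet> x) *\<^sub>R v \<in> V'"
        using that v(1) less.prems(1) by (simp add: V'_def inner_diff_right vv subspace_diff subspace_scale)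
      then have "x - (v \<bullet> x) *\<^sub>R v \<in> span (insert v B)" using B(2) by (meson span_mono subset_insertI subsetD)
      then have "x - (v \<bullet> x) *\<^sub>R v + (v \<bullet> x) *\<^sub>R v \<in> span (insert v B)"
        by (rule span_add) (simp add: span_scale span_base)
      then show ?thesis by simp
    qed
    moreover have "pairwise orthogonal (insert v B)"
      using B(1,3) by (auto simp: pairwise_insert orthogonal_def V'_def inner_commute)
    moreover have "insert v B \<subseteq> V" using B(1) v(1) by (auto simp: V'_def)
    ultimately show ?thesis using B(4) v by (intro exI[of _ "insert v B"]) auto
  qed
qed

theorem symmetric_matrix_diagonalization:
  fixes S :: "real^'n^'n"
  assumes sym: "transpose S = S"
  obtains Q d where "orthogonal_matrix Q" "S = Q ** diag_matrix d ** transpose Q"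
proof -
  obtain B where B: "UNIV \<subseteq> span B" "pairwise orthogonal B"
    "\<And>b. b \<in> B \<Longrightarrow> norm b = 1 \<and> (\<exists>c. S *v b = c *\<^sub>R b)"
    using symmetric_eigenbasis_of_subspace[OF sym, of UNIV] by auto
  have "0 \<notin> B" using B(3) by force
  then have "independent B" using B(2) pairwise_orthogonal_independent by blast
  then have "card B = CARD('n)" "finite B"
    using B(1) independent_imp_finite basis_card_eq_dim[of B UNIV] by auto
  then obtain f :: "'n \<Rightarrow> real^'n" where f: "bij_betw f UNIV B"
    by (metis finite_class.finite_UNIV finite_same_card_bij)
  have fB: "f i \<in> B" for i using f by (auto simp: bij_betw_def)
  have orth: "f i \<bullet> f j = (if i = j then 1 else 0)" for i j
  proof (cases "i = j")
    case False
    then have "f i \<noteq> f j" using f by (auto simp: bij_betw_def inj_on_def)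
    then show ?thesis using B(2) fB False by (auto simp: pairwise_def orthogonal_def)
  qed (use B(3)[OF fB] in \<open>auto simp: dot_square_norm\<close>)
  obtain c where c: "\<And>i. S *v f i = c i *\<^sub>R f i" using B(3)[OF fB] by metis
  define Q :: "real^'n^'n" where "Q = (\<chi> i j. f j $ i)"
  have col: "column j Q = f j" for j by (simp add: Q_def column_def vec_eq_iff)
  have QQ: "transpose Q ** Q = mat 1"
    by (simp add: matrix_mult_transpose_dot_column col orth mat_def vec_eq_iff)
  then have oQ: "orthogonal_matrix Q" by (simp add: orthogonal_matrix)
  have "S ** Q = Q ** diag_matrix (\<chi> i. c i)"
  proof -
    have "S *v (Q *v axis j 1) = Q *v (diag_matrix (\<chi> i. c i) *v axis j 1)" for j
      unfolding diag_matrix_axis matrix_vector_mult_scaleR by (simp add: matrix_vector_mult_basis col c)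
    then have "column j (S ** Q) = column j (Q ** diag_matrix (\<chi> i. c i))" for j
      by (simp add: matrix_vector_mul_assoc flip: matrix_vector_mult_basis)
    then show ?thesis by (simp add: vec_eq_iff column_def)
  qed
  then have "S = Q ** diag_matrix (\<chi> i. c i) ** transpose Q"
    by (metis matrix_mul_assoc matrix_mul_rid oQ orthogonal_matrix_def)
  then show thesis using oQ that by blast
qed

section \<open>Positive definite matrices and simultaneous diagonalization\<close>

lemma pos_def_inner_pos: "pos_def P \<Longrightarrow> x \<noteq> 0 \<Longrightarrow> quad_form P x > 0"
  by (simp add: pos_def_def)

lemma invertible_transpose_real: "invertible (A::real^'n^'n) \<Longrightarrow> invertible (transpose A)"
  by (simp add: invertible_det_nz)

lemma invertible_matrix_vector_surj:
  assumes "invertible (A::real^'n^'n)" obtains y where "A *v y = x"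
  using assms by (metis invertible_right_inverse matrix_vector_mul_assoc matrix_vector_mul_lid)

lemma matrix_inv_right_real: "invertible (A::real^'n^'n) \<Longrightarrow> A ** matrix_inv A = mat 1"
  and matrix_inv_left_real: "invertible (A::real^'n^'n) \<Longrightarrow> matrix_inv A ** A = mat 1"
  using someI_ex[of "\<lambda>A'. A ** A' = mat 1 \<and> A' ** A = mat 1"] by (auto simp: matrix_inv_def invertible_def)

lemma matrix_inv_unique_real: "A ** (B::real^'n^'n) = mat 1 \<Longrightarrow> matrix_inv A = B"
  by (metis invertible_right_inverse matrix_inv_left_real matrix_mul_assoc matrix_mul_lid matrix_mul_rid)

lemma pos_def_congruence:
  fixes h :: "real^'n^'n"
  assumes "invertible h" "\<And>i. d $ i > 0"
  shows "pos_def (h ** diag_matrix d ** transpose h)"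
  unfolding pos_def_def
proof (intro conjI allI impI)
  show "transpose (h ** diag_matrix d ** transpose h) = h ** diag_matrix d ** transpose h"
    by (simp add: matrix_transpose_mul transpose_diag_matrix matrix_mul_assoc)
  fix x :: "real^'n" assume "x \<noteq> 0"
  have "transpose h *v x \<noteq> 0"
    using assms(1) \<open>x \<noteq> 0\<close> invertible_transpose_real
    by (metis invertible_left_inverse matrix_left_invertible_ker)
  then obtain i where "(transpose h *v x) $ i \<noteq> 0" by (metis vec_eq_iff zero_index)
  then have "0 < (\<Sum>i\<in>UNIV. d $ i * ((transpose h *v x) $ i)\<^sup>2)"
    using assms(2) by (intro sum_pos2[of _ i]) (auto simp: less_imp_le)
  then show "quad_form (h ** diag_matrix d ** transpose h) x > 0"
    by (simp only: quad_form_congruence quad_form_diag)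
qed

lemma pos_def_diagonalization:
  assumes "pos_def P"
  obtains Q d where "orthogonal_matrix Q" "P = Q ** diag_matrix d ** transpose Q" "\<And>i. d $ i > 0"
proof -
  obtain Q d where Q: "orthogonal_matrix Q" "P = Q ** diag_matrix d ** transpose Q"
    using assms symmetric_matrix_diagonalization by (metis pos_def_def)
  have "d $ i > 0" for i
  proof -
    have e: "transpose Q *v (Q *v axis i 1) = axis i 1"
      using Q(1) by (simp only: matrix_vector_mul_assoc orthogonal_matrix matrix_vector_mul_lid)
    then have "Q *v axis i 1 \<noteq> 0" by (metis axis_eq_0_iff matrix_vector_mult_0_right zero_neq_one)
    from pos_def_inner_pos[OF assms this] show ?thesis
      unfolding Q(2) quad_form_congruence e diag_matrix_axis by (simp add: inner_axis_axis)
  qed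
  then show thesis using Q that by blast
qed

lemma pos_def_square_root:
  assumes "pos_def P"
  obtains R where "pos_def R" "R ** R = P"
proof -
  obtain Q d where Q: "orthogonal_matrix Q" "P = Q ** diag_matrix d ** transpose Q" "\<And>i. d $ i > 0"
    using pos_def_diagonalization[OF assms] by blast
  define R where "R = Q ** diag_matrix (\<chi> i. sqrt (d $ i)) ** transpose Q"
  have "invertible Q" using Q(1) by (auto simp: orthogonal_matrix_def invertible_def)
  then have "pos_def R" unfolding R_def using Q(3) by (intro pos_def_congruence) auto
  moreover have "R ** R = P"
  proof -
    have "(\<chi> i. sqrt (d $ i)) * (\<chi> i. sqrt (d $ i)) = d"
      using Q(3) by (simp add: vec_eq_iff less_imp_le)
    then have "diag_matrix (\<chi> i. sqrt (d $ i)) ** diag_matrix (\<chi> i. sqrt (d $ i)) = diag_matrix d"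
      by (simp add: diag_matrix_mult)
    moreover have "R ** R = Q ** (diag_matrix (\<chi> i. sqrt (d $ i)) ** (transpose Q ** Q) ** diag_matrix (\<chi> i. sqrt (d $ i))) ** transpose Q"
      by (simp add: R_def matrix_mul_assoc)
    ultimately show ?thesis using Q(1,2) by (simp add: orthogonal_matrix)
  qed
  ultimately show thesis using that by blast
qed

lemma pos_def_imp_invertible: "pos_def P \<Longrightarrow> invertible P"
  unfolding invertible_left_inverse matrix_left_invertible_ker
  by (metis inner_zero_right less_irrefl pos_def_inner_pos)

text \<open>Congruence by the inverse of the square root \<open>R\<close> of \<open>W\<close> turns
  \<open>W\<close> into the identity and keeps \<open>A\<close> symmetric. An orthogonal
  \<open>Q\<close> diagonalizing the result leaves the identity fixed, so \<open>R ** Q\<close>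
  serves both forms.\<close>

theorem simultaneous_diagonalization:
  fixes W A :: "real^'n^'n"
  assumes W: "pos_def W" and A: "transpose A = A"
  obtains h :: "real^'n^'n" and d where "invertible h" "W = h ** transpose h" "A = h ** diag_matrix d ** transpose h"
proof -
  obtain R where R: "pos_def R" "R ** R = W" using pos_def_square_root[OF W] by blast
  have iR: "invertible R" using R(1) by (rule pos_def_imp_invertible)
  let ?I = "matrix_inv R"
  have tR: "transpose R = R" using R(1) by (simp add: pos_def_def)
  have tI: "transpose ?I = ?I"
    by (metis iR matrix_inv_left_real matrix_inv_unique_real matrix_transpose_mul tR transpose_mat)
  have "transpose (?I ** A ** ?I) = ?I ** A ** ?I"
    by (simp add: matrix_transpose_mul A tI matrix_mul_assoc)
  then obtain Q d where Q: "orthogonal_matrix Q" "?I ** A ** ?I = Q ** diag_matrix d ** transpose Q"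
    using symmetric_matrix_diagonalization by blast
  have "A = R ** (?I ** A ** ?I) ** R"
    by (metis iR matrix_inv_left_real matrix_inv_right_real matrix_mul_assoc matrix_mul_lid matrix_mul_rid)
  also have "\<dots> = (R ** Q) ** diag_matrix d ** transpose (R ** Q)"
    by (simp add: Q(2) matrix_transpose_mul tR matrix_mul_assoc)
  finally have "A = (R ** Q) ** diag_matrix d ** transpose (R ** Q)" .
  moreover have "W = (R ** Q) ** transpose (R ** Q)"
    by (metis Q(1) R(2) matrix_mul_assoc matrix_mul_rid matrix_transpose_mul orthogonal_matrix_def tR)
  moreover have "invertible (R ** Q)" using iR Q(1)
    by (auto simp: orthogonal_matrix_def intro!: invertible_mult) (auto simp: invertible_def)
  ultimately show thesis using that by blast
qed

section \<open>Eigenvalues, the Hilbert metric and the Teichmueller norm\<close>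

lemma map_matrix_of_real_mult:
  "map_matrix complex_of_real (A ** B) = map_matrix complex_of_real A ** map_matrix complex_of_real B"
  by (simp add: vec_eq_iff matrix_matrix_mult_def)

lemma map_matrix_of_real_mat: "map_matrix complex_of_real (mat 1) = mat 1"
  by (simp add: vec_eq_iff mat_def)

text \<open>The eigenvectors in \<open>eigenvalues\<close> are complex, so \<open>h\<close> and its
  inverse are moved to complex matrices, where they remain inverse to each other. In the coordinates
  \<open>G *v v\<close> the eigenvalue equation decouples.\<close>

lemma eigenvalues_conjugate_diag:
  fixes h :: "real^'n^'n"
  assumes h: "invertible h"
  shows "eigenvalues (h ** diag_matrix d ** matrix_inv h) = (\<lambda>i. complex_of_real (d $ i)) ` UNIV"
proof -
  define H where "H = map_matrix complex_of_real h"
  define G where "G = map_matrix complex_of_real (matrix_inv h)"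
  define D where "D = map_matrix complex_of_real (diag_matrix d)"
  have HG: "H ** G = mat 1" "G ** H = mat 1"
    unfolding H_def G_def by (metis h map_matrix_of_real_mat map_matrix_of_real_mult
        matrix_inv_right_real matrix_inv_left_real)+
  have Dv: "(D *v u) $ i = of_real (d $ i) * u $ i" for u i
    by (simp add: D_def diag_matrix_def matrix_vector_mult_def if_distrib[of of_real]
        if_distrib[of "\<lambda>z. z * _"] cong: if_cong)
  have E: "map_matrix complex_of_real (h ** diag_matrix d ** matrix_inv h) = H ** D ** G"
    by (simp add: H_def G_def D_def map_matrix_of_real_mult)
  have "z \<in> eigenvalues (h ** diag_matrix d ** matrix_inv h) \<longleftrightarrow> (\<exists>i. z = of_real (d $ i))" for z
  proof
    assume "z \<in> eigenvalues (h ** diag_matrix d ** matrix_inv h)"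
    then obtain v where v: "v \<noteq> 0" "H ** D ** G *v v = z *s v" by (auto simp: eigenvalues_def E)
    define u where "u = G *v v"
    have Hu: "H *v u = v" by (simp add: u_def matrix_vector_mul_assoc HG)
    then have "u \<noteq> 0" using v(1) by auto
    then obtain i where i: "u $ i \<noteq> 0" by (metis vec_eq_iff zero_index)
    have "D *v u = G *v (H *v (D *v u))" by (simp add: matrix_vector_mul_assoc HG matrix_mul_assoc)
    also have "\<dots> = G *v (z *s v)" using v(2) by (simp add: u_def matrix_vector_mul_assoc matrix_mul_assoc)
    also have "\<dots> = z *s u" by (simp add: u_def matrix_vector_mult_def vec_eq_iff sum_distrib_left mult_ac)
    finally have "of_real (d $ i) * u $ i = z * u $ i" by (metis Dv vector_smult_component)
    then show "\<exists>i. z = of_real (d $ i)" using i by auto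
  next
    assume "\<exists>i. z = of_real (d $ i)"
    then obtain i where i: "z = of_real (d $ i)" by blast
    define u :: "complex^'n" where "u = axis i 1"
    have Du: "D *v u = z *s u"
      by (simp add: vec_eq_iff Dv u_def axis_def i)
    have "G *v (H *v u) = u" by (simp add: matrix_vector_mul_assoc HG)
    moreover have "u \<noteq> 0" by (simp add: u_def axis_eq_0_iff)
    ultimately have "H *v u \<noteq> 0" by auto
    moreover have "H ** D ** G *v (H *v u) = z *s (H *v u)"
    proof -
      have "H ** D ** G *v (H *v u) = H *v (D *v (G *v (H *v u)))" by (simp add: matrix_vector_mul_assoc matrix_mul_assoc)
      also have "\<dots> = H *v (z *s u)" by (simp add: \<open>G *v (H *v u) = u\<close> Du)
      also have "\<dots> = z *s (H *v u)" by (simp add: matrix_vector_mult_def vec_eq_iff sum_distrib_left mult_ac)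
      finally show ?thesis .
    qed
    ultimately show "z \<in> eigenvalues (h ** diag_matrix d ** matrix_inv h)"
      by (auto simp: eigenvalues_def E)
  qed
  then show ?thesis by auto
qed

text \<open>The transposed factors cancel, which leaves a matrix similar to the diagonal one. In
  particular the spectrum is real although the product of two symmetric matrices is in general not
  symmetric.\<close>

lemma eigenvalues_pencil:
  fixes h :: "real^'n^'n"
  assumes h: "invertible h"
  shows "eigenvalues ((h ** diag_matrix d ** transpose h) ** matrix_inv (h ** transpose h))
    = (\<lambda>i. complex_of_real (d $ i)) ` UNIV"
proof -
  let ?J = "matrix_inv (transpose h)"
  have t: "transpose h ** ?J = mat 1" by (rule matrix_inv_right_real[OF invertible_transpose_real[OF h]])
  have "(h ** transpose h) ** (?J ** matrix_inv h) = mat 1"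
    by (metis h matrix_inv_right_real matrix_mul_assoc matrix_mul_rid t)
  then have "matrix_inv (h ** transpose h) = ?J ** matrix_inv h" by (rule matrix_inv_unique_real)
  then have "(h ** diag_matrix d ** transpose h) ** matrix_inv (h ** transpose h)
     = h ** diag_matrix d ** (transpose h ** ?J) ** matrix_inv h" by (simp add: matrix_mul_assoc)
  then show ?thesis using eigenvalues_conjugate_diag[OF h] t by simp
qed

text \<open>In the coordinates \<open>transpose h *v y\<close> both forms are sums of squares, one
  of them weighted by \<open>d\<close>. Vectors with coordinates \<open>axis i 1\<close> isolate a
  single weight; the converse is a termwise comparison.\<close>

lemma quad_form_pencil_bounds:
  fixes h :: "real^'n^'n"
  assumes h: "invertible h"
  shows "(\<forall>y. quad_form (h ** diag_matrix d ** transpose h) y \<le> c * quad_form (h ** transpose h) y)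
    \<longleftrightarrow> (\<forall>i. d $ i \<le> c)"
    and "(\<forall>y. c * quad_form (h ** transpose h) y \<le> quad_form (h ** diag_matrix d ** transpose h) y)
    \<longleftrightarrow> (\<forall>i. c \<le> d $ i)"
proof -
  have W: "quad_form (h ** transpose h) y = (\<Sum>i\<in>UNIV. ((transpose h *v y) $ i)\<^sup>2)" for y
    using quad_form_congruence[of y h "diag_matrix 1"] by (simp only: quad_form_diag) (simp add: diag_matrix_one)
  have A: "quad_form (h ** diag_matrix d ** transpose h) y = (\<Sum>i\<in>UNIV. d $ i * ((transpose h *v y) $ i)\<^sup>2)" for y
    by (simp only: quad_form_congruence quad_form_diag)
  have surj: "\<exists>y. transpose h *v y = axis i 1" for i
    using invertible_matrix_vector_surj[OF invertible_transpose_real[OF h]] by metis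
  have ax: "(\<Sum>j\<in>UNIV. f j * ((axis i 1 :: real^'n) $ j)\<^sup>2) = f i" for f :: "'n \<Rightarrow> real" and i
    by (simp add: axis_def if_distrib[of "\<lambda>x. x\<^sup>2"] if_distrib[of "\<lambda>x. _ * x"] cong: if_cong)
  show "(\<forall>y. quad_form (h ** diag_matrix d ** transpose h) y \<le> c * quad_form (h ** transpose h) y)
    \<longleftrightarrow> (\<forall>i. d $ i \<le> c)"
  proof safe
    fix i assume L: "\<forall>y. quad_form (h ** diag_matrix d ** transpose h) y \<le> c * quad_form (h ** transpose h) y"
    obtain y where "transpose h *v y = axis i 1" using surj by blast
    with L[rule_format, of y] show "d $ i \<le> c"
      unfolding A W using ax[of "\<lambda>_. 1" i] by (simp add: ax del: transpose_matrix_vector)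
  next
    fix y assume "\<forall>i. d $ i \<le> c"
    then show "quad_form (h ** diag_matrix d ** transpose h) y \<le> c * quad_form (h ** transpose h) y"
      unfolding A W sum_distrib_left by (intro sum_mono mult_right_mono) auto
  qed
  show "(\<forall>y. c * quad_form (h ** transpose h) y \<le> quad_form (h ** diag_matrix d ** transpose h) y)
    \<longleftrightarrow> (\<forall>i. c \<le> d $ i)"
  proof safe
    fix i assume L: "\<forall>y. c * quad_form (h ** transpose h) y \<le> quad_form (h ** diag_matrix d ** transpose h) y"
    obtain y where "transpose h *v y = axis i 1" using surj by blast
    with L[rule_format, of y] show "c \<le> d $ i"
      unfolding A W using ax[of "\<lambda>_. 1" i] by (simp add: ax del: transpose_matrix_vector)
  next
    fix y assume "\<forall>i. c \<le> d $ i"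
    then show "c * quad_form (h ** transpose h) y \<le> quad_form (h ** diag_matrix d ** transpose h) y"
      unfolding A W sum_distrib_left by (intro sum_mono mult_right_mono) auto
  qed
qed

lemma hilbert_dist_pencil:
  fixes h :: "real^'n^'n"
  assumes "invertible h" "\<And>i. d $ i > 0"
  shows "hilbert_dist (h ** diag_matrix d ** transpose h) (h ** transpose h)
    = Max (range (\<lambda>i. 1/2 * \<bar>ln (d $ i)\<bar>))"
proof -
  have "{1/2 * \<bar>ln (cmod z)\<bar> | z. z \<in> eigenvalues ((h ** diag_matrix d ** transpose h) ** matrix_inv (h ** transpose h))}
    = range (\<lambda>i. 1/2 * \<bar>ln (d $ i)\<bar>)"
    unfolding eigenvalues_pencil[OF assms(1)] using assms(2) by (auto simp: less_imp_le abs_of_pos image_iff intro!: exI)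
  then show ?thesis by (simp add: hilbert_dist_def)
qed

lemma teich_norm_pencil:
  fixes h :: "real^'n^'n"
  assumes "invertible h"
  shows "teich_norm (h ** transpose h) (h ** diag_matrix d ** transpose h) = 1/2 * Max (range (\<lambda>i. \<bar>d $ i\<bar>))"
proof -
  have "{cmod z | z. z \<in> eigenvalues ((h ** diag_matrix d ** transpose h) ** matrix_inv (h ** transpose h))}
    = range (\<lambda>i. \<bar>d $ i\<bar>)"
    unfolding eigenvalues_pencil[OF assms(1)] by (force simp: image_iff)
  then show ?thesis by (simp add: teich_norm_def)
qed

lemma pencil_diag_pos:
  fixes h :: "real^'n^'n"
  assumes h: "invertible h" and U: "pos_def (h ** diag_matrix d ** transpose h)"
  shows "d $ i > 0"
proof -
  obtain y where y: "transpose h *v y = axis i 1"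
    using invertible_matrix_vector_surj[OF invertible_transpose_real[OF h]] by metis
  then have "y \<noteq> 0" by (metis axis_eq_0_iff matrix_vector_mult_0_right zero_neq_one)
  from pos_def_inner_pos[OF U this] show ?thesis
    unfolding quad_form_congruence y diag_matrix_axis by (simp add: inner_axis_axis)
qed

text \<open>The extreme eigenvalues of the pencil are the extreme values of the quotient of the two
  forms; the 2 in the exponents undoes the 1/2 of the metric. Because \<open>c\<close> is arbitrary,
  inequalities between distances can be derived without handling a maximum of eigenvalues.\<close>

theorem hilbert_dist_le_iff:
  fixes U W :: "real^'n^'n"
  assumes "pos_def U" "pos_def W"
  shows "hilbert_dist U W \<le> c \<longleftrightarrow>
    (\<forall>y. exp (- 2 * c) * quad_form W y \<le> quad_form U y \<and> quad_form U y \<le> exp (2 * c) * quad_form W y)"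
proof -
  obtain h :: "real^'n^'n" and d where h: "invertible h" "W = h ** transpose h" "U = h ** diag_matrix d ** transpose h"
    using simultaneous_diagonalization assms by (metis pos_def_def)
  have pos: "d $ i > 0" for i using pencil_diag_pos[OF h(1)] assms(1) h(3) by simp
  have "hilbert_dist U W \<le> c \<longleftrightarrow> (\<forall>i. 1/2 * \<bar>ln (d $ i)\<bar> \<le> c)"
    unfolding h(2,3) hilbert_dist_pencil[OF h(1) pos] by (subst Max_le_iff) auto
  also have "\<dots> \<longleftrightarrow> (\<forall>i. exp (- 2 * c) \<le> d $ i) \<and> (\<forall>i. d $ i \<le> exp (2 * c))"
  proof -
    have "1/2 * \<bar>ln (d $ i)\<bar> \<le> c \<longleftrightarrow> exp (- 2 * c) \<le> d $ i \<and> d $ i \<le> exp (2 * c)" for i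
    proof -
      have "1/2 * \<bar>ln (d $ i)\<bar> \<le> c \<longleftrightarrow> - 2 * c \<le> ln (d $ i) \<and> ln (d $ i) \<le> 2 * c" by linarith
      then show ?thesis using pos[of i] by (metis exp_le_cancel_iff exp_ln)
    qed
    then show ?thesis by blast
  qed
  also have "\<dots> \<longleftrightarrow> (\<forall>y. exp (- 2 * c) * quad_form W y \<le> quad_form U y \<and> quad_form U y \<le> exp (2 * c) * quad_form W y)"
    unfolding h(2,3) quad_form_pencil_bounds[OF h(1), symmetric] by blast
  finally show ?thesis .
qed

theorem teich_norm_le_iff:
  fixes W A :: "real^'n^'n"
  assumes "pos_def W" "transpose A = A"
  shows "teich_norm W A \<le> c \<longleftrightarrow> (\<forall>y. \<bar>quad_form A y\<bar> \<le> 2 * c * quad_form W y)"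
proof -
  obtain h :: "real^'n^'n" and d where h: "invertible h" "W = h ** transpose h" "A = h ** diag_matrix d ** transpose h"
    using simultaneous_diagonalization assms by blast
  have "teich_norm W A \<le> c \<longleftrightarrow> Max (range (\<lambda>i. \<bar>d $ i\<bar>)) \<le> 2 * c"
    unfolding h(2,3) teich_norm_pencil[OF h(1)] by linarith
  also have "\<dots> \<longleftrightarrow> (\<forall>i. - (2 * c) \<le> d $ i) \<and> (\<forall>i. d $ i \<le> 2 * c)"
    by (subst Max_le_iff) (auto simp: abs_le_iff minus_le_iff)
  also have "\<dots> \<longleftrightarrow> (\<forall>y. \<bar>quad_form A y\<bar> \<le> 2 * c * quad_form W y)"
    unfolding h(2,3) quad_form_pencil_bounds[OF h(1), symmetric] abs_le_iff by (auto simp: minus_le_iff)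
  finally show ?thesis .
qed

section \<open>Powers and exponentials of symmetric matrices\<close>

lemma matrix_power_diag:
  fixes Q :: "real^'n^'n"
  assumes "orthogonal_matrix Q"
  shows "(((**) (Q ** diag_matrix d ** transpose Q)) ^^ k) (mat 1) = Q ** diag_matrix (\<chi> i. d $ i ^ k) ** transpose Q"
proof (induction k)
  case 0
  have "(\<chi> i. d $ i ^ 0) = (1::real^'n)" by (simp add: vec_eq_iff)
  then show ?case using assms by (simp add: diag_matrix_one orthogonal_matrix_def)
next
  case (Suc k)
  have "d * (\<chi> i. d $ i ^ k) = (\<chi> i. d $ i ^ Suc k)" by (simp add: vec_eq_iff)
  moreover have "(Q ** diag_matrix d ** transpose Q) ** (Q ** diag_matrix (\<chi> i. d $ i ^ k) ** transpose Q)
     = Q ** (diag_matrix d ** (transpose Q ** Q) ** diag_matrix (\<chi> i. d $ i ^ k)) ** transpose Q"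
    by (simp add: matrix_mul_assoc)
  ultimately show ?case using assms Suc by (simp add: orthogonal_matrix diag_matrix_mult)
qed

text \<open>Exhibits the congruence as a linear function of the diagonal with fixed matrix
  coefficients, so that series, derivatives and continuity reduce to those of the scalars
  \<open>d $ i\<close>.\<close>

lemma congruence_diag_expand:
  "h ** diag_matrix d ** transpose h = (\<Sum>i\<in>UNIV. d $ i *\<^sub>R (h ** diag_matrix (axis i 1) ** transpose h))"
  by (simp add: vec_eq_iff matrix_matrix_mult_def diag_matrix_def transpose_def axis_def
      if_distrib[of "\<lambda>x. _ * x"] if_distrib[of "\<lambda>x. x * _"] mult_ac cong: if_cong)

lemma matrix_exp_diag:
  assumes "orthogonal_matrix Q"
  shows "matrix_exp (Q ** diag_matrix d ** transpose Q) = Q ** diag_matrix (\<chi> i. exp (d $ i)) ** transpose Q"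
proof -
  have "(\<lambda>k. \<Sum>i\<in>UNIV. ((1 / fact k) * d $ i ^ k) *\<^sub>R (Q ** diag_matrix (axis i 1) ** transpose Q))
     sums (\<Sum>i\<in>UNIV. exp (d $ i) *\<^sub>R (Q ** diag_matrix (axis i 1) ** transpose Q))"
  proof (intro sums_sum bounded_linear.sums[OF bounded_linear_scaleR_left])
    fix i show "(\<lambda>k. (1 / fact k) * d $ i ^ k) sums exp (d $ i)"
      using exp_converges[of "d $ i"] by (simp add: field_simps)
  qed
  moreover have "(\<Sum>i\<in>UNIV. ((1 / fact k) * d $ i ^ k) *\<^sub>R (Q ** diag_matrix (axis i 1) ** transpose Q))
     = (1 / fact k) *\<^sub>R (((**) (Q ** diag_matrix d ** transpose Q)) ^^ k) (mat 1)" for k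
    unfolding matrix_power_diag[OF assms] congruence_diag_expand[of Q "\<chi> i. d $ i ^ k"]
    by (simp add: scaleR_sum_right)
  moreover have "(\<Sum>i\<in>UNIV. exp (d $ i) *\<^sub>R (Q ** diag_matrix (axis i 1) ** transpose Q))
     = Q ** diag_matrix (\<chi> i. exp (d $ i)) ** transpose Q"
    by (subst congruence_diag_expand) simp
  ultimately show ?thesis unfolding matrix_exp_def by (simp add: sums_unique[symmetric])
qed

section \<open>The Finsler structure on the space of positive matrices\<close>

lemma posdef1_imp_pos_def: "P \<in> posdef1 \<Longrightarrow> pos_def P"
  by (simp add: posdef1_iff)

lemma posdef1_tangent_symmetric: "A \<in> posdef1_tangent Z \<Longrightarrow> transpose A = A"
  by (auto simp: posdef1_tangent_def traceless_sym_def matrix_transpose_mul matrix_mul_assoc)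

lemma quad_form_scale: "quad_form A (r *\<^sub>R y) = r\<^sup>2 * quad_form A y"
  by (simp add: matrix_vector_mult_scaleR power2_eq_square)

text \<open>The quotient of the forms is invariant under scaling of \<open>y\<close>, so the unit
  sphere suffices. Its compactness is what yields continuity of the norm.\<close>

lemma teich_norm_le_iff_sphere:
  fixes W A :: "real^'n^'n"
  assumes W: "pos_def W" and A: "transpose A = A"
  shows "teich_norm W A \<le> c \<longleftrightarrow> (\<forall>y\<in>sphere 0 1. \<bar>quad_form A y\<bar> / (2 * quad_form W y) \<le> c)"
proof -
  have "(\<bar>quad_form A y\<bar> \<le> 2 * c * quad_form W y) \<longleftrightarrow> \<bar>quad_form A y\<bar> / (2 * quad_form W y) \<le> c"
    if "y \<noteq> 0" for y
    using pos_def_inner_pos[OF W that] by (simp add: field_simps)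
  moreover have "\<bar>quad_form A y\<bar> / (2 * quad_form W y) \<le> c"
    if L: "\<forall>y\<in>sphere 0 1. \<bar>quad_form A y\<bar> / (2 * quad_form W y) \<le> c" and "y \<noteq> 0" for y
  proof -
    have "(1 / norm y) *\<^sub>R y \<in> sphere 0 1" using that by simp
    from L[rule_format, OF this] that(2) show ?thesis
      by (simp only: quad_form_scale abs_mult) (simp add: power_divide)
  qed
  ultimately show ?thesis unfolding teich_norm_le_iff[OF W A]
    by (metis (no_types, lifting) inner_zero_left abs_zero mult_zero_right order_refl
        mem_sphere_0 norm_zero zero_neq_one)
qed

lemma teich_norm_bound:
  assumes "pos_def W" "transpose A = A"
  shows "\<bar>quad_form A y\<bar> \<le> 2 * teich_norm W A * quad_form W y"
  using teich_norm_le_iff[OF assms] by blast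

lemma teich_norm_nonneg:
  fixes W :: "real^'n^'n"
  assumes "pos_def W" "transpose A = A"
  shows "0 \<le> teich_norm W A"
proof -
  obtain y :: "real^'n" where "y \<noteq> 0" by (metis axis_eq_0_iff zero_neq_one)
  then have "quad_form W y > 0" by (rule pos_def_inner_pos[OF assms(1)])
  moreover have "0 \<le> 2 * teich_norm W A * quad_form W y"
    using teich_norm_bound[OF assms, of y] by linarith
  ultimately show ?thesis by (simp add: zero_le_mult_iff)
qed

text \<open>Polarization: the mixed terms of the form at \<open>x + y\<close> recover the bilinear
  form of a symmetric matrix.\<close>

lemma symmetric_quad_form_eq_zero:
  fixes A :: "real^'n^'n"
  assumes A: "transpose A = A" and z: "\<And>y. quad_form A y = 0"
  shows "A = 0"
proof -
  have "x \<bullet> (A *v y) = 0" for x y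
  proof -
    have "quad_form A (x + y) = quad_form A x + quad_form A y + x \<bullet> (A *v y) + y \<bullet> (A *v x)"
      by (simp add: matrix_vector_right_distrib inner_add_left inner_add_right)
    moreover have "y \<bullet> (A *v x) = x \<bullet> (A *v y)"
      by (metis A inner_commute inner_symmetric_matrix)
    ultimately show ?thesis by (simp add: z)
  qed
  then have "A *v y = 0 *v y" for y by (metis inner_eq_zero_iff matrix_vector_mult_0)
  then show ?thesis by (simp add: matrix_eq)
qed

lemma continuous_on_quad_form [continuous_intros]:
  assumes "continuous_on S A" "continuous_on S y"
  shows "continuous_on S (\<lambda>p. quad_form (A p) (y p))"
  unfolding inner_vec_def matrix_vector_mult_def
  by (auto intro!: continuous_intros assms)

text \<open>The quotients are jointly continuous in \<open>Z\<close>, \<open>A\<close> and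
  \<open>y\<close>. Compactness of the sphere makes the continuity in \<open>(Z, A)\<close> uniform
  in \<open>y\<close>, and a uniform bound on the change of the quotients is a bound on the change
  of their supremum.\<close>

lemma continuous_on_teich_norm:
  assumes S: "\<And>Z A. (Z, A) \<in> S \<Longrightarrow> pos_def Z \<and> transpose A = A"
  shows "continuous_on S (\<lambda>(Z, A). teich_norm Z (A::real^'n^'n))"
  unfolding continuous_on_iff
proof (intro ballI allI impI)
  fix p0 :: "(real^'n^'n) \<times> (real^'n^'n)" and e :: real assume p0: "p0 \<in> S" and "e > 0"
  define f where "f = (\<lambda>(p, y). \<bar>quad_form (snd p :: real^'n^'n) y\<bar> / (2 * quad_form (fst p) y))"
  have pos: "quad_form (fst p) y > 0" if "p \<in> S" "y \<in> sphere 0 1" for p y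
    using S[of "fst p" "snd p"] that by (auto intro!: pos_def_inner_pos)
  have "continuous_on (S \<times> sphere 0 1) f"
    unfolding f_def split_beta using pos by (intro continuous_intros) force
  from continuous_on_prod_compactE[OF this compact_sphere p0 half_gt_zero[OF \<open>e > 0\<close>]]
  obtain X where X: "p0 \<in> X" "open X" "\<forall>p\<in>X \<inter> S. \<forall>y\<in>sphere 0 1. dist (f (p, y)) (f (p0, y)) \<le> e / 2"
    by blast
  have le: "(\<lambda>(Z, A). teich_norm Z A) p \<le> c \<longleftrightarrow> (\<forall>y\<in>sphere 0 1. f (p, y) \<le> c)" if "p \<in> S" for p c
    using teich_norm_le_iff_sphere[of "fst p" "snd p" c] S[of "fst p" "snd p"] that
    by (cases p) (simp add: f_def)
  obtain d where "d > 0" and d: "ball p0 d \<subseteq> X" using X openE by blast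
  show "\<exists>d>0. \<forall>p\<in>S. dist p p0 < d \<longrightarrow> dist ((\<lambda>(Z, A). teich_norm Z A) p) ((\<lambda>(Z, A). teich_norm Z A) p0) < e"
  proof (intro exI[of _ d] conjI \<open>d > 0\<close> ballI impI)
    fix p assume p: "p \<in> S" "dist p p0 < d"
    then have "p \<in> X" using d by (auto simp: dist_commute)
    then have c: "\<bar>f (p, y) - f (p0, y)\<bar> \<le> e / 2" if "y \<in> sphere 0 1" for y
      using X(3) p(1) that by (auto simp: dist_real_def)
    have "(\<lambda>(Z, A). teich_norm Z A) p \<le> (\<lambda>(Z, A). teich_norm Z A) p0 + e / 2"
      unfolding le[OF p(1)] using le[OF p0, of "(\<lambda>(Z, A). teich_norm Z A) p0"] c by (smt (verit))
    moreover have "(\<lambda>(Z, A). teich_norm Z A) p0 \<le> (\<lambda>(Z, A). teich_norm Z A) p + e / 2"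
      unfolding le[OF p0] using le[OF p(1), of "(\<lambda>(Z, A). teich_norm Z A) p"] c by (smt (verit))
    ultimately show "dist ((\<lambda>(Z, A). teich_norm Z A) p) ((\<lambda>(Z, A). teich_norm Z A) p0) < e"
      using \<open>e > 0\<close> by (simp add: dist_real_def)
  qed
qed

lemma quad_form_add_matrix: "quad_form (A + B) y = quad_form A y + quad_form B y"
  and quad_form_scale_matrix: "quad_form (r *\<^sub>R A) y = r * quad_form A y"
  by (simp_all add: matrix_vector_mult_add_rdistrib inner_add_right scaleR_matrix_vector_assoc[symmetric])

text \<open>Used twice, for \<open>r\<close> and for \<open>1 / r\<close> applied to
  \<open>r *\<^sub>R A\<close>, to obtain both halves of homogeneity.\<close>

lemma teich_norm_scale_le:
  assumes W: "pos_def W" and A: "transpose A = A" and r: "r > 0"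
  shows "teich_norm W (r *\<^sub>R A) \<le> r * teich_norm W A"
proof -
  have "\<bar>quad_form (r *\<^sub>R A) y\<bar> \<le> 2 * (r * teich_norm W A) * quad_form W y" for y
    using mult_left_mono[OF teich_norm_bound[OF W A, of y], of r] r
    by (simp only: quad_form_scale_matrix abs_mult) (simp add: mult_ac)
  then show ?thesis using W A by (subst teich_norm_le_iff) (auto simp: transpose_scalar)
qed

theorem finsler_metric_teich_norm:
  "finsler_metric (posdef1 :: (real^'n^'n) set) posdef1_tangent teich_norm"
  unfolding finsler_metric_def
proof (intro conjI ballI allI impI)
  show "continuous_on (Sigma (posdef1 :: (real^'n^'n) set) posdef1_tangent) (\<lambda>(Z, A). teich_norm Z A)"
    by (rule continuous_on_teich_norm) (auto simp: posdef1_imp_pos_def posdef1_tangent_symmetric)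
next
  fix Z v :: "real^'n^'n" assume Z: "Z \<in> posdef1" and v: "v \<in> posdef1_tangent Z"
  note pd = posdef1_imp_pos_def[OF Z] and sv = posdef1_tangent_symmetric[OF v]
  show "0 \<le> teich_norm Z v" by (rule teich_norm_nonneg[OF pd sv])
  show "teich_norm Z v = 0 \<longleftrightarrow> v = 0"
  proof
    assume "teich_norm Z v = 0"
    then have "quad_form v y = 0" for y using teich_norm_bound[OF pd sv, of y] by simp
    then show "v = 0" by (rule symmetric_quad_form_eq_zero[OF sv])
  next
    assume "v = 0"
    then have "teich_norm Z v \<le> 0" using teich_norm_le_iff[OF pd sv, of 0] by simp
    then show "teich_norm Z v = 0" using teich_norm_nonneg[OF pd sv] by simp
  qed
next
  fix Z v w :: "real^'n^'n" assume Z: "Z \<in> posdef1" and v: "v \<in> posdef1_tangent Z" and w: "w \<in> posdef1_tangent Z"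
  note pd = posdef1_imp_pos_def[OF Z] and sv = posdef1_tangent_symmetric[OF v]
    and sw = posdef1_tangent_symmetric[OF w]
  have s: "transpose (v + w) = v + w" using sv sw by (simp add: vec_eq_iff transpose_def)
  have "\<bar>quad_form (v + w) y\<bar> \<le> 2 * (teich_norm Z v + teich_norm Z w) * quad_form Z y" for y
    using teich_norm_bound[OF pd sv, of y] teich_norm_bound[OF pd sw, of y]
    unfolding quad_form_add_matrix by (simp add: algebra_simps)
  then show "teich_norm Z (v + w) \<le> teich_norm Z v + teich_norm Z w"
    using teich_norm_le_iff[OF pd s] by blast
next
  fix Z v :: "real^'n^'n" and r :: real
  assume Z: "Z \<in> posdef1" and v: "v \<in> posdef1_tangent Z" and r: "r > 0"
  note pd = posdef1_imp_pos_def[OF Z] and sv = posdef1_tangent_symmetric[OF v]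
  have sr: "transpose (r *\<^sub>R v) = r *\<^sub>R v" by (simp add: transpose_scalar sv)
  have "teich_norm Z v \<le> (1 / r) * teich_norm Z (r *\<^sub>R v)"
    using teich_norm_scale_le[OF pd sr, of "1 / r"] r by simp
  then show "teich_norm Z (r *\<^sub>R v) = r * teich_norm Z v"
    using teich_norm_scale_le[OF pd sv r] r by (simp add: field_simps)
qed

subsection \<open>One-parameter families\<close>

text \<open>The translate by \<open>h\<close> of a one-parameter group of diagonal matrices: a
  geodesic of the symmetric space whose pencil eigenvalues relative to
  \<open>h ** transpose h\<close> grow exponentially at the rates \<open>l $ i\<close>.\<close>

definition diag_flow :: "real^'n^'n \<Rightarrow> real^'n \<Rightarrow> real \<Rightarrow> real^'n^'n" where
  "diag_flow h l t = h ** diag_matrix (\<chi> i. exp (t * l $ i)) ** transpose h"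

lemma congruence_split:
  "(h ** diag_matrix a) ** diag_matrix b ** transpose (h ** diag_matrix a) = h ** diag_matrix (a * b * a) ** transpose h"
  by (metis diag_matrix_mult matrix_mul_assoc matrix_transpose_mul transpose_diag_matrix)

lemma invertible_congruence_diag:
  assumes "invertible (h::real^'n^'n)" "\<And>i. a $ i \<noteq> 0"
  shows "invertible (h ** diag_matrix a)"
  using assms by (simp add: invertible_det_nz det_mul det_diag_matrix)

text \<open>Halving the exponents writes the point at time \<open>t\<close> as
  \<open>k ** transpose k\<close>. The pencil lemmas can then be based at any time of the flow, and
  only differences of times remain in the exponents.\<close>

lemma diag_flow_eq_square:
  "diag_flow h l t = (h ** diag_matrix (\<chi> i. exp (t * l $ i / 2))) ** transpose (h ** diag_matrix (\<chi> i. exp (t * l $ i / 2)))"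
proof -
  have "(\<chi> i. exp (t * l $ i)) = (\<chi> i. exp (t * l $ i / 2)) * 1 * (\<chi> i. exp (t * l $ i / 2))"
    by (simp add: vec_eq_iff exp_add[symmetric])
  then show ?thesis using congruence_split[of h "\<chi> i. exp (t * l $ i / 2)" 1]
    by (simp add: diag_flow_def diag_matrix_one)
qed

lemma hilbert_dist_diag_flow:
  fixes h :: "real^'n^'n"
  assumes "invertible h"
  shows "hilbert_dist (diag_flow h l t) (diag_flow h l u) = \<bar>t - u\<bar> * (1/2 * Max (range (\<lambda>i. \<bar>l $ i\<bar>)))"
proof -
  define k where "k = h ** diag_matrix (\<chi> i. exp (u * l $ i / 2))"
  have k: "invertible k" unfolding k_def using assms by (intro invertible_congruence_diag) auto
  have t: "diag_flow h l t = k ** diag_matrix (\<chi> i. exp ((t - u) * l $ i)) ** transpose k"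
    unfolding k_def congruence_split diag_flow_def
    by (intro arg_cong2[of _ _ _ _ "(**)"] arg_cong[of _ _ diag_matrix] refl)
      (simp add: vec_eq_iff exp_add[symmetric] algebra_simps)
  have "hilbert_dist (diag_flow h l t) (diag_flow h l u) = Max (range (\<lambda>i. 1/2 * \<bar>(t - u) * l $ i\<bar>))"
    unfolding t diag_flow_eq_square[of h l u, folded k_def] by (subst hilbert_dist_pencil[OF k]) auto
  also have "\<dots> = Max ((\<lambda>x. \<bar>t - u\<bar> * (1/2 * x)) ` range (\<lambda>i. \<bar>l $ i\<bar>))"
    by (simp add: image_image abs_mult mult_ac)
  also have "\<dots> = \<bar>t - u\<bar> * (1/2 * Max (range (\<lambda>i. \<bar>l $ i\<bar>)))"
    by (rule mono_Max_commute[symmetric]) (auto intro!: monoI mult_left_mono)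
  finally show ?thesis .
qed

text \<open>Relative to the square factor \<open>k\<close> of the point at time \<open>t\<close>,
  the velocity is the congruence of the constant diagonal \<open>l\<close>. Hence the speed does not
  depend on \<open>t\<close>.\<close>

lemma teich_norm_diag_flow:
  fixes h :: "real^'n^'n"
  assumes "invertible h"
  shows "teich_norm (diag_flow h l t) (h ** diag_matrix (\<chi> i. l $ i * exp (t * l $ i)) ** transpose h)
    = 1/2 * Max (range (\<lambda>i. \<bar>l $ i\<bar>))"
proof -
  define k where "k = h ** diag_matrix (\<chi> i. exp (t * l $ i / 2))"
  have k: "invertible k" unfolding k_def using assms by (intro invertible_congruence_diag) auto
  have "h ** diag_matrix (\<chi> i. l $ i * exp (t * l $ i)) ** transpose h = k ** diag_matrix l ** transpose k"
    unfolding k_def congruence_split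
    by (intro arg_cong2[of _ _ _ _ "(**)"] arg_cong[of _ _ diag_matrix] refl)
      (simp add: vec_eq_iff exp_add[symmetric] mult_ac)
  then show ?thesis
    unfolding diag_flow_eq_square[of h l t, folded k_def] by (simp add: teich_norm_pencil[OF k])
qed

lemma diag_flow_has_vector_derivative:
  "(diag_flow h l has_vector_derivative (h ** diag_matrix (\<chi> i. l $ i * exp (t * l $ i)) ** transpose h)) (at t)"
proof -
  have "((\<lambda>t. \<Sum>i\<in>UNIV. exp (t * l $ i) *\<^sub>R (h ** diag_matrix (axis i 1) ** transpose h)) has_vector_derivative
     (\<Sum>i\<in>UNIV. (l $ i * exp (t * l $ i)) *\<^sub>R (h ** diag_matrix (axis i 1) ** transpose h))) (at t)"
    by (intro has_vector_derivative_sum bounded_linear.has_vector_derivative[OF bounded_linear_scaleR_left])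
      (auto intro!: derivative_eq_intros simp flip: has_real_derivative_iff_has_vector_derivative)
  moreover have "diag_flow h l = (\<lambda>t. \<Sum>i\<in>UNIV. exp (t * l $ i) *\<^sub>R (h ** diag_matrix (axis i 1) ** transpose h))"
    by (rule ext) (unfold diag_flow_def, subst congruence_diag_expand, simp)
  moreover have "h ** diag_matrix (\<chi> i. l $ i * exp (t * l $ i)) ** transpose h
      = (\<Sum>i\<in>UNIV. (l $ i * exp (t * l $ i)) *\<^sub>R (h ** diag_matrix (axis i 1) ** transpose h))"
    by (subst congruence_diag_expand) simp
  ultimately show ?thesis by simp
qed

lemma det_diag_flow: "det (diag_flow h l t) = (det h)\<^sup>2 * exp (t * (\<Sum>i\<in>UNIV. l $ i))"
  by (simp add: diag_flow_def det_mul det_diag_matrix exp_sum sum_distrib_left power2_eq_square)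

lemma pos_def_diag_flow: "invertible h \<Longrightarrow> pos_def (diag_flow h l t)"
  unfolding diag_flow_def by (rule pos_def_congruence) auto

text \<open>The rates are the logarithms of the pencil eigenvalues. Determinant 1 at both ends
  forces the rates to sum to zero, which keeps the whole curve in determinant 1.\<close>

lemma diag_flow_connecting:
  fixes p q :: "real^'n^'n"
  assumes "p \<in> posdef1" "q \<in> posdef1"
  obtains h :: "real^'n^'n" and l where "invertible h" "diag_flow h l 0 = p" "diag_flow h l 1 = q"
    "\<And>t. diag_flow h l t \<in> posdef1"
proof -
  have pd: "pos_def p" "pos_def q" using assms by (auto simp: posdef1_iff)
  obtain h :: "real^'n^'n" and d where h: "invertible h" "p = h ** transpose h" "q = h ** diag_matrix d ** transpose h"
    using simultaneous_diagonalization[OF pd(1)] pd(2) by (metis pos_def_def)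
  have pos: "d $ i > 0" for i using pencil_diag_pos[OF h(1)] pd(2) h(3) by simp
  define l where "l = (\<chi> i. ln (d $ i))"
  have E0: "diag_flow h l 0 = p"
  proof -
    have "(\<chi> i. exp (0 * l $ i)) = 1" by (simp add: vec_eq_iff)
    then show ?thesis by (simp only: diag_flow_def h(2) diag_matrix_one matrix_mul_rid)
  qed
  have "(\<chi> i. exp (1 * l $ i)) = d" by (simp add: vec_eq_iff l_def pos)
  then have E1: "diag_flow h l 1 = q" by (simp only: diag_flow_def h(3))
  have "(det h)\<^sup>2 = 1" using det_diag_flow[of h l 0] E0 assms(1) by (simp add: posdef1_iff)
  moreover from this have "(\<Sum>i\<in>UNIV. l $ i) = 0"
    using det_diag_flow[of h l 1] E1 assms(2) by (simp add: posdef1_iff)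
  ultimately have "diag_flow h l t \<in> posdef1" for t
    using h(1) by (simp add: posdef1_iff pos_def_diag_flow det_diag_flow)
  then show thesis using that[OF h(1) E0 E1] by blast
qed

subsection \<open>The path distance\<close>

lemma bounded_linear_transpose: "bounded_linear (transpose :: real^'n^'n \<Rightarrow> real^'n^'n)"
  by (rule linear_conv_bounded_linear[THEN iffD1])
    (simp add: linear_iff transpose_def vec_eq_iff)

lemma bounded_linear_quad_form_matrix: "bounded_linear (\<lambda>A::real^'n^'n. quad_form A y)"
  by (rule linear_conv_bounded_linear[THEN iffD1])
    (simp add: linear_iff quad_form_add_matrix quad_form_scale_matrix)

text \<open>Transposition is bounded linear and fixes the path near \<open>t\<close>, so it fixes
  the velocity. The norm estimates are stated for symmetric matrices only.\<close>

lemma symmetric_path_derivative: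
  fixes \<gamma> :: "real \<Rightarrow> real^'n^'n"
  assumes d: "(\<gamma> has_vector_derivative v) (at t)" and t: "t \<in> {0<..<1}"
    and s: "\<And>u. u \<in> {0..1} \<Longrightarrow> transpose (\<gamma> u) = \<gamma> u"
  shows "transpose v = v"
proof -
  have "((\<lambda>u. transpose (\<gamma> u)) has_vector_derivative transpose v) (at t)"
    by (rule bounded_linear.has_vector_derivative[OF bounded_linear_transpose d])
  then have "(\<gamma> has_vector_derivative transpose v) (at t)"
    by (rule has_vector_derivative_transform_within_open[of _ _ _ "{0<..<1}"]) (use t s in auto)
  then show ?thesis using d vector_derivative_unique_at by blast
qed

text \<open>Each coordinate \<open>P \<mapsto> ln (y \<bullet> P y)\<close> changes along a path at no more than twice its speed.\<close>

lemma hilbert_dist_le_path_length: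
  fixes \<gamma> :: "real \<Rightarrow> real^'n^'n"
  assumes vp: "valid_path \<gamma>" and im: "path_image \<gamma> \<subseteq> posdef1"
    and int: "(\<lambda>t. teich_norm (\<gamma> t) (vector_derivative \<gamma> (at t))) integrable_on {0..1}"
  shows "hilbert_dist (pathstart \<gamma>) (pathfinish \<gamma>)
    \<le> integral {0..1} (\<lambda>t. teich_norm (\<gamma> t) (vector_derivative \<gamma> (at t)))"
proof -
  let ?F = "\<lambda>t. teich_norm (\<gamma> t) (vector_derivative \<gamma> (at t))"
  let ?I = "integral {0..1} ?F"
  have pd: "pos_def (\<gamma> t)" if "t \<in> {0..1}" for t
    using im that posdef1_imp_pos_def by (force simp: path_image_def)
  have cont: "continuous_on {0..1} \<gamma>" using vp by (simp add: valid_path_def piecewise_C1_differentiable_on_def)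
  obtain S where S: "finite S" "\<gamma> C1_differentiable_on ({0..1} - S)"
    using vp by (auto simp: valid_path_def piecewise_C1_differentiable_on_def)
  \<comment> \<open>The end points join the exceptional set because symmetry of the velocity is
    established only at interior times; outside \<open>{0..1}\<close> nothing is known about the
    path.\<close>
  define S' where "S' = S \<union> {0, 1}"
  have S': "finite S'" using S(1) by (simp add: S'_def)
  have der: "(\<gamma> has_vector_derivative vector_derivative \<gamma> (at t)) (at t)" if "t \<in> {0..1} - S'" for t
    using S(2) that by (auto simp: C1_differentiable_on_eq S'_def vector_derivative_works[symmetric])
  have key: "\<bar>ln (quad_form (\<gamma> 1) y) - ln (quad_form (\<gamma> 0) y)\<bar> \<le> 2 * ?I" if "y \<noteq> 0" for y
  proof -
    define g where "g t = quad_form (vector_derivative \<gamma> (at t)) y / quad_form (\<gamma> t) y" for t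
    have pos: "quad_form (\<gamma> t) y > 0" if "t \<in> {0..1}" for t
      using pd[OF that] \<open>y \<noteq> 0\<close> by (rule pos_def_inner_pos)
    have "(g has_integral (ln (quad_form (\<gamma> 1) y) - ln (quad_form (\<gamma> 0) y))) {0..1}"
    proof (rule fundamental_theorem_of_calculus_interior_strong[OF S'])
      show "continuous_on {0..1} (\<lambda>t. ln (quad_form (\<gamma> t) y))"
        using pos by (intro continuous_intros cont) force
      fix t assume t: "t \<in> {0<..<1} - S'"
      have "((\<lambda>t. quad_form (\<gamma> t) y) has_vector_derivative quad_form (vector_derivative \<gamma> (at t)) y) (at t)"
        using t by (intro bounded_linear.has_vector_derivative[OF bounded_linear_quad_form_matrix der]) auto
      then have "((\<lambda>t. quad_form (\<gamma> t) y) has_real_derivative quad_form (vector_derivative \<gamma> (at t)) y) (at t)"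
        by (simp add: has_real_derivative_iff_has_vector_derivative)
      then have "((\<lambda>t. ln (quad_form (\<gamma> t) y)) has_real_derivative g t) (at t)"
        using pos[of t] t by (auto intro!: derivative_eq_intros simp: g_def)
      then show "((\<lambda>t. ln (quad_form (\<gamma> t) y)) has_vector_derivative g t) (at t)"
        by (simp add: has_real_derivative_iff_has_vector_derivative)
    qed auto
    \<comment> \<open>Both integrands are set to 0 on the finite set \<open>S'\<close>, since the
      comparison of integrals asks for a pointwise bound at every time.\<close>
    then have gi: "((\<lambda>t. if t \<in> S' then 0 else g t) has_integral (ln (quad_form (\<gamma> 1) y) - ln (quad_form (\<gamma> 0) y))) {0..1}"
      by (rule has_integral_spike_finite[OF S', rotated]) auto
    have Fi: "((\<lambda>t. if t \<in> S' then 0 else 2 * ?F t) has_integral (2 * ?I)) {0..1}"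
      by (rule has_integral_spike_finite[OF S', of _ _ "\<lambda>t. 2 * ?F t"])
        (use has_integral_mult_right[OF integrable_integral[OF int]] in auto)
    have "norm (integral {0..1} (\<lambda>t. if t \<in> S' then 0 else g t)) \<le> integral {0..1} (\<lambda>t. if t \<in> S' then 0 else 2 * ?F t)"
    proof (rule integral_norm_bound_integral)
      show "(\<lambda>t. if t \<in> S' then 0 else g t) integrable_on {0..1}" using gi by blast
      show "(\<lambda>t. if t \<in> S' then 0 else 2 * ?F t) integrable_on {0..1}" using Fi by blast
      fix t :: real assume t: "t \<in> {0..1}"
      show "norm (if t \<in> S' then 0 else g t) \<le> (if t \<in> S' then 0 else 2 * ?F t)"
      proof (cases "t \<in> S'")
        case False
        then have t': "t \<in> {0..1} - S'" "t \<in> {0<..<1}" using t by (auto simp: S'_def)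
        have "transpose (vector_derivative \<gamma> (at t)) = vector_derivative \<gamma> (at t)"
          using symmetric_path_derivative[OF der[OF t'(1)] t'(2)] pd by (simp add: pos_def_def)
        from teich_norm_bound[OF pd[OF t] this, of y] pos[OF t] False
        show ?thesis by (simp add: g_def abs_mult field_simps)
      qed simp
    qed
    then show ?thesis using gi Fi by (simp add: integral_unique)
  qed
  have "exp (- 2 * ?I) * quad_form (\<gamma> 1) y \<le> quad_form (\<gamma> 0) y \<and> quad_form (\<gamma> 0) y \<le> exp (2 * ?I) * quad_form (\<gamma> 1) y" for y
  proof (cases "y = 0")
    case False
    have pos: "quad_form (\<gamma> 0) y > 0" "quad_form (\<gamma> 1) y > 0"
      using pd[of 0] pd[of 1] False by (auto intro!: pos_def_inner_pos)
    have "ln (quad_form (\<gamma> 1) y) + (- 2 * ?I) \<le> ln (quad_form (\<gamma> 0) y)"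
      "ln (quad_form (\<gamma> 0) y) \<le> ln (quad_form (\<gamma> 1) y) + 2 * ?I"
      using key[OF False] by linarith+
    then have "exp (ln (quad_form (\<gamma> 1) y) + (- 2 * ?I)) \<le> exp (ln (quad_form (\<gamma> 0) y))"
      "exp (ln (quad_form (\<gamma> 0) y)) \<le> exp (ln (quad_form (\<gamma> 1) y) + 2 * ?I)"
      by (simp_all only: exp_le_cancel_iff)
    then show ?thesis using pos by (simp only: exp_add exp_ln mult.commute)
  qed simp
  then show ?thesis using pd[of 0] pd[of 1]
    by (subst hilbert_dist_le_iff) (auto simp: pathstart_def pathfinish_def)
qed

theorem path_distance_teich_norm:
  fixes p q :: "real^'n^'n"
  assumes "p \<in> posdef1" "q \<in> posdef1"
  shows "path_distance posdef1 teich_norm p q = hilbert_dist p q"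
  unfolding path_distance_def
proof (rule cInf_eq_minimum)
  obtain h :: "real^'n^'n" and l where h: "invertible h" "diag_flow h l 0 = p" "diag_flow h l 1 = q"
    "\<And>t. diag_flow h l t \<in> posdef1" using diag_flow_connecting[OF assms] by metis
  let ?g = "diag_flow h l"
  have vd: "vector_derivative ?g (at t) = h ** diag_matrix (\<chi> i. l $ i * exp (t * l $ i)) ** transpose h" for t
    by (rule vector_derivative_at[OF diag_flow_has_vector_derivative])
  have sp: "teich_norm (?g t) (vector_derivative ?g (at t)) = hilbert_dist p q" for t
    unfolding vd teich_norm_diag_flow[OF h(1)] using hilbert_dist_diag_flow[OF h(1), of l 0 1] by (simp add: h(2,3))
  have "?g C1_differentiable_on {0..1}"
    unfolding C1_differentiable_on_def
  proof (intro exI conjI ballI)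
    fix t show "(?g has_vector_derivative (h ** diag_matrix (\<chi> i. l $ i * exp (t * l $ i)) ** transpose h)) (at t)"
      by (rule diag_flow_has_vector_derivative)
    show "continuous_on {0..1} (\<lambda>t. h ** diag_matrix (\<chi> i. l $ i * exp (t * l $ i)) ** transpose h)"
      by (subst congruence_diag_expand) (simp, intro continuous_intros)
  qed
  then have "valid_path ?g" by (simp add: valid_path_def C1_differentiable_imp_piecewise)
  then show "hilbert_dist p q \<in> {integral {0..1} (\<lambda>t. teich_norm (\<gamma> t) (vector_derivative \<gamma> (at t))) | \<gamma>.
     valid_path \<gamma> \<and> path_image \<gamma> \<subseteq> posdef1 \<and> pathstart \<gamma> = p \<and> pathfinish \<gamma> = q \<and>
     (\<lambda>t. teich_norm (\<gamma> t) (vector_derivative \<gamma> (at t))) integrable_on {0..1}}"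
    using h(2,3,4) by (intro CollectI exI[of _ ?g]) (auto simp: sp path_image_def pathstart_def pathfinish_def)
qed (use hilbert_dist_le_path_length in auto)

text \<open>An orthogonal diagonalization of \<open>X\<close> turns the exponentials into a diagonal
  flow with orthogonal \<open>h\<close>; the zero trace is the condition that the rates sum to
  zero.\<close>

theorem hilbert_dist_matrix_exp:
  fixes X :: "real^'n^'n"
  assumes "X \<in> traceless_sym"
  shows "matrix_exp (t *\<^sub>R X) \<in> posdef1"
    and "hilbert_dist (matrix_exp (t *\<^sub>R X)) (matrix_exp (u *\<^sub>R X))
      = \<bar>t - u\<bar> * hilbert_dist (matrix_exp (0 *\<^sub>R X)) (matrix_exp (1 *\<^sub>R X))"
proof -
  obtain Q d where Q: "orthogonal_matrix Q" "X = Q ** diag_matrix d ** transpose Q"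
    using assms symmetric_matrix_diagonalization by (auto simp: traceless_sym_def)
  have iQ: "invertible Q" using Q(1) by (auto simp: orthogonal_matrix_def invertible_def)
  have E: "matrix_exp (t *\<^sub>R X) = diag_flow Q d t" for t
  proof -
    have "t *\<^sub>R X = Q ** diag_matrix (t *\<^sub>R d) ** transpose Q"
      unfolding Q(2) congruence_diag_expand[of Q d] congruence_diag_expand[of Q "t *\<^sub>R d"]
      by (simp add: scaleR_sum_right)
    then show ?thesis by (simp add: matrix_exp_diag[OF Q(1)] diag_flow_def)
  qed
  have "(\<Sum>i\<in>UNIV. d $ i) = trace (transpose Q ** (Q ** diag_matrix d))"
    by (metis Q(1) matrix_mul_assoc matrix_mul_lid orthogonal_matrix trace_diag_matrix)
  also have "\<dots> = 0" using assms by (simp add: trace_mul_sym[of "transpose Q"] Q(2)[symmetric] traceless_sym_def)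
  finally have tr: "(\<Sum>i\<in>UNIV. d $ i) = 0" .
  have "det Q * det Q = 1"
    by (metis Q(1) det_I det_mul det_transpose orthogonal_matrix)
  then show "matrix_exp (t *\<^sub>R X) \<in> posdef1"
    using tr iQ by (simp add: E posdef1_iff pos_def_diag_flow det_diag_flow power2_eq_square)
  show "hilbert_dist (matrix_exp (t *\<^sub>R X)) (matrix_exp (u *\<^sub>R X))
      = \<bar>t - u\<bar> * hilbert_dist (matrix_exp (0 *\<^sub>R X)) (matrix_exp (1 *\<^sub>R X))"
    unfolding E hilbert_dist_diag_flow[OF iQ] by simp
qed

section \<open>Absolutely continuous functions\<close>

text \<open>The gauge is adapted to the derivative at the points of differentiability. The intervals
  tagged by the exceptional null set lie in an open set of small measure, where absolute continuity
  makes the total variation small.\<close>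

theorem abs_continuous_fundamental_theorem:
  fixes h :: "real \<Rightarrow> 'a::real_normed_vector"
  assumes ab: "a \<le> b" and ac: "abs_continuous_between a b h" and N: "negligible N"
    and der: "\<And>t. t \<in> {a..b} - N \<Longrightarrow> (h has_vector_derivative h' t) (at t within {a..b})"
  shows "(h' has_integral (h b - h a)) {a..b}"
proof (cases "a = b")
  case False
  then have "a < b" using ab by simp
  \<comment> \<open>On \<open>N\<close> the values of \<open>h'\<close> are arbitrary. With the
    value 0 there, a tag in \<open>N\<close> contributes just an increment of \<open>h\<close>,
    which absolute continuity controls.\<close>
  define f where "f t = (if t \<in> N then 0 else h' t)" for t
  have "(f has_integral (h b - h a)) {a..b}"
    unfolding has_integral_factor_content_real
  proof (intro allI impI)
    fix e :: real assume "e > 0"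
    have e2: "e * (b - a) / 2 > 0" using \<open>e > 0\<close> \<open>a < b\<close> by simp
    obtain \<delta> where "\<delta> > 0" and \<delta>: "\<And>D. finite D \<Longrightarrow> (\<forall>(s, t)\<in>D. a \<le> s \<and> s \<le> t \<and> t \<le> b) \<Longrightarrow>
       pairwise (\<lambda>(s, t) (s', t'). disjnt {s<..<t} {s'<..<t'}) D \<Longrightarrow>
       (\<Sum>(s, t)\<in>D. t - s) < \<delta> \<Longrightarrow> (\<Sum>(s, t)\<in>D. norm (h t - h s)) < e * (b - a) / 2"
      using ac[unfolded abs_continuous_between_def, rule_format, OF e2] by blast
    have Nn: "N \<in> null_sets lebesgue" using N by (simp add: negligible_iff_null_sets)
    obtain T where T: "open T" "N \<subseteq> T" "T - N \<in> lmeasurable" "emeasure lebesgue (T - N) < ennreal \<delta>"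
      using sets_lebesgue_outer_open[OF null_setsD2[OF Nn] \<open>\<delta> > 0\<close>] by blast
    have "T = (T - N) \<union> N" using T(2) by blast
    then have eT: "emeasure lebesgue T < ennreal \<delta>"
      by (metis Nn T(3,4) emeasure_Un_null_set fmeasurableD)
    have Tm: "T \<in> lmeasurable"
      using eT T(1) by (auto simp: fmeasurable_def less_top[symmetric] intro: order.strict_trans)
    have "\<exists>d>0. (t \<in> N \<longrightarrow> ball t d \<subseteq> T) \<and> (t \<in> {a..b} - N \<longrightarrow>
        (\<forall>y\<in>{a..b}. norm (y - t) < d \<longrightarrow> norm (h y - h t - (y - t) *\<^sub>R h' t) \<le> e / 2 * norm (y - t)))" for t
    proof (cases "t \<in> N")
      case True
      then show ?thesis using T(1,2) by (metis DiffD2 openE subsetD)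
    next
      case False
      then show ?thesis
      proof (cases "t \<in> {a..b}")
        case True
        with False have "(h has_vector_derivative h' t) (at t within {a..b})" by (intro der) auto
        then show ?thesis using \<open>e > 0\<close> False
          unfolding has_vector_derivative_def has_derivative_within_alt by (metis half_gt_zero)
      qed (use False in \<open>auto intro: zero_less_one\<close>)
    qed
    then obtain d where d: "\<And>t. d t > 0" "\<And>t. t \<in> N \<Longrightarrow> ball t (d t) \<subseteq> T"
      "\<And>t y. t \<in> {a..b} - N \<Longrightarrow> y \<in> {a..b} \<Longrightarrow> norm (y - t) < d t \<Longrightarrow>
        norm (h y - h t - (y - t) *\<^sub>R h' t) \<le> e / 2 * norm (y - t)" by metis
    show "\<exists>\<gamma>. gauge \<gamma> \<and> (\<forall>p. p tagged_division_of {a..b} \<and> \<gamma> fine p \<longrightarrow>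
      norm ((\<Sum>(x, k)\<in>p. measure lborel k *\<^sub>R f x) - (h b - h a)) \<le> e * measure lborel {a..b})"
    proof (intro exI conjI allI impI)
      show "gauge (\<lambda>t. ball t (d t))" using d(1) by (simp add: gauge_ball_dependent)
      fix p assume p: "p tagged_division_of {a..b} \<and> (\<lambda>t. ball t (d t)) fine p"
      have fin: "finite p" using p by blast
      have K: "k = {Inf k..Sup k} \<and> x \<in> k \<and> Inf k \<le> x \<and> x \<le> Sup k \<and> k \<subseteq> {a..b} \<and> a \<le> Inf k \<and> Sup k \<le> b
          \<and> measure lborel k = Sup k - Inf k \<and> k \<subseteq> ball x (d x)" if "(x, k) \<in> p" for x k
      proof -
        have x: "x \<in> k" "k \<subseteq> {a..b}" using p that by (auto simp: tagged_division_of)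
        have "\<exists>u v. k = cbox u v" by (rule tagged_division_ofD(4)[OF conjunct1[OF p] that])
        then obtain u v where uv: "k = cbox u v" by blast
        have "u \<le> v" using x(1) uv by auto
        then have "Inf k = u" "Sup k = v" by (auto simp: uv)
        moreover have "k \<subseteq> ball x (d x)" using p that by (auto simp: fine_def)
        ultimately show ?thesis using x uv \<open>u \<le> v\<close> by auto
      qed
      let ?r = "\<lambda>(x, k). measure lborel k *\<^sub>R f x - (h (Sup k) - h (Inf k))"
      have "(\<Sum>(x, k)\<in>p. h (Sup k) - h (Inf k)) = h b - h a"
        using p additive_tagged_division_1[OF ab] by blast
      then have "(\<Sum>(x, k)\<in>p. measure lborel k *\<^sub>R f x) - (h b - h a) = (\<Sum>q\<in>p. ?r q)"
        by (simp add: split_beta sum_subtractf)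
      also have "norm \<dots> \<le> (\<Sum>q\<in>p. norm (?r q))" by (rule norm_sum)
      also have "\<dots> = (\<Sum>q\<in>{q\<in>p. fst q \<notin> N}. norm (?r q)) + (\<Sum>q\<in>{q\<in>p. fst q \<in> N}. norm (?r q))"
        using fin by (subst sum.union_disjoint[symmetric]) (auto intro!: sum.cong)
      finally have split: "norm ((\<Sum>(x, k)\<in>p. measure lborel k *\<^sub>R f x) - (h b - h a))
        \<le> (\<Sum>q\<in>{q\<in>p. fst q \<notin> N}. norm (?r q)) + (\<Sum>q\<in>{q\<in>p. fst q \<in> N}. norm (?r q))" .
      have good: "(\<Sum>q\<in>{q\<in>p. fst q \<notin> N}. norm (?r q)) \<le> e / 2 * (b - a)"
      proof -
        have "norm (?r q) \<le> e / 2 * measure lborel (snd q)" if "q \<in> p" "fst q \<notin> N" for q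
        proof -
          obtain x k where q: "q = (x, k)" by fastforce
          note Kx = K[of x k, folded q, OF that(1)]
          have x: "x \<in> {a..b} - N" using Kx that(2) q by auto
          have ends: "Inf k \<in> {a..b}" "Sup k \<in> {a..b}" "norm (Inf k - x) < d x" "norm (Sup k - x) < d x"
          proof -
            have "Inf k \<in> k" "Sup k \<in> k" using Kx by (metis atLeastAtMost_iff order_refl order_trans)+
            then show "Inf k \<in> {a..b}" "Sup k \<in> {a..b}" "norm (Inf k - x) < d x" "norm (Sup k - x) < d x"
              using Kx by (auto simp: dist_norm norm_minus_commute)
          qed
          \<comment> \<open>The increment over the interval is split at its tag, because the
            derivative estimate is centred there.\<close>
          have "?r q = - (h (Sup k) - h x - (Sup k - x) *\<^sub>R h' x) + (h (Inf k) - h x - (Inf k - x) *\<^sub>R h' x)"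
          proof -
            have "measure lborel k = Sup k - Inf k" using Kx by blast
            then show ?thesis using x by (simp add: q f_def scaleR_diff_left)
          qed
          also have "norm \<dots> \<le> norm (h (Sup k) - h x - (Sup k - x) *\<^sub>R h' x) + norm (h (Inf k) - h x - (Inf k - x) *\<^sub>R h' x)"
            by (metis norm_minus_cancel norm_triangle_ineq)
          also have "\<dots> \<le> e / 2 * norm (Sup k - x) + e / 2 * norm (Inf k - x)"
            using d(3)[OF x ends(1,3)] d(3)[OF x ends(2,4)] by simp
          also have "\<dots> = e / 2 * measure lborel (snd q)"
          proof -
            have "norm (Sup k - x) + norm (Inf k - x) = measure lborel k" using Kx by auto
            then show ?thesis by (metis distrib_left q snd_conv)
          qed
          finally show ?thesis .
        qed
        then have "(\<Sum>q\<in>{q\<in>p. fst q \<notin> N}. norm (?r q)) \<le> (\<Sum>q\<in>{q\<in>p. fst q \<notin> N}. e / 2 * measure lborel (snd q))"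
          by (intro sum_mono) auto
        also have "\<dots> \<le> (\<Sum>q\<in>p. e / 2 * measure lborel (snd q))"
          using fin \<open>e > 0\<close> by (intro sum_mono2) auto
        also have "\<dots> = e / 2 * (\<Sum>(x, k)\<in>p. measure lborel k)" by (simp add: sum_distrib_left split_beta)
        also have "(\<Sum>(x, k)\<in>p. measure lborel k) = b - a"
          using additive_content_tagged_division[of p a b] p ab by simp
        finally show ?thesis .
      qed
      have bad: "(\<Sum>q\<in>{q\<in>p. fst q \<in> N}. norm (?r q)) \<le> e * (b - a) / 2"
      proof -
        \<comment> \<open>Degenerate intervals contribute 0 and are dropped. The remaining ones have
          disjoint nonempty interiors, so their pairs of end points are distinct and can index the
          sum in the definition of absolute continuity.\<close>
        define J where "J = {q\<in>p. fst q \<in> N \<and> Inf (snd q) < Sup (snd q)}"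
        define E where "E = (\<lambda>q. (Inf (snd q), Sup (snd q))) ` J"
        have dis: "disjnt {Inf (snd q)<..<Sup (snd q)} {Inf (snd r)<..<Sup (snd r)}"
          if "q \<in> J" "r \<in> J" "q \<noteq> r" for q r
        proof -
          have "interior (snd q) \<inter> interior (snd r) = {}"
            using p that tagged_division_ofD(5)[of p "{a..b}" "fst q" "snd q" "fst r" "snd r"]
            by (auto simp: J_def prod_eq_iff)
          moreover have "interior (snd q) = {Inf (snd q)<..<Sup (snd q)}" if "q \<in> J" for q
            using K[of "fst q" "snd q"] that by (metis (no_types, lifting) J_def interior_atLeastAtMost_real mem_Collect_eq prod.collapse)
          ultimately show ?thesis using that by (simp add: disjnt_def)
        qed
        have inj: "inj_on (\<lambda>q. (Inf (snd q), Sup (snd q))) J"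
        proof (rule inj_onI, rule ccontr)
          fix q r assume qr: "q \<in> J" "r \<in> J" "(Inf (snd q), Sup (snd q)) = (Inf (snd r), Sup (snd r))" "q \<noteq> r"
          then have "{Inf (snd q)<..<Sup (snd q)} = {}" using dis[OF qr(1,2,4)] by (simp add: disjnt_def)
          then show False using qr(1) by (simp add: J_def)
        qed
        have finJ: "finite J" using fin by (simp add: J_def)
        have "(\<Sum>(s, t)\<in>E. norm (h t - h s)) < e * (b - a) / 2"
        proof (rule \<delta>)
          show "finite E" using finJ by (simp add: E_def)
          show "\<forall>(s, t)\<in>E. a \<le> s \<and> s \<le> t \<and> t \<le> b"
            using K by (fastforce simp: E_def J_def)
          show "pairwise (\<lambda>(s, t) (s', t'). disjnt {s<..<t} {s'<..<t'}) E"
            unfolding pairwise_def E_def using dis by auto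
          have "(\<Sum>(s, t)\<in>E. t - s) = (\<Sum>q\<in>J. Sup (snd q) - Inf (snd q))"
            unfolding E_def by (subst sum.reindex[OF inj]) (simp add: o_def)
          also have "\<dots> = (\<Sum>q\<in>J. measure lebesgue {Inf (snd q)<..<Sup (snd q)})"
            by (intro sum.cong refl) (simp add: J_def)
          also have "\<dots> = measure lebesgue (\<Union>q\<in>J. {Inf (snd q)<..<Sup (snd q)})"
          proof (rule measure_finite_Union[symmetric, OF finJ])
            show "disjoint_family_on (\<lambda>q. {Inf (snd q)<..<Sup (snd q)}) J"
              using dis by (simp only: disjoint_family_on_def disjnt_def) blast
            fix q assume "q \<in> J"
            then show "emeasure lebesgue {Inf (snd q)<..<Sup (snd q)} \<noteq> \<infinity>" by (simp add: J_def less_imp_le)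
          qed auto
          also have "\<dots> \<le> measure lebesgue T"
          proof (rule measure_mono_fmeasurable)
            show "(\<Union>q\<in>J. {Inf (snd q)<..<Sup (snd q)}) \<subseteq> T"
            proof (intro UN_least subsetI)
              fix q y assume q: "q \<in> J" and y: "y \<in> {Inf (snd q)<..<Sup (snd q)}"
              have "(fst q, snd q) \<in> p" using q by (simp add: J_def)
              note Kq = K[OF this]
              have "y \<in> {Inf (snd q)..Sup (snd q)}" using y by simp
              then have "y \<in> snd q" using Kq by simp
              then have "y \<in> ball (fst q) (d (fst q))" using Kq by blast
              then show "y \<in> T" using d(2)[of "fst q"] q unfolding J_def by blast
            qed
          qed (use Tm finJ in auto)
          also have "\<dots> < \<delta>" using eT \<open>\<delta> > 0\<close> Tm by (simp add: emeasure_eq_measure2 ennreal_less_iff)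
          finally show "(\<Sum>(s, t)\<in>E. t - s) < \<delta>" .
        qed
        moreover have "(\<Sum>q\<in>{q\<in>p. fst q \<in> N}. norm (?r q)) = (\<Sum>q\<in>J. norm (?r q))"
        proof (rule sum.mono_neutral_right)
          show "\<forall>q\<in>{q \<in> p. fst q \<in> N} - J. norm (?r q) = 0"
          proof
            fix q assume q: "q \<in> {q \<in> p. fst q \<in> N} - J"
            then have "(fst q, snd q) \<in> p" by simp
            from K[OF this] q have "Inf (snd q) = Sup (snd q)" by (auto simp: J_def)
            then show "norm (?r q) = 0" using q by (simp add: split_beta f_def)
          qed
        qed (use fin in \<open>auto simp: J_def\<close>)
        moreover have "(\<Sum>(s, t)\<in>E. norm (h t - h s)) = (\<Sum>q\<in>J. norm (?r q))"
          unfolding E_def by (subst sum.reindex[OF inj])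
            (auto simp: o_def J_def f_def split_beta norm_minus_commute intro!: sum.cong)
        ultimately show ?thesis by simp
      qed
      show "norm ((\<Sum>(x, k)\<in>p. measure lborel k *\<^sub>R f x) - (h b - h a)) \<le> e * measure lborel {a..b}"
        using split good bad ab by (simp add: algebra_simps)
    qed
  qed
  then show ?thesis
    by (rule has_integral_spike[OF N, rotated]) (auto simp: f_def)
qed (use has_integral_refl(2)[of h' b] in simp)

section \<open>Integrals of periodic functions over fundamental domains\<close>

text \<open>A Borel fundamental domain of arbitrary shape. Parallelepipeds alone would not do,
  because the image of one under a homeomorphism must qualify as well.\<close>

definition tiles :: "'a::euclidean_space set \<Rightarrow> 'a set \<Rightarrow> bool" where
  "tiles \<Lambda> Q \<longleftrightarrow> Q \<in> sets borel \<and> (\<forall>x. \<exists>!l. l \<in> \<Lambda> \<and> x - l \<in> Q)"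

lemma nn_integral_lborel_translate:
  fixes c :: "'a::euclidean_space"
  assumes [measurable]: "f \<in> borel_measurable borel"
  shows "(\<integral>\<^sup>+x. f (c + x) \<partial>lborel) = (\<integral>\<^sup>+x. f x \<partial>lborel)"
  by (subst (2) lborel_distr_plus[of c, symmetric]) (simp add: nn_integral_distr)

text \<open>That exactly one translate of a tile covers a given point, in the form in which it is
  inserted as a factor 1 into a double integral.\<close>

lemma nn_integral_count_space_unique:
  assumes "\<exists>!l. l \<in> \<Lambda> \<and> P l"
  shows "(\<integral>\<^sup>+l. indicator {l. P l} l \<partial>count_space \<Lambda>) = 1"
proof -
  obtain l0 where l0: "l0 \<in> \<Lambda>" "P l0" "\<And>l. l \<in> \<Lambda> \<Longrightarrow> P l \<Longrightarrow> l = l0" using assms by blast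
  have "(\<integral>\<^sup>+l. indicator {l. P l} l \<partial>count_space \<Lambda>) = (\<integral>\<^sup>+l. indicator {l0} l \<partial>count_space \<Lambda>)"
  proof (intro nn_integral_cong)
    fix l assume "l \<in> space (count_space \<Lambda>)"
    then have "l \<in> \<Lambda>" by simp
    then have "P l \<longleftrightarrow> l = l0" using l0 by blast
    then show "indicator {l. P l} l = (indicator {l0} l :: ennreal)" by (simp add: indicator_def)
  qed
  also have "\<dots> = emeasure (count_space \<Lambda>) {l0}" using l0(1) by (intro nn_integral_indicator) simp
  also have "\<dots> = 1" using l0(1) by simp
  finally show ?thesis .
qed

text \<open>Unfolding: the factor 1, as the sum of the indicators of all translates of
  \<open>Q\<close>, is inserted into the integral over \<open>Q'\<close>; sum and integral are
  exchanged, each term is translated by its lattice vector, and the sum is collected over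
  \<open>Q'\<close> instead. Countability of the lattice makes the counting measure sigma-finite, as
  the exchange requires.\<close>

theorem nn_integral_tiles_eq:
  fixes u :: "'a::euclidean_space \<Rightarrow> ennreal"
  assumes c: "countable \<Lambda>" and neg: "\<And>l. l \<in> \<Lambda> \<Longrightarrow> - l \<in> \<Lambda>"
    and Q: "tiles \<Lambda> Q" and Q': "tiles \<Lambda> Q'"
    and u[measurable]: "u \<in> borel_measurable borel" and per: "\<And>l x. l \<in> \<Lambda> \<Longrightarrow> u (x + l) = u x"
  shows "(\<integral>\<^sup>+x\<in>Q. u x \<partial>lborel) = (\<integral>\<^sup>+x\<in>Q'. u x \<partial>lborel)"
proof -
  have [measurable]: "Q \<in> sets borel" "Q' \<in> sets borel" using Q Q' by (auto simp: tiles_def)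
  interpret C: sigma_finite_measure "count_space \<Lambda>" by (rule sigma_finite_measure_count_space_countable[OF c])
  interpret pair_sigma_finite "count_space \<Lambda>" "lborel :: 'a measure" ..
  define f where "f = (\<lambda>(l, x). indicator Q (x - l) * (indicator Q' x * u x))"
  define g where "g = (\<lambda>(l, x). indicator Q x * (indicator Q' (x + l) * u x))"
  have fm: "f \<in> borel_measurable (count_space \<Lambda> \<Otimes>\<^sub>M lborel)"
    by (rule measurable_pair_measure_countable1[OF c]) (simp add: f_def)
  have gm: "g \<in> borel_measurable (count_space \<Lambda> \<Otimes>\<^sub>M lborel)"
    by (rule measurable_pair_measure_countable1[OF c]) (simp add: g_def)
  have "(\<integral>\<^sup>+x\<in>Q'. u x \<partial>lborel) = (\<integral>\<^sup>+x. (\<integral>\<^sup>+l. f (l, x) \<partial>count_space \<Lambda>) \<partial>lborel)"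
  proof (rule nn_integral_cong)
    fix x
    have "(\<integral>\<^sup>+l. f (l, x) \<partial>count_space \<Lambda>) = (\<integral>\<^sup>+l. indicator {l. x - l \<in> Q} l * (indicator Q' x * u x) \<partial>count_space \<Lambda>)"
      by (intro nn_integral_cong) (simp add: f_def indicator_def)
    also have "\<dots> = indicator Q' x * u x"
      using Q by (subst nn_integral_multc) (auto simp: tiles_def nn_integral_count_space_unique)
    finally show "u x * indicator Q' x = (\<integral>\<^sup>+l. f (l, x) \<partial>count_space \<Lambda>)" by (simp add: mult.commute)
  qed
  also have "\<dots> = (\<integral>\<^sup>+l. (\<integral>\<^sup>+x. f (l, x) \<partial>lborel) \<partial>count_space \<Lambda>)"
    by (rule Fubini'[OF _]) (use fm in simp)
  also have "\<dots> = (\<integral>\<^sup>+l. (\<integral>\<^sup>+x. g (l, x) \<partial>lborel) \<partial>count_space \<Lambda>)"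
  proof (rule nn_integral_cong)
    fix l assume l: "l \<in> space (count_space \<Lambda>)"
    have "(\<integral>\<^sup>+x. f (l, x) \<partial>lborel) = (\<integral>\<^sup>+x. f (l, l + x) \<partial>lborel)"
      by (rule nn_integral_lborel_translate[symmetric]) (simp add: f_def)
    then show "(\<integral>\<^sup>+x. f (l, x) \<partial>lborel) = (\<integral>\<^sup>+x. g (l, x) \<partial>lborel)"
      using per[of l] l by (simp add: f_def g_def add.commute[of l])
  qed
  also have "\<dots> = (\<integral>\<^sup>+x. (\<integral>\<^sup>+l. g (l, x) \<partial>count_space \<Lambda>) \<partial>lborel)"
    by (rule Fubini'[OF _, symmetric]) (use gm in simp)
  also have "\<dots> = (\<integral>\<^sup>+x\<in>Q. u x \<partial>lborel)"
  proof (rule nn_integral_cong)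
    fix x
    \<comment> \<open>After the translation the lattice vector appears with the opposite sign, so
      the unique translate of \<open>Q'\<close> is found at \<open>- l\<close>.\<close>
    have ex: "\<exists>!l. l \<in> \<Lambda> \<and> x + l \<in> Q'"
    proof -
      obtain l where l: "l \<in> \<Lambda>" "x - l \<in> Q'" "\<And>m. m \<in> \<Lambda> \<Longrightarrow> x - m \<in> Q' \<Longrightarrow> m = l"
        using Q' unfolding tiles_def by metis
      show ?thesis
      proof (rule ex1I[of _ "- l"])
        show "- l \<in> \<Lambda> \<and> x + - l \<in> Q'" using l(1,2) neg by simp
        fix m assume "m \<in> \<Lambda> \<and> x + m \<in> Q'"
        then have "- m = l" using l(3)[of "- m"] neg by simp
        then show "m = - l" by (metis minus_minus)
      qed
    qed
    have "(\<integral>\<^sup>+l. g (l, x) \<partial>count_space \<Lambda>) = (\<integral>\<^sup>+l. indicator {l. x + l \<in> Q'} l * (indicator Q x * u x) \<partial>count_space \<Lambda>)"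
      by (intro nn_integral_cong) (simp add: g_def indicator_def)
    also have "\<dots> = indicator Q x * u x"
      by (subst nn_integral_multc) (auto simp: nn_integral_count_space_unique[OF ex])
    finally show "(\<integral>\<^sup>+l. g (l, x) \<partial>count_space \<Lambda>) = u x * indicator Q x" by (simp add: mult.commute)
  qed
  finally show ?thesis by simp
qed

text \<open>Reduces to the nonnegative case: \<open>f = norm\<close> transfers integrability, and
  the identity and its negative, cut off at 0 by \<open>ennreal\<close>, transfer the positive and
  negative parts.\<close>

lemma set_integral_tiles_eq:
  fixes u :: "'a::euclidean_space \<Rightarrow> real"
  assumes c: "countable \<Lambda>" and neg: "\<And>l. l \<in> \<Lambda> \<Longrightarrow> - l \<in> \<Lambda>"
    and Q: "tiles \<Lambda> Q" and Q': "tiles \<Lambda> Q'"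
    and u[measurable]: "u \<in> borel_measurable borel" and per: "\<And>l x. l \<in> \<Lambda> \<Longrightarrow> u (x + l) = u x"
    and int: "set_integrable lborel Q u"
  shows "set_integrable lborel Q' u \<and> (LINT x:Q'|lborel. u x) = (LINT x:Q|lborel. u x)"
proof -
  have [measurable]: "Q \<in> sets borel" "Q' \<in> sets borel" using Q Q' by (auto simp: tiles_def)
  have eq: "(\<integral>\<^sup>+x. ennreal (f (indicator Q x *\<^sub>R u x)) \<partial>lborel) = (\<integral>\<^sup>+x. ennreal (f (indicator Q' x *\<^sub>R u x)) \<partial>lborel)"
    if [measurable]: "f \<in> borel_measurable borel" and "f 0 = 0" for f :: "real \<Rightarrow> real"
  proof -
    have "(\<integral>\<^sup>+x. ennreal (f (indicator S x *\<^sub>R u x)) \<partial>lborel) = (\<integral>\<^sup>+x\<in>S. ennreal (f (u x)) \<partial>lborel)" for S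
      using that(2) by (intro nn_integral_cong) (auto simp: indicator_def)
    then show ?thesis
      using nn_integral_tiles_eq[OF c neg Q Q', of "\<lambda>x. ennreal (f (u x))"] per by simp
  qed
  have i: "set_integrable lborel Q' u"
    using int eq[of norm] unfolding set_integrable_def integrable_iff_bounded by simp
  then show ?thesis
    using int eq[of "\<lambda>x. x"] eq[of "\<lambda>x. - x"]
    unfolding set_lebesgue_integral_def set_integrable_def by (simp add: real_lebesgue_integral_def)
qed

lemma tiles_translate:
  assumes "tiles \<Lambda> Q"
  shows "tiles \<Lambda> ((+) a ` Q)"
proof -
  have "(+) a ` Q = (\<lambda>x. x - a) -` Q" by (force simp: image_iff algebra_simps)
  moreover have "(\<lambda>x. x - a) -` Q \<in> sets borel"
    using assms measurable_sets[of "\<lambda>x. x - a" borel borel Q] by (simp add: tiles_def)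
  moreover have "\<exists>!l. l \<in> \<Lambda> \<and> x - l \<in> (\<lambda>x. x - a) -` Q" for x
  proof -
    have "\<exists>!l. l \<in> \<Lambda> \<and> (x - a) - l \<in> Q" using assms by (simp add: tiles_def)
    then show ?thesis by (simp add: algebra_simps)
  qed
  ultimately show ?thesis by (simp add: tiles_def)
qed

section \<open>Lattices and fundamental domains\<close>

lemma int_lattice_eq_range: "int_lattice = range (\<lambda>z::int^'n. \<chi> i. of_int (z $ i))"
proof -
  have "x \<in> range (\<lambda>z::int^'n. \<chi> i. of_int (z $ i))" if "x \<in> int_lattice" for x :: "real^'n"
  proof -
    have "\<forall>i. \<exists>k::int. x $ i = of_int k" using that by (auto simp: int_lattice_def Ints_def)
    then obtain k :: "'n \<Rightarrow> int" where "\<And>i. x $ i = of_int (k i)" by metis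
    then have "x = (\<chi> i. of_int ((\<chi> i. k i) $ i))" by (simp add: vec_eq_iff)
    then show ?thesis by blast
  qed
  then show ?thesis by (auto simp: int_lattice_def)
qed

lemma countable_int_lattice: "countable (int_lattice :: (real^'n) set)"
  unfolding int_lattice_eq_range by simp

lemma int_lattice_zero [simp]: "0 \<in> int_lattice"
  and int_lattice_add: "x \<in> int_lattice \<Longrightarrow> y \<in> int_lattice \<Longrightarrow> x + y \<in> int_lattice"
  and int_lattice_minus: "x \<in> int_lattice \<Longrightarrow> - x \<in> int_lattice"
  and int_lattice_axis [simp]: "axis i 1 \<in> int_lattice"
  by (auto simp: int_lattice_def axis_def)

abbreviation lattice :: "real^'n^'n \<Rightarrow> (real^'n) set" where
  "lattice g \<equiv> (\<lambda>z. g *v z) ` int_lattice"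

lemma countable_lattice: "countable (lattice g)"
  using countable_int_lattice by blast

lemma lattice_zero: "0 \<in> lattice g"
  by (metis imageI int_lattice_zero matrix_vector_mult_0_right)

lemma lattice_add: "x \<in> lattice g \<Longrightarrow> y \<in> lattice g \<Longrightarrow> x + y \<in> lattice g"
  by (auto simp: matrix_vector_right_distrib[symmetric] int_lattice_add)

lemma matrix_vector_mult_minus: "(A::real^'n^'m) *v (- x) = - (A *v x)"
  by (simp add: vec_eq_iff matrix_vector_mult_def sum_negf)

lemma lattice_minus: "x \<in> lattice g \<Longrightarrow> - x \<in> lattice g"
  by (auto simp: matrix_vector_mult_minus[symmetric] int_lattice_minus)

lemma lattice_diff: "x \<in> lattice g \<Longrightarrow> y \<in> lattice g \<Longrightarrow> x - y \<in> lattice g"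
  using lattice_add[of x g "- y"] lattice_minus[of y g] by simp

lemma matrix_vector_mul_cancel:
  fixes g :: "real^'n^'n"
  assumes "det g \<noteq> 0"
  shows "g *v (matrix_inv g *v x) = x" "matrix_inv g *v (g *v x) = x"
  using assms
  by (simp_all add: matrix_vector_mul_assoc matrix_inv_right_real matrix_inv_left_real invertible_det_nz)

lemma sum_axis: "(\<Sum>i\<in>UNIV. v $ i *\<^sub>R axis i 1) = (v :: real^'n)"
  by (simp add: vec_eq_iff axis_def if_distrib[of "\<lambda>z. _ * z"] cong: if_cong)

definition fundamental_domain :: "real^'n^'n \<Rightarrow> (real^'n) set" where
  "fundamental_domain g = (\<lambda>x. g *v x) ` {x. \<forall>i. 0 \<le> x $ i \<and> x $ i < 1}"

lemma borel_half_open_cube: "{x::real^'n. \<forall>i. 0 \<le> x $ i \<and> x $ i < 1} \<in> sets borel"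
proof -
  have "{x::real^'n. \<forall>i. 0 \<le> x $ i \<and> x $ i < 1} = (\<Inter>i. {x. 0 \<le> x $ i} \<inter> {x. x $ i < 1})" by auto
  also have "\<dots> \<in> sets borel"
    by (intro sets.countable_INT'' sets.Int borel_closed borel_open closed_Collect_le open_Collect_less continuous_intros) auto
  finally show ?thesis .
qed

lemma fundamental_domain_vimage:
  assumes "det g \<noteq> 0"
  shows "fundamental_domain g = (\<lambda>x. matrix_inv g *v x) -` {x. \<forall>i. 0 \<le> x $ i \<and> x $ i < 1}"
proof (intro equalityI subsetI)
  fix x assume "x \<in> (\<lambda>x. matrix_inv g *v x) -` {x. \<forall>i. 0 \<le> x $ i \<and> x $ i < 1}"
  then have "g *v (matrix_inv g *v x) \<in> fundamental_domain g"
    unfolding fundamental_domain_def by (intro imageI) simp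
  then show "x \<in> fundamental_domain g" by (simp only: matrix_vector_mul_cancel[OF assms])
qed (auto simp: fundamental_domain_def matrix_vector_mul_cancel[OF assms] simp del: matrix_vector_mul_assoc)

lemma tiles_fundamental_domain:
  fixes g :: "real^'n^'n"
  assumes g: "det g \<noteq> 0"
  shows "tiles (lattice g) (fundamental_domain g)"
proof -
  have "continuous_on UNIV (\<lambda>x. matrix_inv g *v x)" by (rule matrix_vector_mult_linear_continuous_on)
  then have "(\<lambda>x. matrix_inv g *v x) \<in> borel_measurable borel" by (rule borel_measurable_continuous_onI)
  then have "fundamental_domain g \<in> sets borel"
    unfolding fundamental_domain_vimage[OF g] by (rule measurable_sets_borel[OF _ borel_half_open_cube])
  moreover have "\<exists>!l. l \<in> lattice g \<and> x - l \<in> fundamental_domain g" for x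
  proof -
    define y where "y = matrix_inv g *v x"
    define z :: "real^'n" where "z = (\<chi> i. of_int \<lfloor>y $ i\<rfloor>)"
    have mem: "x - g *v w \<in> fundamental_domain g \<longleftrightarrow> (\<forall>i. 0 \<le> y $ i - w $ i \<and> y $ i - w $ i < 1)" for w
      by (simp add: fundamental_domain_vimage[OF g] matrix_vector_mult_diff_distrib matrix_vector_mul_cancel[OF g] y_def)
    show ?thesis
    proof (rule ex1I[of _ "g *v z"])
      show "g *v z \<in> lattice g \<and> x - g *v z \<in> fundamental_domain g"
        unfolding mem by (auto simp: z_def int_lattice_def intro!: imageI) linarith+
      fix l assume l: "l \<in> lattice g \<and> x - l \<in> fundamental_domain g"
      then obtain w where w: "w \<in> int_lattice" "l = g *v w" by blast
      have "w $ i = z $ i" for i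
      proof -
        obtain k :: int where k: "w $ i = of_int k" using w(1) by (auto simp: int_lattice_def Ints_def)
        have "\<forall>i. 0 \<le> y $ i - w $ i \<and> y $ i - w $ i < 1" using l mem[of w] w(2) by metis
        then have "0 \<le> y $ i - of_int k" "y $ i - of_int k < 1" using k by metis+
        then have "\<lfloor>y $ i\<rfloor> = k" by linarith
        then show ?thesis by (simp add: z_def k)
      qed
      then have "w = z" by (simp add: vec_eq_iff)
      then show "l = g *v z" by (simp add: w)
    qed
  qed
  ultimately show ?thesis by (simp add: tiles_def)
qed

lemma bounded_fundamental_domain: "bounded (fundamental_domain g)"
proof -
  have "{x::real^'n. \<forall>i. 0 \<le> x $ i \<and> x $ i < 1} \<subseteq> cbox 0 1" by (auto simp: mem_box_cart less_imp_le)
  then have "bounded {x::real^'n. \<forall>i. 0 \<le> x $ i \<and> x $ i < 1}" using bounded_cbox bounded_subset by blast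
  then show ?thesis unfolding fundamental_domain_def
    by (intro bounded_linear_image matrix_vector_mul_bounded_linear)
qed

text \<open>The half-open unit cube lies between the open and the closed unit box, both of volume 1,
  and the linear map scales volume by 1.\<close>

lemma emeasure_fundamental_domain:
  fixes g :: "real^'n::{finite,wellorder}^'n::_"
  assumes g: "\<bar>det g\<bar> = 1"
  shows "emeasure lborel (fundamental_domain g) = 1"
proof -
  let ?C = "{x::real^'n::_. \<forall>i. 0 \<le> x $ i \<and> x $ i < 1}"
  have ins: "i \<in> Basis \<Longrightarrow> (1::real^'n::_) \<bullet> i = 1" for i
    by (auto simp: Basis_vec_def inner_axis)
  have "emeasure lborel (box 0 (1::real^'n::_)) = 1" "emeasure lborel (cbox 0 (1::real^'n::_)) = 1"
    by (simp_all add: emeasure_lborel_box emeasure_lborel_cbox ins)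
  moreover have "emeasure lborel (box 0 (1::real^'n::_)) \<le> emeasure lborel ?C"
    using borel_half_open_cube by (intro emeasure_mono) (auto simp: mem_box_cart less_imp_le)
  moreover have "emeasure lborel ?C \<le> emeasure lborel (cbox 0 (1::real^'n::_))"
    by (intro emeasure_mono) (auto simp: mem_box_cart less_imp_le)
  ultimately have C: "emeasure lborel ?C = 1" by simp
  have eC: "emeasure lebesgue ?C = 1" using C borel_half_open_cube by simp
  then have Cm: "?C \<in> lmeasurable" using borel_half_open_cube by (intro fmeasurableI) auto
  have "measure lebesgue (fundamental_domain g) = \<bar>det (matrix (\<lambda>x. g *v x))\<bar> * measure lebesgue ?C"
    unfolding fundamental_domain_def by (rule measure_linear_image[OF _ Cm]) simp
  also have "\<dots> = 1" using eC g by (simp add: measure_def)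
  finally have m: "measure lebesgue (fundamental_domain g) = 1" .
  have "fundamental_domain g \<in> lmeasurable"
    unfolding fundamental_domain_def by (rule measurable_linear_image[OF _ Cm]) simp
  then have "emeasure lebesgue (fundamental_domain g) = 1"
    using m by (simp add: emeasure_eq_measure2)
  moreover have "fundamental_domain g \<in> sets borel"
    using tiles_fundamental_domain[of g] g by (simp add: tiles_def)
  ultimately show ?thesis by simp
qed

lemma AE_lborel_translate:
  fixes c :: "'a::euclidean_space"
  assumes "N \<in> null_sets lborel"
  shows "AE x in lborel. c + x \<notin> N"
proof -
  have [measurable]: "N \<in> sets borel" using assms by auto
  have "(\<lambda>x. c + x) -` N \<in> sets borel" using measurable_sets_borel[of "\<lambda>x. c + x" borel N] by simp
  moreover have "emeasure lborel ((\<lambda>x. c + x) -` N) = (\<integral>\<^sup>+x. indicator N (c + x) \<partial>lborel)"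
  proof -
    have "indicator ((\<lambda>x. c + x) -` N) = (\<lambda>x. indicator N (c + x) :: ennreal)" by (auto simp: indicator_def)
    then show ?thesis using calculation by (subst nn_integral_indicator[symmetric]) auto
  qed
  moreover have "\<dots> = (\<integral>\<^sup>+x. indicator N x \<partial>lborel)" by (rule nn_integral_lborel_translate) simp
  ultimately have "(\<lambda>x. c + x) -` N \<in> null_sets lborel"
    using null_setsD1[OF assms] by (intro null_setsI) auto
  then show ?thesis by (rule AE_I') auto
qed

lemma integral_lborel_translate:
  fixes f :: "'a::euclidean_space \<Rightarrow> real"
  assumes [measurable]: "f \<in> borel_measurable borel"
  shows "integrable lborel (\<lambda>x. f (c + x)) \<longleftrightarrow> integrable lborel f"
    and "(\<integral>x. f (c + x) \<partial>lborel) = (\<integral>x. f x \<partial>lborel)"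
  by (subst (2) lborel_distr_plus[of c, symmetric], simp add: integrable_distr_eq integral_distr)+

text \<open>A translated tile is again a tile, so the mean of a periodic function does not see a
  translation, even by a vector outside the lattice.\<close>

lemma set_integral_periodic_translate:
  fixes u :: "'a::euclidean_space \<Rightarrow> real"
  assumes c: "countable \<Lambda>" and neg: "\<And>l. l \<in> \<Lambda> \<Longrightarrow> - l \<in> \<Lambda>" and Q: "tiles \<Lambda> Q"
    and u[measurable]: "u \<in> borel_measurable borel" and per: "\<And>l x. l \<in> \<Lambda> \<Longrightarrow> u (x + l) = u x"
    and int: "set_integrable lborel Q u"
  shows "set_integrable lborel Q (\<lambda>x. u (a + x)) \<and> (LINT x:Q|lborel. u (a + x)) = (LINT x:Q|lborel. u x)"
proof -
  have [measurable]: "(+) a ` Q \<in> sets borel" using tiles_translate[OF Q] by (simp add: tiles_def)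
  have i: "indicator ((+) a ` Q) (a + x) = (indicator Q x :: real)" for x
    by (auto simp: indicator_def)
  have m: "(\<lambda>x. indicator ((+) a ` Q) x *\<^sub>R u x) \<in> borel_measurable borel" by measurable
  show ?thesis
    using set_integral_tiles_eq[OF c neg Q tiles_translate[OF Q, of a] u per int]
      integral_lborel_translate[OF m, of a]
    unfolding set_integrable_def set_lebesgue_integral_def i by simp
qed

section \<open>The dilatation of quasiperiodic homeomorphisms\<close>

text \<open>These are the lifts of torus homeomorphisms homotopic to the one induced by
  \<open>A\<close>. The assumptions are symmetric: the inverse \<open>G\<close> satisfies them for
  the lattice of \<open>A ** g\<close> and the inverse matrix, so every estimate for
  \<open>F\<close> also serves for \<open>G\<close>.\<close>

locale quasiperiodic_homeomorphism =
  fixes g A :: "real^'n::{finite,wellorder}^'n::_" and F G :: "real^'n::_ \<Rightarrow> real^'n::_"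
  assumes det_g: "\<bar>det g\<bar> = 1" and det_A: "\<bar>det A\<bar> = 1"
    and homeo: "homeomorphism UNIV UNIV F G"
    and equivariant: "l \<in> lattice g \<Longrightarrow> F (x + l) = F x + A *v l"
begin

abbreviation Q :: "(real^'n::_) set" where "Q \<equiv> fundamental_domain g"

lemma GF [simp]: "G (F x) = x" and FG [simp]: "F (G x) = x"
  using homeo by (auto simp: homeomorphism_def)

lemma cont_F: "continuous_on UNIV F" and cont_G: "continuous_on UNIV G"
  using homeo by (auto simp: homeomorphism_def)

lemma measurable_F [measurable]: "F \<in> borel_measurable borel"
  and measurable_G [measurable]: "G \<in> borel_measurable borel"
  using cont_F cont_G by (auto intro: borel_measurable_continuous_onI)

lemma image_F_vimage: "F ` S = G -` S"
  by (auto simp: image_iff) (metis FG)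

lemma borel_image_F: "S \<in> sets borel \<Longrightarrow> F ` S \<in> sets borel"
  unfolding image_F_vimage by (rule measurable_sets_borel[OF measurable_G])

lemma inj_F: "inj_on F S"
  by (metis GF inj_onI)

lemma tiles_Q: "tiles (lattice g) Q"
  using det_g by (intro tiles_fundamental_domain) auto

lemma borel_Q [measurable]: "Q \<in> sets borel"
  using tiles_Q by (simp add: tiles_def)

lemma tiles_image: "tiles (lattice (A ** g)) (F ` Q)"
proof -
  have "\<exists>!m. m \<in> lattice (A ** g) \<and> y - m \<in> F ` Q" for y
  proof -
    have mem: "y - A *v l \<in> F ` Q \<longleftrightarrow> G y - l \<in> Q" if "l \<in> lattice g" for l
    proof -
      have "F (G y + (- l)) = F (G y) + A *v (- l)" by (rule equivariant) (rule lattice_minus[OF that])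
      then have "y - A *v l = F (G y - l)" by (simp add: matrix_vector_mult_minus)
      then show ?thesis by (simp add: inj_image_mem_iff inj_F)
    qed
    have lat: "lattice (A ** g) = (\<lambda>l. A *v l) ` lattice g"
      by (simp add: image_image matrix_vector_mul_assoc)
    obtain l where l: "l \<in> lattice g" "G y - l \<in> Q" "\<And>k. k \<in> lattice g \<Longrightarrow> G y - k \<in> Q \<Longrightarrow> k = l"
      using tiles_Q unfolding tiles_def by metis
    show ?thesis
    proof (rule ex1I[of _ "A *v l"])
      show "A *v l \<in> lattice (A ** g) \<and> y - A *v l \<in> F ` Q" using l(1,2) mem[OF l(1)] lat by blast
      fix m assume m: "m \<in> lattice (A ** g) \<and> y - m \<in> F ` Q"
      then obtain k where k: "k \<in> lattice g" "m = A *v k" using lat by blast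
      then show "m = A *v l" using m mem[OF k(1)] l(3)[of k] by simp
    qed
  qed
  then show ?thesis using borel_image_F[OF borel_Q] by (simp add: tiles_def)
qed

lemma emeasure_Q: "emeasure lborel Q = 1"
  using det_g by (rule emeasure_fundamental_domain)

lemma emeasure_image_Q: "emeasure lborel (F ` Q) = 1"
proof -
  have d: "\<bar>det (A ** g)\<bar> = 1" using det_g det_A by (simp add: det_mul abs_mult)
  then have t: "tiles (lattice (A ** g)) (fundamental_domain (A ** g))"
    by (intro tiles_fundamental_domain) auto
  have "(\<integral>\<^sup>+x\<in>F ` Q. 1 \<partial>lborel) = (\<integral>\<^sup>+x\<in>fundamental_domain (A ** g). 1 \<partial>(lborel :: (real^'n::_) measure))"
    by (rule nn_integral_tiles_eq[OF countable_lattice _ tiles_image t]) (auto simp: lattice_minus)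
  moreover have "fundamental_domain (A ** g) \<in> sets borel" using t by (simp add: tiles_def)
  ultimately show ?thesis
    using emeasure_fundamental_domain[OF d] borel_image_F[OF borel_Q] by simp
qed

text \<open>A Borel measurable, periodic version of the directional derivative.\<close>

definition deriv_along :: "real^'n::_ \<Rightarrow> real^'n::_ \<Rightarrow> real^'n::_" where
  "deriv_along e x = lim (\<lambda>k. real (Suc k) *\<^sub>R (F (x + (1 / real (Suc k)) *\<^sub>R e) - F x))"

lemma measurable_deriv_along [measurable]: "deriv_along e \<in> borel_measurable borel"
  unfolding deriv_along_def[abs_def] by measurable

text \<open>The difference quotients at \<open>x + l\<close> and at \<open>x\<close> form the same
  sequence, so the equality holds at every point, also where the sequence diverges.\<close>

lemma periodic_deriv_along: "l \<in> lattice g \<Longrightarrow> deriv_along e (x + l) = deriv_along e x"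
  using equivariant[of l x] equivariant[of l "x + _"] unfolding deriv_along_def
  by (simp add: add.assoc add.commute[of l])

lemma deriv_along_eq:
  assumes "F differentiable (at x)"
  shows "deriv_along e x = frechet_derivative F (at x) e"
proof -
  let ?D = "frechet_derivative F (at x)"
  have D: "(F has_derivative ?D) (at x)" using assms frechet_derivative_works by blast
  have "(\<lambda>k. real (Suc k) *\<^sub>R (F (x + (1 / real (Suc k)) *\<^sub>R e) - F x)) \<longlonglongrightarrow> ?D e"
  proof (cases "e = 0")
    case True
    then show ?thesis using linear_0[OF has_derivative_linear[OF D]] by simp
  next
    case False
    let ?h = "\<lambda>k. (1 / real (Suc k)) *\<^sub>R e"
    have "?h \<longlonglongrightarrow> 0 *\<^sub>R e" by (intro tendsto_intros LIMSEQ_Suc lim_1_over_n)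
    then have h: "filterlim ?h (at 0) sequentially" using False by (simp add: filterlim_at)
    have "(\<lambda>h. norm (F (x + h) - F x - ?D h) / norm h) \<midarrow>0\<rightarrow> 0" using D by (simp add: has_derivative_at)
    from tendsto_mult_left[OF filterlim_compose[OF this h], of "norm e"]
    have "(\<lambda>k. norm e * (norm (F (x + ?h k) - F x - ?D (?h k)) / norm (?h k))) \<longlonglongrightarrow> 0" by simp
    moreover have "norm e * (norm (F (x + ?h k) - F x - ?D (?h k)) / norm (?h k))
        = norm (real (Suc k) *\<^sub>R (F (x + ?h k) - F x) - ?D e)" for k
    proof -
      have "real (Suc k) *\<^sub>R (F (x + ?h k) - F x) - ?D e = real (Suc k) *\<^sub>R (F (x + ?h k) - F x - ?D (?h k))"
        by (simp add: linear_cmul[OF has_derivative_linear[OF D]] scaleR_diff_right del: of_nat_Suc)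
      then show ?thesis using False by (simp del: of_nat_Suc)
    qed
    ultimately have "(\<lambda>k. real (Suc k) *\<^sub>R (F (x + ?h k) - F x) - ?D e) \<longlonglongrightarrow> 0"
      by (simp only: tendsto_norm_zero_iff)
    then show ?thesis by (simp only: Lim_null[symmetric])
  qed
  then show ?thesis unfolding deriv_along_def by (rule limI)
qed

definition jac :: "real^'n::_ \<Rightarrow> real" where
  "jac x = det (\<chi> i j. deriv_along (axis j 1) x $ i)"

lemma measurable_jac [measurable]: "jac \<in> borel_measurable borel"
proof -
  have [measurable]: "(\<lambda>x. deriv_along e x $ i) \<in> borel_measurable borel" for e i
    using measurable_compose[OF measurable_deriv_along, of "\<lambda>v. v $ i" borel e]
    by (simp add: borel_measurable_continuous_onI continuous_on_component)
  show ?thesis unfolding jac_def[abs_def] det_def vec_lambda_beta by measurable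
qed

lemma jac_eq: "F differentiable (at x) \<Longrightarrow> jac x = jacobian F x"
  unfolding jac_def jacobian_def matrix_def by (simp add: deriv_along_eq)

text \<open>The change of variables is exact on the points of differentiability, where
  \<open>F\<close> is injective. The remaining null set may have an image of positive measure, so an
  inequality is what remains for \<open>S\<close>.\<close>

lemma nn_integral_jac_le:
  assumes diff: "AE x in lebesgue. F differentiable (at x)" and S: "S \<in> sets borel"
    and m: "emeasure lborel (F ` S) \<le> ennreal m" "0 \<le> m"
  shows "(\<integral>\<^sup>+x\<in>S. ennreal \<bar>jac x\<bar> \<partial>lborel) \<le> ennreal m"
proof -
  define D where "D = {x. F differentiable (at x)}"
  \<comment> \<open>The set of points of differentiability is measurable by completeness, since its
    complement lies in a null set.\<close>
  have "Measurable.pred lebesgue (\<lambda>x. \<not> F differentiable (at x))"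
    by (rule sets_completion_AE) (use diff in \<open>simp add: AE_completion_iff\<close>)
  then have "{x. \<not> F differentiable (at x)} \<in> sets lebesgue" by (simp add: pred_def)
  moreover have "D = space lebesgue - {x. \<not> F differentiable (at x)}" by (auto simp: D_def)
  ultimately have "D \<in> sets lebesgue" by (metis sets.compl_sets)
  then have SD: "S \<inter> D \<in> sets lebesgue" using S by auto
  have der: "(F has_derivative frechet_derivative F (at x)) (at x within S \<inter> D)" if "x \<in> S \<inter> D" for x
    using that frechet_derivative_works by (auto simp: D_def intro: has_derivative_at_withinI)
  have "F ` (S \<inter> D) \<in> sets lebesgue"
    by (rule differentiable_image_in_sets_lebesgue[OF SD]) (use der in \<open>auto simp: differentiable_on_def differentiable_def\<close>)
  have FS: "F ` S \<in> lmeasurable" using m borel_image_F[OF S]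
    by (intro fmeasurableI) (auto intro: le_less_trans)
  have FSD: "F ` (S \<inter> D) \<in> lmeasurable"
    by (rule fmeasurableI2[OF FS]) (use \<open>F ` (S \<inter> D) \<in> sets lebesgue\<close> in auto)
  have le: "measure lebesgue (F ` (S \<inter> D)) \<le> m"
  proof -
    have "measure lebesgue (F ` (S \<inter> D)) \<le> measure lebesgue (F ` S)"
      using FS FSD by (intro measure_mono_fmeasurable) auto
    also have "\<dots> \<le> m" using m FS borel_image_F[OF S] by (simp add: emeasure_eq_measure2[symmetric] measure_def enn2real_leI)
    finally show ?thesis .
  qed
  have "((\<lambda>x. \<bar>det (matrix (frechet_derivative F (at x)))\<bar>) has_integral measure lebesgue (F ` (S \<inter> D))) (S \<inter> D)"
    using has_measure_differentiable_image[OF SD der inj_F] FSD by blast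
  from nn_integral_has_integral_lebesgue'[OF _ this]
  have "(\<integral>\<^sup>+x\<in>S \<inter> D. ennreal \<bar>jacobian F x\<bar> \<partial>lborel) = ennreal (measure lebesgue (F ` (S \<inter> D)))"
    by (simp add: jacobian_def)
  moreover have "(\<integral>\<^sup>+x\<in>S. ennreal \<bar>jac x\<bar> \<partial>lborel) = (\<integral>\<^sup>+x\<in>S \<inter> D. ennreal \<bar>jacobian F x\<bar> \<partial>lborel)"
    using diff[unfolded AE_completion_iff]
    by (intro nn_integral_cong_AE) (auto simp: jac_eq D_def indicator_def elim!: eventually_mono)
  ultimately show ?thesis using le by (simp add: ennreal_leI)
qed

lemma set_integrable_Q_continuous:
  fixes p :: "real^'n::_ \<Rightarrow> real"
  assumes p: "continuous_on UNIV p"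
  shows "set_integrable lborel Q p"
proof -
  have "compact (closure Q)" using bounded_fundamental_domain compact_closure by blast
  then have "set_integrable lborel (closure Q) p"
    unfolding set_integrable_def by (intro borel_integrable_compact continuous_on_subset[OF p]) auto
  then show ?thesis by (rule set_integrable_subset) (auto simp: closure_subset)
qed

lemma set_integral_Q_const: "(LINT x:Q|lborel. c) = (c::real)"
  by (simp add: set_lebesgue_integral_def measure_def emeasure_Q)

text \<open>Two kinds of lines are discarded: those where absolute continuity fails and those
  meeting the points of non-differentiability in positive length. The latter are handled by Fubini
  for pairs \<open>(t, x)\<close> with \<open>x\<close> ranging over all of space, which avoids
  splitting off a hyperplane.\<close>

lemma AE_line_has_integral:
  assumes acl: "abs_continuous_on_lines F" and diff: "AE x in lebesgue. F differentiable (at x)"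
  shows "AE x in lborel. ((\<lambda>t. deriv_along (axis i 1) (t *\<^sub>R axis i 1 + x)) has_integral (F (axis i 1 + x) - F x)) {0..1}"
proof -
  let ?e = "axis i 1 :: real^'n::_"
  obtain N where N: "N \<in> null_sets lborel" "{x. \<not> F differentiable (at x)} \<subseteq> N"
    using diff[unfolded AE_completion_iff] unfolding eventually_ae_filter by auto
  have [measurable]: "N \<in> sets borel" using N(1) by auto
  have "AE t in (lborel :: real measure). AE x in lborel. t *\<^sub>R ?e + x \<notin> N"
    using AE_lborel_translate[OF N(1)] by simp
  then have "AE x in lborel. AE t in (lborel :: real measure). t *\<^sub>R ?e + x \<notin> N"
  proof -
    have m: "{z \<in> space ((lborel :: real measure) \<Otimes>\<^sub>M lborel). fst z *\<^sub>R ?e + snd z \<notin> N}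
        \<in> sets ((lborel :: real measure) \<Otimes>\<^sub>M lborel)" by measurable
    show "AE t in (lborel :: real measure). AE x in lborel. t *\<^sub>R ?e + x \<notin> N \<Longrightarrow> ?thesis"
      using lborel_pair.AE_commute[OF m] by blast
  qed
  moreover have "AE x in lborel. \<forall>a b. abs_continuous_between a b (\<lambda>t. F (x + t *\<^sub>R ?e))"
    using acl unfolding abs_continuous_on_lines_def AE_completion_iff by blast
  ultimately show ?thesis
  proof eventually_elim
    case (elim x)
    have "((\<lambda>t. deriv_along ?e (t *\<^sub>R ?e + x)) has_integral (F (x + 1 *\<^sub>R ?e) - F (x + 0 *\<^sub>R ?e))) {0..1}"
    proof (rule abs_continuous_fundamental_theorem)
      show "abs_continuous_between 0 1 (\<lambda>t. F (x + t *\<^sub>R ?e))" using elim(2) by blast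
      show "negligible {t. t *\<^sub>R ?e + x \<in> N}"
      proof -
        obtain M where "M \<in> null_sets lborel" "{t. t *\<^sub>R ?e + x \<in> N} \<subseteq> M"
          using elim(1) unfolding eventually_ae_filter by auto
        then show ?thesis
          unfolding negligible_iff_null_sets using null_sets_completion_iff2 by blast
      qed
      fix t :: real assume t: "t \<in> {0..1} - {t. t *\<^sub>R ?e + x \<in> N}"
      have d: "F differentiable (at (x + t *\<^sub>R ?e))" using t N(2) by (auto simp: add.commute)
      let ?D = "frechet_derivative F (at (x + t *\<^sub>R ?e))"
      have "((\<lambda>t. x + t *\<^sub>R ?e) has_vector_derivative ?e) (at t within {0..1})"
        by (auto intro!: derivative_eq_intros simp: has_vector_derivative_def)
      moreover have "(F has_derivative ?D) (at (x + t *\<^sub>R ?e) within (\<lambda>t. x + t *\<^sub>R ?e) ` {0..1})"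
        using d frechet_derivative_works has_derivative_at_withinI by blast
      ultimately have "((\<lambda>t. F (x + t *\<^sub>R ?e)) has_vector_derivative ?D ?e) (at t within {0..1})"
        using vector_derivative_diff_chain_within[of "\<lambda>t. x + t *\<^sub>R ?e" ?e t "{0..1}" F ?D] by (simp add: o_def)
      then show "((\<lambda>t. F (x + t *\<^sub>R ?e)) has_vector_derivative deriv_along ?e (t *\<^sub>R ?e + x)) (at t within {0..1})"
        using deriv_along_eq[OF d] by (simp add: add.commute)
    qed simp
    then show ?case by (simp add: add.commute)
  qed
qed

text \<open>Averaging over all translates of the fundamental domain in the direction of the axis
  integrates the derivative along lines.\<close>

lemma integral_deriv_along:
  assumes acl: "abs_continuous_on_lines F" and diff: "AE x in lebesgue. F differentiable (at x)"
    and int: "set_integrable lborel Q (\<lambda>x. w \<bullet> deriv_along (axis i 1) x)"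
  shows "(LINT x:Q|lborel. w \<bullet> deriv_along (axis i 1) x) = w \<bullet> (A *v axis i 1)"
proof -
  let ?e = "axis i 1 :: real^'n::_"
  let ?u = "\<lambda>x. w \<bullet> deriv_along ?e x"
  let ?I = "LINT x:Q|lborel. ?u x"
  have per: "?u (x + l) = ?u x" if "l \<in> lattice g" for l x using periodic_deriv_along[OF that] by simp
  have um[measurable]: "?u \<in> borel_measurable borel" by measurable
  note tr = set_integral_periodic_translate[OF countable_lattice lattice_minus tiles_Q um per int]
  have abs_int: "set_integrable lborel Q (\<lambda>x. \<bar>?u x\<bar>)" using set_integrable_abs[OF int] .
  have abs_per: "\<bar>?u (x + l)\<bar> = \<bar>?u x\<bar>" if "l \<in> lattice g" for l x using per[OF that] by simp
  have abs_m: "(\<lambda>x. \<bar>?u x\<bar>) \<in> borel_measurable borel" by measurable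
  note atr = set_integral_periodic_translate[OF countable_lattice lattice_minus tiles_Q abs_m abs_per abs_int]
  \<comment> \<open>Integrated in \<open>x\<close> first, every \<open>t\<close> in the unit
    interval gives the same value by periodicity. Integrated in \<open>t\<close> first, the
    derivative becomes the increment of \<open>F\<close> along the axis vector.\<close>
  define f where "f t x = indicator {0..1} t * (indicator Q x * ?u (t *\<^sub>R ?e + x))" for t :: real and x
  have fm: "case_prod f \<in> borel_measurable (lborel \<Otimes>\<^sub>M lborel)"
    unfolding f_def by measurable
  have fint: "integrable (lborel \<Otimes>\<^sub>M lborel) (case_prod f)"
  proof (rule lborel_pair.Fubini_integrable[OF fm])
    have "(\<integral>x. norm (case_prod f (t, x)) \<partial>lborel) = indicator {0..1} t * (LINT x:Q|lborel. \<bar>?u x\<bar>)" for t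
    proof -
      have "(\<integral>x. norm (case_prod f (t, x)) \<partial>lborel) = indicator {0..1} t * (LINT x:Q|lborel. \<bar>?u (t *\<^sub>R ?e + x)\<bar>)"
        by (simp add: f_def abs_mult set_lebesgue_integral_def)
      then show ?thesis using atr[of "t *\<^sub>R ?e"] by simp
    qed
    then show "integrable lborel (\<lambda>t. \<integral>x. norm (case_prod f (t, x)) \<partial>lborel)"
      by (simp add: emeasure_lborel_Icc)
    have "integrable lborel (\<lambda>x. case_prod f (t, x))" for t
      using tr[of "t *\<^sub>R ?e"] by (simp add: f_def set_integrable_def)
    then show "AE t in lborel. integrable lborel (\<lambda>x. case_prod f (t, x))" by simp
  qed
  have "(\<integral>t. (\<integral>x. f t x \<partial>lborel) \<partial>lborel) = (\<integral>t. indicator {0..1} t * ?I \<partial>(lborel :: real measure))"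
    using tr by (intro Bochner_Integration.integral_cong refl) (simp add: f_def set_lebesgue_integral_def)
  then have left: "(\<integral>t. (\<integral>x. f t x \<partial>lborel) \<partial>lborel) = ?I" by simp
  have "AE x in lborel. (\<integral>t. f t x \<partial>lborel) = indicator Q x * (w \<bullet> (F (?e + x) - F x))"
    using AE_line_has_integral[OF acl diff, of i] lborel_pair.AE_integrable_snd[OF fint]
  proof eventually_elim
    case (elim x)
    show ?case
    proof (cases "x \<in> Q")
      case True
      then have "set_integrable lborel {0..1} (\<lambda>t. ?u (t *\<^sub>R ?e + x))"
        using elim(2) by (simp add: f_def set_integrable_def)
      then have "(LINT t:{0..1}|lborel. ?u (t *\<^sub>R ?e + x)) = integral {0..1} (\<lambda>t. ?u (t *\<^sub>R ?e + x))"
        by (rule set_borel_integral_eq_integral)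
      also have "\<dots> = w \<bullet> (F (?e + x) - F x)"
        using has_integral_linear[OF elim(1) bounded_linear_inner_right[of w]] by (simp add: integral_unique o_def)
      finally show ?thesis using True by (simp add: f_def set_lebesgue_integral_def)
    qed (simp add: f_def)
  qed
  then have "(\<integral>x. (\<integral>t. f t x \<partial>lborel) \<partial>lborel) = (LINT x:Q|lborel. w \<bullet> (F (?e + x) - F x))"
    unfolding set_lebesgue_integral_def
    by (intro integral_cong_AE) (use borel_measurable_integrable[OF lborel_pair.integrable_snd[OF fint]] in simp_all)
  also have "\<dots> = w \<bullet> (A *v ?e)"
  proof -
    \<comment> \<open>The axis vector may lie outside the lattice, so the increment of
      \<open>F\<close> along it can vary with \<open>x\<close>. Without its linear part
      \<open>F\<close> is periodic, and the mean of the remaining increment is 0.\<close>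
    define p where "p x = w \<bullet> (F x - A *v x)" for x
    have pc: "continuous_on UNIV p" unfolding p_def
      by (intro continuous_intros cont_F matrix_vector_mult_linear_continuous_on)
    then have pm: "p \<in> borel_measurable borel" by (rule borel_measurable_continuous_onI)
    have pper: "p (x + l) = p x" if "l \<in> lattice g" for l x
      by (simp add: p_def equivariant[OF that] matrix_vector_right_distrib)
    note ptr = set_integral_periodic_translate[OF countable_lattice lattice_minus tiles_Q pm pper
        set_integrable_Q_continuous[OF pc], of ?e]
    have eq: "w \<bullet> (F (?e + x) - F x) = (p (?e + x) - p x) + w \<bullet> (A *v ?e)" for x
      by (simp add: p_def inner_diff_right inner_add_right matrix_vector_right_distrib)
    show ?thesis unfolding eq
      using ptr set_integrable_Q_continuous[OF pc] set_integrable_Q_continuous[OF continuous_on_const]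
      by (simp add: set_integral_add set_integral_diff set_integral_Q_const)
  qed
  finally have right: "(\<integral>x. (\<integral>t. f t x \<partial>lborel) \<partial>lborel) = w \<bullet> (A *v ?e)" .
  show ?thesis using lborel_pair.Fubini_integral[OF fint] left right by simp
qed

text \<open>Convexity of the power function, obtained by scaling Bernoulli's inequality for
  \<open>t / s\<close> by \<open>s ^ n\<close>.\<close>

lemma power_tangent_line:
  fixes s t :: real
  assumes "s \<ge> 0" "t \<ge> 0" "n > 0"
  shows "real n * s ^ (n - 1) * t \<le> t ^ n + real (n - 1) * s ^ n"
proof (cases "s = 0")
  case True
  then show ?thesis using assms by (cases "n = 1") (auto simp: power_0_left)
next
  case False
  then have s: "s > 0" using assms by simp
  have "1 + real n * (t / s - 1) \<le> (1 + (t / s - 1)) ^ n"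
    using assms s by (intro Bernoulli_inequality) simp
  then have "s ^ n * (1 + real n * (t / s - 1)) \<le> s ^ n * (t / s) ^ n"
    using s by (intro mult_left_mono) auto
  also have "s ^ n * (t / s) ^ n = t ^ n" using s by (simp add: power_divide)
  also have "s ^ n * (1 + real n * (t / s - 1)) = real n * s ^ (n - 1) * t - real (n - 1) * s ^ n"
  proof -
    obtain m where "n = Suc m" using assms by (cases n) auto
    then show ?thesis using s by (simp add: field_simps)
  qed
  finally show ?thesis by simp
qed

text \<open>The tangent line of \<open>t \<mapsto> t ^ n\<close> at \<open>s = norm (A *v v)\<close> replaces Hoelder's inequality.\<close>

theorem outer_dilatation_lower_bound:
  assumes acl: "abs_continuous_on_lines F" and diff: "AE x in lebesgue. F differentiable (at x)"
    and K: "K \<ge> 0" and bound: "AE x in lebesgue. onorm (frechet_derivative F (at x)) ^ CARD('n) \<le> K * \<bar>jacobian F x\<bar>"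
  shows "norm (A *v v) ^ CARD('n) \<le> K * norm v ^ CARD('n)"
proof (cases "A *v v = 0")
  case True
  then show ?thesis using K by (simp add: power_0_left)
next
  case False
  let ?n = "CARD('n)"
  let ?O = "\<lambda>x. onorm (frechet_derivative F (at x))"
  have unit: "norm (A *v v) ^ ?n \<le> K" if v: "norm v = 1" "A *v v \<noteq> 0" for v
  proof -
    define s where "s = norm (A *v v)"
    have s: "s > 0" using v by (simp add: s_def)
    \<comment> \<open>Pairing with the unit vector in the direction of \<open>A *v v\<close> makes
      the mean derivative along \<open>v\<close> a scalar equal to \<open>s\<close>, while the
      pairing at each point is at most the operator norm.\<close>
    define w where "w = (1 / s) *\<^sub>R (A *v v)"
    have nw: "norm w = 1" using s by (simp add: w_def s_def)
    have ws: "w \<bullet> (A *v v) = s" using s by (simp add: w_def s_def dot_square_norm power2_eq_square)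
    have good: "AE x in lborel. F differentiable (at x) \<and> ?O x ^ ?n \<le> K * \<bar>jac x\<bar>"
      using diff[unfolded AE_completion_iff] bound[unfolded AE_completion_iff]
      by eventually_elim (simp add: jac_eq)
    have J: "(\<integral>\<^sup>+x\<in>Q. ennreal \<bar>jac x\<bar> \<partial>lborel) \<le> 1"
      using nn_integral_jac_le[OF diff borel_Q, of 1] emeasure_image_Q by simp
    have affine: "(\<integral>\<^sup>+x\<in>Q. ennreal (K * \<bar>jac x\<bar> + c) \<partial>lborel) \<le> ennreal (K + c)" if "c \<ge> 0" for c
    proof -
      have "(\<integral>\<^sup>+x\<in>Q. ennreal (K * \<bar>jac x\<bar> + c) \<partial>lborel)
        = (\<integral>\<^sup>+x. ennreal K * (ennreal \<bar>jac x\<bar> * indicator Q x) + ennreal c * indicator Q x \<partial>lborel)"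
        using K that by (intro nn_integral_cong) (auto simp: ennreal_mult indicator_def)
      also have "\<dots> = ennreal K * (\<integral>\<^sup>+x\<in>Q. ennreal \<bar>jac x\<bar> \<partial>lborel) + ennreal c"
        by (simp add: nn_integral_add nn_integral_cmult emeasure_Q)
      also have "\<dots> \<le> ennreal K * 1 + ennreal c" using J by (intro add_mono mult_left_mono) auto
      also have "\<dots> = ennreal (K + c)" using K that by simp
      finally show ?thesis .
    qed
    have Dle: "\<bar>w \<bullet> deriv_along e x\<bar> \<le> ?O x * norm e" if "F differentiable (at x)" for e x
    proof -
      have "bounded_linear (frechet_derivative F (at x))"
        using that frechet_derivative_works has_derivative_bounded_linear by blast
      then have "norm (frechet_derivative F (at x) e) \<le> ?O x * norm e" by (rule onorm)
      moreover have "\<bar>w \<bullet> deriv_along e x\<bar> \<le> norm w * norm (deriv_along e x)" by (rule Cauchy_Schwarz_ineq2)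
      ultimately show ?thesis using deriv_along_eq[OF that] nw by simp
    qed
    have O0: "0 \<le> ?O x" if "F differentiable (at x)" for x
      using that frechet_derivative_works has_derivative_bounded_linear onorm_pos_le by blast
    have int: "set_integrable lborel Q (\<lambda>x. w \<bullet> deriv_along (axis i 1) x)" for i
      unfolding set_integrable_def
    proof (rule integrableI_bounded)
      have "(\<integral>\<^sup>+x. ennreal (norm (indicator Q x *\<^sub>R (w \<bullet> deriv_along (axis i 1) x))) \<partial>lborel)
        \<le> (\<integral>\<^sup>+x\<in>Q. ennreal (K * \<bar>jac x\<bar> + 1) \<partial>lborel)"
        using good
      proof (intro nn_integral_mono_AE, eventually_elim)
        case (elim x)
        have "?O x \<le> ?O x ^ ?n + 1"
        proof (cases "?O x \<le> 1")
          case False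
          then have "?O x \<le> ?O x ^ ?n" using power_increasing[of 1 ?n "?O x"] by simp
          then show ?thesis by simp
        qed (use zero_le_power[OF O0, of x ?n] elim in auto)
        then have "\<bar>w \<bullet> deriv_along (axis i 1) x\<bar> \<le> K * \<bar>jac x\<bar> + 1"
          using Dle[of x "axis i 1"] elim by simp
        then show ?case by (auto simp: indicator_def intro: ennreal_leI)
      qed
      also have "\<dots> < \<infinity>" using affine[of 1] by (simp add: le_less_trans)
      finally show "(\<integral>\<^sup>+x. ennreal (norm (indicator Q x *\<^sub>R (w \<bullet> deriv_along (axis i 1) x))) \<partial>lborel) < \<infinity>" .
    qed measurable
    define u where "u x = (\<Sum>i\<in>UNIV. v $ i * (w \<bullet> deriv_along (axis i 1) x))" for x
    have iQ: "integrable lborel (\<lambda>x. v $ i * (indicator Q x *\<^sub>R (w \<bullet> deriv_along (axis i 1) x)))" for i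
      using int[of i] unfolding set_integrable_def by (intro integrable_mult_right)
    have uQ: "indicator Q x *\<^sub>R u x = (\<Sum>i\<in>UNIV. v $ i * (indicator Q x *\<^sub>R (w \<bullet> deriv_along (axis i 1) x)))" for x
      by (simp add: u_def sum_distrib_left mult_ac)
    have ui: "set_integrable lborel Q u"
      unfolding set_integrable_def uQ by (intro Bochner_Integration.integrable_sum iQ)
    have "(LINT x:Q|lborel. u x) = (\<Sum>i\<in>UNIV. v $ i * (LINT x:Q|lborel. w \<bullet> deriv_along (axis i 1) x))"
      unfolding set_lebesgue_integral_def uQ
      by (subst Bochner_Integration.integral_sum[OF iQ]) (simp only: integral_mult_right_zero)
    also have "\<dots> = w \<bullet> (A *v (\<Sum>i\<in>UNIV. v $ i *\<^sub>R axis i 1))"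
      by (simp add: integral_deriv_along[OF acl diff int] linear_sum[OF matrix_vector_mul_linear]
          inner_sum_right matrix_vector_mult_scaleR)
    finally have uint: "(LINT x:Q|lborel. u x) = s" by (simp add: sum_axis ws)
    have ueq: "u x \<le> ?O x" if d: "F differentiable (at x)" for x
    proof -
      have "linear (frechet_derivative F (at x))"
        using d frechet_derivative_works has_derivative_linear by blast
      then have "u x = w \<bullet> frechet_derivative F (at x) (\<Sum>i\<in>UNIV. v $ i *\<^sub>R axis i 1)"
        by (simp add: u_def deriv_along_eq[OF d] linear_sum linear_cmul inner_sum_right)
      then show ?thesis using Dle[OF d, of v] deriv_along_eq[OF d] v(1) by (simp add: sum_axis)
    qed
    \<comment> \<open>Slope and offset of the tangent line at \<open>s\<close>. After integration
      the offset cancels all but one copy of \<open>s ^ n\<close> on the left, leaving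
      \<open>s ^ n \<le> K\<close>.\<close>
    let ?c = "real ?n * s ^ (?n - 1)"
    let ?d = "real (?n - 1) * s ^ ?n"
    have "?c * s = (LINT x:Q|lborel. ?c * u x)" using uint by simp
    also have "\<dots> \<le> enn2real (\<integral>\<^sup>+x. ennreal (indicator Q x *\<^sub>R (?c * u x)) \<partial>lborel)"
      using set_integrable_mult_right[of ?c lborel Q u, OF ui]
      unfolding set_lebesgue_integral_def set_integrable_def by (subst real_lebesgue_integral_def) auto
    also have "\<dots> \<le> K + ?d"
    proof (rule enn2real_leI)
      have "(\<integral>\<^sup>+x. ennreal (indicator Q x *\<^sub>R (?c * u x)) \<partial>lborel) \<le> (\<integral>\<^sup>+x\<in>Q. ennreal (K * \<bar>jac x\<bar> + ?d) \<partial>lborel)"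
        using good
      proof (intro nn_integral_mono_AE, eventually_elim)
        case (elim x)
        have "?c * u x \<le> ?c * ?O x" using ueq elim s by (intro mult_left_mono) auto
        also have "\<dots> \<le> ?O x ^ ?n + ?d" using O0 elim s by (intro power_tangent_line) auto
        also have "\<dots> \<le> K * \<bar>jac x\<bar> + ?d" using elim by simp
        finally show ?case by (auto simp: indicator_def intro: ennreal_leI)
      qed
      also have "\<dots> \<le> ennreal (K + ?d)" using s by (intro affine) auto
      finally show "(\<integral>\<^sup>+x. ennreal (indicator Q x *\<^sub>R (?c * u x)) \<partial>lborel) \<le> ennreal (K + ?d)" .
    qed (use K s in auto)
    finally have "?c * s \<le> K + ?d" .
    moreover have "?c * s = s ^ ?n + ?d"
    proof -
      obtain m where "?n = Suc m" by (metis Suc_pred zero_less_card_finite)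
      then show ?thesis by (simp add: algebra_simps)
    qed
    ultimately show ?thesis by (simp add: s_def)
  qed
  have "v \<noteq> 0" using False by auto
  let ?v = "(1 / norm v) *\<^sub>R v"
  have eq: "A *v ?v = (1 / norm v) *\<^sub>R (A *v v)" by (simp add: matrix_vector_mult_scaleR)
  then have "norm (A *v ?v) ^ ?n \<le> K" using False \<open>v \<noteq> 0\<close> by (intro unit) auto
  then have "(norm (A *v v) / norm v) ^ ?n \<le> K" using eq by simp
  then show ?thesis using \<open>v \<noteq> 0\<close> by (simp add: power_divide field_simps)
qed

lemma inverse_quasiperiodic: "quasiperiodic_homeomorphism (A ** g) (matrix_inv A) G F"
proof
  have nz: "det A \<noteq> 0" using det_A by auto
  show "\<bar>det (A ** g)\<bar> = 1" using det_g det_A by (simp add: det_mul abs_mult)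
  have "A ** matrix_inv A = mat 1" using matrix_vector_mul_cancel(1)[OF nz]
    by (simp add: matrix_eq matrix_vector_mul_assoc[symmetric])
  then have "det A * det (matrix_inv A) = 1" by (metis det_I det_mul)
  then show "\<bar>det (matrix_inv A)\<bar> = 1" using det_A by (metis abs_mult abs_one mult_1)
  show "homeomorphism UNIV UNIV G F" using homeo by (rule homeomorphism_symD)
  fix l y assume "l \<in> lattice (A ** g)"
  then obtain z where z: "z \<in> int_lattice" "l = A *v (g *v z)" by (auto simp: matrix_vector_mul_assoc)
  have "F (G y + g *v z) = F (G y) + A *v (g *v z)" by (rule equivariant) (use z in auto)
  then have "y + l = F (G y + g *v z)" by (simp add: z)
  then show "G (y + l) = G y + matrix_inv A *v l"
    using matrix_vector_mul_cancel(2)[OF nz] by (simp add: z)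
qed

end

section \<open>Dilatations\<close>

lemma bdd_above_norm_image_sphere:
  assumes "bounded_linear (T :: real^'n \<Rightarrow> real^'n)"
  shows "bdd_above ((\<lambda>x. norm (T x)) ` sphere 0 1)"
  using onorm[OF assms] by (intro bdd_aboveI2[of _ _ "onorm T"]) (metis mem_sphere_0 mult.right_neutral)

lemma sphere_nonempty: "sphere (0::real^'n) 1 \<noteq> {}"
proof -
  have "(axis undefined 1 :: real^'n) \<in> sphere 0 1" by simp
  then show ?thesis by blast
qed

lemma norm_le_max_stretch:
  assumes T: "bounded_linear (T :: real^'n \<Rightarrow> real^'n)"
  shows "norm (T x) \<le> max_stretch T * norm x"
proof (cases "x = 0")
  case False
  interpret bounded_linear T by fact
  have "norm (T ((1 / norm x) *\<^sub>R x)) \<le> max_stretch T" unfolding max_stretch_def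
    using False by (intro cSUP_upper bdd_above_norm_image_sphere[OF T]) simp
  then show ?thesis using False by (simp add: scaleR field_simps)
qed (simp add: linear_0[OF bounded_linear.linear[OF T]])

lemma max_stretch_nonneg:
  assumes T: "bounded_linear (T :: real^'n \<Rightarrow> real^'n)"
  shows "0 \<le> max_stretch T"
proof -
  have "0 \<le> norm (T (axis undefined 1))" by simp
  also have "\<dots> \<le> max_stretch T" using norm_le_max_stretch[OF T, of "axis undefined 1"] by simp
  finally show ?thesis .
qed

lemma onorm_le_max_stretch:
  assumes T: "bounded_linear (T :: real^'n \<Rightarrow> real^'n)"
  shows "onorm T \<le> max_stretch T"
  using norm_le_max_stretch[OF T] max_stretch_nonneg[OF T] by (intro onorm_le)

lemma min_stretch_nonneg: "0 \<le> min_stretch (T :: real^'n \<Rightarrow> real^'n)"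
  unfolding min_stretch_def by (intro cINF_greatest sphere_nonempty) auto

lemma min_stretch_le_norm:
  assumes T: "bounded_linear (T :: real^'n \<Rightarrow> real^'n)"
  shows "min_stretch T * norm x \<le> norm (T x)"
proof (cases "x = 0")
  case False
  interpret bounded_linear T by fact
  have "min_stretch T \<le> norm (T ((1 / norm x) *\<^sub>R x))" unfolding min_stretch_def
    using False by (intro cINF_lower bdd_belowI2[of _ 0]) auto
  then show ?thesis using False by (simp add: scaleR field_simps)
qed simp

text \<open>A positive number divided by 0 is infinite, so a finite bound forces
  \<open>a = 0\<close> when \<open>b = 0\<close>, and the product form holds at degenerate
  derivatives as well.\<close>

lemma ereal_divide_le_imp:
  assumes "ereal a / ereal b \<le> ereal K" "a \<ge> 0" "b \<ge> 0"
  shows "a \<le> K * b"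
proof (cases "b = 0")
  case True
  have "a = 0"
  proof (rule ccontr)
    assume "a \<noteq> 0"
    then have "ereal a / ereal b = \<infinity>" using assms True by (simp add: zero_ereal_def[symmetric] divide_ereal_def)
    then show False using assms(1) by simp
  qed
  then show ?thesis using True by simp
next
  case False
  then have "a / b \<le> K" using assms(1) by simp
  then show ?thesis using False assms by (simp add: field_simps)
qed

lemma outer_dilatation_AE:
  fixes F :: "real^'n \<Rightarrow> real^'n"
  assumes diff: "AE x in lebesgue. F differentiable (at x)" and K: "outer_dilatation F \<le> ereal K"
  shows "AE x in lebesgue. onorm (frechet_derivative F (at x)) ^ CARD('n) \<le> K * \<bar>jacobian F x\<bar>"
  using diff esssup_AE[of "\<lambda>x. ereal (max_stretch (frechet_derivative F (at x)) ^ CARD('n)) / ereal \<bar>jacobian F x\<bar>" lebesgue]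
proof eventually_elim
  case (elim x)
  have bl: "bounded_linear (frechet_derivative F (at x))"
    using elim(1) frechet_derivative_works has_derivative_bounded_linear by blast
  have "onorm (frechet_derivative F (at x)) ^ CARD('n) \<le> max_stretch (frechet_derivative F (at x)) ^ CARD('n)"
    by (intro power_mono onorm_le_max_stretch onorm_pos_le bl)
  also have "\<dots> \<le> K * \<bar>jacobian F x\<bar>"
    using elim(2) K max_stretch_nonneg[OF bl]
    by (intro ereal_divide_le_imp) (auto simp: outer_dilatation_def intro: order_trans)
  finally show ?case .
qed

lemma inner_dilatation_AE:
  fixes F :: "real^'n \<Rightarrow> real^'n"
  assumes K: "inner_dilatation F \<le> ereal K"
  shows "AE x in lebesgue. \<bar>jacobian F x\<bar> \<le> K * min_stretch (frechet_derivative F (at x)) ^ CARD('n)"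
  using esssup_AE[of "\<lambda>x. ereal \<bar>jacobian F x\<bar> / ereal (min_stretch (frechet_derivative F (at x)) ^ CARD('n))" lebesgue]
proof eventually_elim
  case (elim x)
  show ?case
    by (rule ereal_divide_le_imp[OF order_trans[OF elim K[unfolded inner_dilatation_def]]])
      (simp_all add: min_stretch_nonneg)
qed

lemma ereal_less_inftyE:
  assumes "x < (\<infinity>::ereal)" obtains K :: real where "K \<ge> 0" "x \<le> ereal K"
proof -
  obtain K where "x \<le> ereal K" using assms by (cases x) auto
  then have "x \<le> ereal (max K 0)" by (meson ereal_less_eq(3) max.cobounded1 order_trans)
  then show thesis using that[of "max K 0"] by simp
qed

text \<open>Outside the image of a null set the derivatives of \<open>F\<close> and \<open>G\<close> are inverse to each other. On
  the image of a null set the Jacobian of \<open>G\<close> vanishes almost everywhere, hence so does its derivative.\<close>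

lemma (in quasiperiodic_homeomorphism) inner_dilatation_inverse:
  assumes diffF: "AE x in lebesgue. F differentiable (at x)" and diffG: "AE x in lebesgue. G differentiable (at x)"
    and Gfin: "outer_dilatation G < \<infinity>" and K: "inner_dilatation F \<le> ereal K" "K \<ge> 0"
  shows "AE y in lebesgue. onorm (frechet_derivative G (at y)) ^ CARD('n) \<le> K * \<bar>jacobian G y\<bar>"
proof -
  interpret H: quasiperiodic_homeomorphism "A ** g" "matrix_inv A" G F by (rule inverse_quasiperiodic)
  obtain K' where K': "K' \<ge> 0" "outer_dilatation G \<le> ereal K'" using ereal_less_inftyE[OF Gfin] by blast
  have "AE x in lebesgue. F differentiable (at x) \<and> \<bar>jacobian F x\<bar> \<le> K * min_stretch (frechet_derivative F (at x)) ^ CARD('n)"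
    using diffF inner_dilatation_AE[OF K(1)] by eventually_elim auto
  from this[unfolded AE_completion_iff]
  obtain N where N: "N \<in> null_sets lborel"
    "\<And>x. x \<notin> N \<Longrightarrow> F differentiable (at x) \<and> \<bar>jacobian F x\<bar> \<le> K * min_stretch (frechet_derivative F (at x)) ^ CARD('n)"
    unfolding eventually_ae_filter by auto
  have Nb: "N \<in> sets borel" using N(1) by auto
  have FN: "F ` N \<in> sets borel" by (rule borel_image_F[OF Nb])
  have GFN: "G ` (F ` N) = N" by (simp add: image_image)
  have "(\<integral>\<^sup>+y\<in>F ` N. ennreal \<bar>H.jac y\<bar> \<partial>lborel) \<le> ennreal 0"
    using null_setsD1[OF N(1)] by (intro H.nn_integral_jac_le[OF diffG FN]) (simp_all only: GFN, auto)
  then have "AE y in lborel. ennreal \<bar>H.jac y\<bar> * indicator (F ` N) y = 0"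
    using FN by (subst nn_integral_0_iff_AE[symmetric]) auto
  then have jz: "AE y in lebesgue. y \<in> F ` N \<longrightarrow> H.jac y = 0"
    unfolding AE_completion_iff by eventually_elim (auto simp: indicator_def)
  show ?thesis
    using jz diffG outer_dilatation_AE[OF diffG K'(2)]
  proof eventually_elim
    case (elim y)
    show ?case
    proof (cases "y \<in> F ` N")
      case True
      \<comment> \<open>Finite outer dilatation of \<open>G\<close>, with whatever constant
        \<open>K'\<close>, makes the derivative vanish together with the Jacobian, so the bound
        holds with \<open>K\<close> too.\<close>
      then show ?thesis using elim K(2) by (simp add: H.jac_eq)
    next
      case False
      define x where "x = G y"
      have x: "x \<notin> N" using False by (metis FG image_eqI x_def)
      let ?DF = "frechet_derivative F (at x)" and ?DG = "frechet_derivative G (at y)"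
      have dF: "(F has_derivative ?DF) (at x)" using N(2)[OF x] frechet_derivative_works by blast
      have dG: "(G has_derivative ?DG) (at y)" using elim frechet_derivative_works by blast
      have "(F \<circ> G has_derivative ?DF \<circ> ?DG) (at y)"
        using dF dG unfolding x_def by (intro diff_chain_at)
      moreover have "F \<circ> G = (\<lambda>x. x)" by auto
      ultimately have "?DF \<circ> ?DG = (\<lambda>x. x)" using has_derivative_ident has_derivative_unique by metis
      then have inv: "?DF (?DG v) = v" for v by (metis comp_apply)
      have lin: "linear ?DF" "linear ?DG" "bounded_linear ?DF" "bounded_linear ?DG"
        using dF dG has_derivative_linear has_derivative_bounded_linear by auto
      have "matrix ?DF ** matrix ?DG = mat 1"
      proof -
        have "matrix ?DF ** matrix ?DG = matrix (?DF \<circ> ?DG)" by (rule matrix_compose[symmetric]) (use lin in auto)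
        also have "\<dots> = mat 1" by (auto simp: \<open>?DF \<circ> ?DG = (\<lambda>x. x)\<close> matrix_def mat_def axis_def vec_eq_iff)
        finally show ?thesis .
      qed
      then have "jacobian F x * jacobian G y = 1" unfolding jacobian_def by (metis det_I det_mul)
      then have JJ: "\<bar>jacobian F x\<bar> * \<bar>jacobian G y\<bar> = 1" by (metis abs_mult abs_one)
      define l where "l = min_stretch ?DF"
      have l: "l \<ge> 0" by (simp add: l_def min_stretch_nonneg)
      have JF: "\<bar>jacobian F x\<bar> \<le> K * l ^ CARD('n)" using N(2)[OF x] by (simp add: l_def)
      have "l > 0"
      proof (rule ccontr)
        assume "\<not> l > 0"
        then have "\<bar>jacobian F x\<bar> \<le> 0" using JF l by (simp add: power_0_left)
        then show False using JJ by simp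
      qed
      have "norm (?DG v) \<le> (1 / l) * norm v" for v
        using min_stretch_le_norm[OF lin(3), of "?DG v"] inv \<open>l > 0\<close> by (simp add: l_def field_simps)
      then have "onorm ?DG \<le> 1 / l" using \<open>l > 0\<close> by (intro onorm_le) auto
      then have "onorm ?DG ^ CARD('n) \<le> (1 / l) ^ CARD('n)" by (intro power_mono onorm_pos_le lin)
      also have "\<dots> = (1 / l) ^ CARD('n) * (\<bar>jacobian F x\<bar> * \<bar>jacobian G y\<bar>)" using JJ by simp
      also have "\<dots> \<le> (1 / l) ^ CARD('n) * (K * l ^ CARD('n) * \<bar>jacobian G y\<bar>)"
        using JF \<open>l > 0\<close> by (intro mult_left_mono mult_right_mono) auto
      also have "\<dots> = K * \<bar>jacobian G y\<bar>" using \<open>l > 0\<close> by (simp add: power_divide field_simps)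
      finally show ?thesis .
    qed
  qed
qed

text \<open>The second bound is the outer estimate for \<open>G\<close> with the same
  \<open>K\<close>, which comes from the inner dilatation of \<open>F\<close>; quasiconformality of
  \<open>G\<close> supplies only regularity and a finite dilatation.\<close>

theorem (in quasiperiodic_homeomorphism) max_dilatation_lower_bound:
  assumes qc: "quasiconformal F" and K: "max_dilatation F \<le> ereal K" "K \<ge> 0"
  shows "norm (A *v v) ^ CARD('n) \<le> K * norm v ^ CARD('n)"
    and "norm (matrix_inv A *v v) ^ CARD('n) \<le> K * norm v ^ CARD('n)"
proof -
  interpret H: quasiperiodic_homeomorphism "A ** g" "matrix_inv A" G F by (rule inverse_quasiperiodic)
  obtain G' where G': "homeomorphism UNIV UNIV F G'" and
    q: "\<forall>H\<in>{F, G'}. abs_continuous_on_lines H \<and> (AE x in lebesgue. H differentiable (at x)) \<and> max_dilatation H < \<infinity>"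
    using qc unfolding quasiconformal_def by blast
  have "G' = G"
  proof
    fix y show "G' y = G y" using G' by (metis FG GF UNIV_I homeomorphism_def)
  qed
  then have F: "abs_continuous_on_lines F" "AE x in lebesgue. F differentiable (at x)"
    and G: "abs_continuous_on_lines G" "AE x in lebesgue. G differentiable (at x)" "outer_dilatation G < \<infinity>"
    using q by (auto simp: max_dilatation_def)
  have K': "outer_dilatation F \<le> ereal K" "inner_dilatation F \<le> ereal K" using K by (auto simp: max_dilatation_def)
  show "norm (A *v v) ^ CARD('n) \<le> K * norm v ^ CARD('n)"
    by (rule outer_dilatation_lower_bound[OF F K(2) outer_dilatation_AE[OF F(2) K'(1)]])
  show "norm (matrix_inv A *v v) ^ CARD('n) \<le> K * norm v ^ CARD('n)"
    by (rule H.outer_dilatation_lower_bound[OF G(1,2) K(2) inner_dilatation_inverse[OF F(2) G(2,3) K'(2) K(2)]])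
qed

section \<open>Linear maps as quasiconformal maps\<close>

lemma frechet_derivative_matrix: "frechet_derivative (\<lambda>x. (A::real^'n^'m) *v x) (at x) = (\<lambda>x. A *v x)"
  by (rule frechet_derivative_at[symmetric]) (simp add: bounded_linear_imp_has_derivative)

text \<open>The derivative is constant and the Jacobian is 1 up to sign, so both essential suprema
  are those of constants; the bound on the inverse says that the minimal stretch is at least
  \<open>1 / c\<close>.\<close>

lemma max_dilatation_linear_le:
  fixes A :: "real^'n^'n"
  assumes det: "\<bar>det A\<bar> = 1" and c: "c > 0"
    and up: "\<And>x. norm (A *v x) \<le> c * norm x" and low: "\<And>x. norm (matrix_inv A *v x) \<le> c * norm x"
  shows "max_dilatation (\<lambda>x. A *v x) \<le> ereal (c ^ CARD('n))"
proof -
  have nz: "det A \<noteq> 0" using det by auto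
  have J: "\<bar>jacobian (\<lambda>x. A *v x) x\<bar> = 1" for x
    by (simp add: jacobian_def frechet_derivative_matrix det)
  have sp: "emeasure lebesgue (space (lebesgue :: (real^'n) measure)) \<noteq> 0" by (simp add: emeasure_lborel_UNIV)
  have bl: "bounded_linear (\<lambda>x. A *v x)" by (rule matrix_vector_mul_bounded_linear)
  have "max_stretch (\<lambda>x. A *v x) \<le> c"
    unfolding max_stretch_def using up by (intro cSUP_least sphere_nonempty) (metis mem_sphere_0 mult.right_neutral)
  then have "max_stretch (\<lambda>x. A *v x) ^ CARD('n) \<le> c ^ CARD('n)"
    using max_stretch_nonneg[OF bl] by (intro power_mono)
  then have "outer_dilatation (\<lambda>x. A *v x) \<le> ereal (c ^ CARD('n))"
    unfolding outer_dilatation_def frechet_derivative_matrix J esssup_const[OF sp] by simp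
  moreover have "inner_dilatation (\<lambda>x. A *v x) \<le> ereal (c ^ CARD('n))"
  proof -
    have "1 / c \<le> norm (A *v x)" if "x \<in> sphere 0 1" for x
      using low[of "A *v x"] that c by (simp add: matrix_vector_mul_cancel[OF nz] field_simps del: matrix_vector_mul_assoc)
    then have "1 / c \<le> min_stretch (\<lambda>x. A *v x)"
      unfolding min_stretch_def by (intro cINF_greatest sphere_nonempty) 
    then have m: "(1 / c) ^ CARD('n) \<le> min_stretch (\<lambda>x. A *v x) ^ CARD('n)" using c by (intro power_mono) auto
    moreover have "0 < (1 / c) ^ CARD('n)" using c by simp
    ultimately have "1 / min_stretch (\<lambda>x. A *v x) ^ CARD('n) \<le> 1 / (1 / c) ^ CARD('n)"
      by (intro divide_left_mono mult_pos_pos) auto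
    moreover have "min_stretch (\<lambda>x. A *v x) ^ CARD('n) \<noteq> 0" using m \<open>0 < (1 / c) ^ CARD('n)\<close> by linarith
    ultimately show ?thesis
      unfolding inner_dilatation_def frechet_derivative_matrix J esssup_const[OF sp]
      by (simp add: power_divide)
  qed
  ultimately show ?thesis by (simp add: max_dilatation_def)
qed

lemma abs_continuous_on_lines_linear: "abs_continuous_on_lines (\<lambda>x. (A::real^'n^'n) *v x)"
  unfolding abs_continuous_on_lines_def
proof (intro allI AE_I2)
  fix i a b and x :: "real^'n"
  let ?k = "norm (A *v axis i 1) + 1"
  have k: "?k > 0" by (simp add: add_nonneg_pos)
  show "abs_continuous_between a b (\<lambda>t. A *v (x + t *\<^sub>R axis i 1))"
    unfolding abs_continuous_between_def
  proof (intro allI impI)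
    fix \<epsilon> :: real assume "\<epsilon> > 0"
    show "\<exists>\<delta>>0. \<forall>D. finite D \<and> (\<forall>(s, t)\<in>D. a \<le> s \<and> s \<le> t \<and> t \<le> b) \<and>
      pairwise (\<lambda>(s, t) (s', t'). disjnt {s<..<t} {s'<..<t'}) D \<and> (\<Sum>(s, t)\<in>D. t - s) < \<delta> \<longrightarrow>
      (\<Sum>(s, t)\<in>D. norm (A *v (x + t *\<^sub>R axis i 1) - A *v (x + s *\<^sub>R axis i 1))) < \<epsilon>"
    proof (intro exI[of _ "\<epsilon> / ?k"] conjI allI impI)
      show "\<epsilon> / ?k > 0" using k \<open>\<epsilon> > 0\<close> by simp
      fix D :: "(real \<times> real) set"
      assume D: "finite D \<and> (\<forall>(s, t)\<in>D. a \<le> s \<and> s \<le> t \<and> t \<le> b) \<and>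
        pairwise (\<lambda>(s, t) (s', t'). disjnt {s<..<t} {s'<..<t'}) D \<and> (\<Sum>(s, t)\<in>D. t - s) < \<epsilon> / ?k"
      have eq: "A *v (x + t *\<^sub>R axis i 1) - A *v (x + s *\<^sub>R axis i 1) = (t - s) *\<^sub>R (A *v axis i 1)" for s t
        by (simp add: matrix_vector_right_distrib matrix_vector_mult_scaleR scaleR_diff_left)
      have "(\<Sum>(s, t)\<in>D. norm (A *v (x + t *\<^sub>R axis i 1) - A *v (x + s *\<^sub>R axis i 1))) \<le> (\<Sum>(s, t)\<in>D. ?k * (t - s))"
      proof (intro sum_mono)
        fix p assume "p \<in> D"
        then have "fst p \<le> snd p" using D by auto
        then show "(case p of (s, t) \<Rightarrow> norm (A *v (x + t *\<^sub>R axis i 1) - A *v (x + s *\<^sub>R axis i 1)))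
            \<le> (case p of (s, t) \<Rightarrow> ?k * (t - s))"
          by (simp only: split_beta eq norm_scaleR) (simp add: mult.commute[of _ "snd p - fst p"] mult_left_mono)
      qed
      also have "\<dots> = ?k * (\<Sum>(s, t)\<in>D. t - s)" by (simp add: sum_distrib_left split_beta)
      also have "\<dots> < \<epsilon>" using D k by (simp add: field_simps)
      finally show "(\<Sum>(s, t)\<in>D. norm (A *v (x + t *\<^sub>R axis i 1) - A *v (x + s *\<^sub>R axis i 1))) < \<epsilon>" .
    qed
  qed
qed

lemma homeomorphism_matrix:
  fixes A :: "real^'n^'n"
  assumes "det A \<noteq> 0"
  shows "homeomorphism UNIV UNIV (\<lambda>x. A *v x) (\<lambda>x. matrix_inv A *v x)"
  unfolding homeomorphism_def
  by (auto simp: matrix_vector_mul_cancel[OF assms] image_iff matrix_vector_mult_linear_continuous_on simp del: matrix_vector_mul_assoc)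
    (metis matrix_vector_mul_cancel[OF assms])+

lemma quasiconformal_linear:
  fixes A :: "real^'n^'n"
  assumes det: "\<bar>det A\<bar> = 1"
  shows "quasiconformal (\<lambda>x. A *v x)"
proof -
  have nz: "det A \<noteq> 0" using det by auto
  have iA: "matrix_inv A ** A = mat 1" "A ** matrix_inv A = mat 1"
    using matrix_vector_mul_cancel[OF nz] by (simp_all add: matrix_eq matrix_vector_mul_assoc[symmetric])
  have ii: "matrix_inv (matrix_inv A) = A" by (rule matrix_inv_unique_real[OF iA(1)])
  have d: "\<bar>det (matrix_inv A)\<bar> = 1" using det iA(2) by (metis abs_mult abs_one det_I det_mul mult_1)
  define c where "c = max (onorm (\<lambda>x. A *v x)) (onorm (\<lambda>x. matrix_inv A *v x)) + 1"
  have c: "c > 0" by (simp add: c_def add_nonneg_pos le_max_iff_disj onorm_pos_le matrix_vector_mul_bounded_linear)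
  have u: "norm (A *v x) \<le> c * norm x" for x
    using onorm[OF matrix_vector_mul_bounded_linear[of A], of x]
    by (rule order_trans) (auto simp: c_def intro!: mult_right_mono)
  have l: "norm (matrix_inv A *v x) \<le> c * norm x" for x
    using onorm[OF matrix_vector_mul_bounded_linear[of "matrix_inv A"], of x]
    by (rule order_trans) (auto simp: c_def intro!: mult_right_mono)
  have fin: "max_dilatation (\<lambda>x. A *v x) < \<infinity>" "max_dilatation (\<lambda>x. matrix_inv A *v x) < \<infinity>"
    using max_dilatation_linear_le[OF det c u l] max_dilatation_linear_le[OF d c l] u ii by (auto intro: le_less_trans)
  have diff: "(\<lambda>x. B *v x) differentiable (at x)" for B :: "real^'n^'n" and x
    using bounded_linear_imp_differentiable[OF matrix_vector_mul_bounded_linear] by blast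
  show ?thesis unfolding quasiconformal_def
    using homeomorphism_matrix[OF nz] fin diff abs_continuous_on_lines_linear
    by (intro exI[of _ "\<lambda>x. matrix_inv A *v x"]) auto
qed

section \<open>Flat tori and lifts\<close>

text \<open>The axis vectors generate the lattice as a group. Equivariance under them therefore
  extends to all lattice vectors.\<close>

lemma int_lattice_induct [consumes 1, case_names zero axis add minus]:
  fixes z :: "real^'n"
  assumes z: "z \<in> int_lattice" and P0: "P 0" and axis: "\<And>i. P (axis i 1)"
    and add: "\<And>x y. P x \<Longrightarrow> P y \<Longrightarrow> P (x + y)" and neg: "\<And>x. P x \<Longrightarrow> P (- x)"
  shows "P z"
proof -
  have nat: "P (real k *\<^sub>R x)" if "P x" for k and x :: "real^'n"
    by (induction k) (auto simp: P0 scaleR_left_distrib add.commute that intro: add)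
  have int: "P (of_int k *\<^sub>R x)" if "P x" for k and x :: "real^'n"
  proof (cases "k \<ge> 0")
    case True
    then show ?thesis using nat[OF that, of "nat k"] by simp
  next
    case False
    then show ?thesis using neg[OF nat[OF that, of "nat (- k)"]] by simp
  qed
  have sum: "P (\<Sum>i\<in>S. z $ i *\<^sub>R axis i 1)" for S
  proof (induction S rule: infinite_finite_induct)
    case (insert i S)
    obtain k where "z $ i = of_int k" using z by (auto simp: int_lattice_def Ints_def)
    then show ?case using insert int[OF axis] by (simp add: add)
  qed (auto simp: P0)
  show ?thesis using sum[of UNIV] by (simp only: sum_axis)
qed

lemma closed_int_lattice: "closed (int_lattice :: (real^'n) set)"
proof -
  have eq: "int_lattice = (\<Inter>i. (\<lambda>x::real^'n. x $ i) -` \<int>)" by (auto simp: int_lattice_def)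
  have "closed ((\<lambda>x::real^'n. x $ i) -` \<int>)" for i
    by (intro continuous_closed_vimage closed_Ints) (simp add: continuous_at_imp_continuous_on continuous_component)
  then show ?thesis unfolding eq by (intro closed_INT ballI)
qed

lemma closed_lattice:
  fixes g :: "real^'n^'n"
  assumes "det g \<noteq> 0" shows "closed (lattice g)"
  by (rule closed_injective_linear_image[OF closed_int_lattice matrix_vector_mul_linear])
    (metis injI matrix_vector_mul_cancel(2)[OF assms])

text \<open>A nonzero integer vector has norm at least 1 and the inverse of \<open>g\<close> is
  bounded. The gap \<open>r\<close> is what lets a lift recover short distances from distances on
  the torus.\<close>

lemma lattice_separated:
  fixes g :: "real^'n^'n"
  assumes g: "det g \<noteq> 0"
  obtains r where "r > 0" "\<And>l. l \<in> lattice g \<Longrightarrow> l \<noteq> 0 \<Longrightarrow> r \<le> norm l"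
proof -
  let ?k = "onorm (\<lambda>x. matrix_inv g *v x) + 1"
  have bl: "bounded_linear (\<lambda>x. matrix_inv g *v x)" by (rule matrix_vector_mul_bounded_linear)
  have k: "?k > 0" using onorm_pos_le[OF bl] by simp
  have "1 / ?k \<le> norm l" if l: "l \<in> lattice g" "l \<noteq> 0" for l
  proof -
    obtain z where z: "z \<in> int_lattice" "l = g *v z" using l by blast
    then have "z \<noteq> 0" using l(2) by auto
    then obtain i where i: "z $ i \<noteq> 0" by (metis vec_eq_iff zero_index)
    obtain k :: int where "z $ i = of_int k" using z(1) by (auto simp: int_lattice_def Ints_def)
    then have "1 \<le> \<bar>z $ i\<bar>" using i by simp
    also have "\<dots> \<le> norm z" by (rule component_le_norm_cart)
    also have "z = matrix_inv g *v l" by (simp only: z(2) matrix_vector_mul_cancel(2)[OF g])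
    also have "norm (matrix_inv g *v l) \<le> onorm (\<lambda>x. matrix_inv g *v x) * norm l" by (rule onorm[OF bl])
    also have "\<dots> \<le> ?k * norm l" by (intro mult_right_mono) auto
    finally show ?thesis using k by (simp add: field_simps)
  qed
  then show thesis using that[of "1 / ?k"] k by simp
qed

section \<open>The quotient metric and topology of a flat torus\<close>

abbreviation coset :: "real^'n^'n \<Rightarrow> real^'n \<Rightarrow> (real^'n) set" where
  "coset g \<equiv> lattice_coset (lattice g)"

abbreviation torus_top :: "real^'n^'n \<Rightarrow> (real^'n) set topology" where
  "torus_top g \<equiv> torus_topology (lattice g)"

lemma coset_eq_iff: "coset g x = coset g y \<longleftrightarrow> x - y \<in> lattice g"
proof
  assume "coset g x = coset g y"
  then have "x \<in> coset g y" by (metis add.right_neutral imageI lattice_coset_def lattice_zero)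
  then show "x - y \<in> lattice g" by (auto simp: lattice_coset_def)
next
  assume d: "x - y \<in> lattice g"
  have "x + l \<in> coset g y" if "l \<in> lattice g" for l
    unfolding lattice_coset_def by (rule image_eqI[OF _ lattice_add[OF d that]]) simp
  moreover have "y + l \<in> coset g x" if "l \<in> lattice g" for l
    unfolding lattice_coset_def by (rule image_eqI[OF _ lattice_diff[OF that d]]) simp
  ultimately show "coset g x = coset g y" by (auto simp: lattice_coset_def)
qed

lemma coset_add_lattice: "l \<in> lattice g \<Longrightarrow> coset g (x + l) = coset g x"
  by (simp only: coset_eq_iff add_diff_cancel_left')

lemma mem_coset: "x \<in> coset g x"
  by (metis add.right_neutral imageI lattice_coset_def lattice_zero)

lemma setdist_coset_le: "setdist (coset g x) (coset g y) \<le> dist x y"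
  by (intro setdist_le_dist mem_coset)

text \<open>Lattice translations are isometries, so one representative can be held fixed, and the
  other coset is closed, so its infimal distance to a point is attained. Torus distances thereby
  become actual distances of representatives.\<close>

lemma setdist_coset_attained:
  fixes g :: "real^'n^'n"
  assumes g: "det g \<noteq> 0"
  obtains l where "l \<in> lattice g" "setdist (coset g x) (coset g y) = dist x (y + l)"
proof -
  have "coset g y = (+) y ` lattice g" by (simp add: lattice_coset_def)
  then have cl: "closed (coset g y)" using closed_translation closed_lattice[OF g] by metis
  obtain b where b: "b \<in> coset g y" "infdist x (coset g y) = dist x b"
    using infdist_attains_inf[OF cl, of x] mem_coset by blast
  have "dist x b \<le> setdist (coset g x) (coset g y)"
  proof (rule le_setdistI)
    fix a c assume "a \<in> coset g x" "c \<in> coset g y"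
    then obtain l m where lm: "l \<in> lattice g" "a = x + l" "m \<in> lattice g" "c = y + m"
      by (auto simp: lattice_coset_def)
    have "y + (m - l) \<in> coset g y" unfolding lattice_coset_def by (intro imageI lattice_diff lm)
    then have "infdist x (coset g y) \<le> dist x (y + (m - l))" by (rule infdist_le)
    also have "\<dots> = dist a c" by (simp add: lm dist_norm algebra_simps)
    finally show "dist x b \<le> dist a c" by (simp add: b)
  qed (use mem_coset in auto)
  moreover have "setdist (coset g x) (coset g y) \<le> dist x b" by (intro setdist_le_dist mem_coset b)
  moreover obtain l where "l \<in> lattice g" "b = y + l" using b(1) by (auto simp: lattice_coset_def)
  ultimately show thesis using that by (metis order_antisym)
qed

lemma Metric_space_torus:
  fixes g :: "real^'n^'n"
  assumes g: "det g \<noteq> 0"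
  shows "Metric_space (torus (lattice g)) setdist"
proof
  fix p q r assume "p \<in> torus (lattice g)" "q \<in> torus (lattice g)"
  then obtain x y where pq: "p = coset g x" "q = coset g y" by (auto simp: torus_def)
  show "setdist p q = 0 \<longleftrightarrow> p = q"
  proof
    assume z: "setdist p q = 0"
    obtain l where "l \<in> lattice g" "setdist (coset g x) (coset g y) = dist x (y + l)"
      by (rule setdist_coset_attained[OF g])
    then show "p = q" using z by (simp add: pq coset_add_lattice)
  next
    assume "p = q"
    then have "setdist p q \<le> 0" using setdist_coset_le[of g x x] by (simp add: pq)
    then show "setdist p q = 0" by (simp add: order_antisym)
  qed
  assume "r \<in> torus (lattice g)"
  then obtain z where r: "r = coset g z" by (auto simp: torus_def)
  obtain l m where l: "l \<in> lattice g" "setdist (coset g x) (coset g y) = dist x (y + l)"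
    and m: "m \<in> lattice g" "setdist (coset g y) (coset g z) = dist y (z + m)"
    using setdist_coset_attained[OF g] by metis
  have "setdist p r = setdist (coset g x) (coset g (z + (m + l)))"
    by (simp only: pq r coset_add_lattice[OF lattice_add[OF m(1) l(1)]])
  also have "\<dots> \<le> dist x (z + (m + l))" by (rule setdist_coset_le)
  also have "\<dots> \<le> dist x (y + l) + dist (y + l) (z + (m + l))" by (rule dist_triangle)
  also have "dist (y + l) (z + (m + l)) = dist y (z + m)" by (simp add: dist_norm algebra_simps)
  finally show "setdist p r \<le> setdist p q + setdist q r" by (simp add: l m pq r)
qed (auto simp: setdist_pos_le setdist_sym)

lemma topspace_torus_top:
  "det g \<noteq> 0 \<Longrightarrow> topspace (torus_top g) = torus (lattice g)"
  by (simp add: torus_topology_def Metric_space.topspace_mtopology Metric_space_torus)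

text \<open>The projection does not increase distances, and it is open because attained distances
  lift points of a small ball to the ball above. Continuity of maps out of the torus can then be
  tested on the covering space.\<close>

lemma quotient_map_coset:
  fixes g :: "real^'n^'n"
  assumes g: "det g \<noteq> 0"
  shows "quotient_map euclidean (torus_top g) (coset g)"
proof (rule continuous_open_imp_quotient_map)
  interpret Metric_space "torus (lattice g)" setdist by (rule Metric_space_torus[OF g])
  have mem: "coset g x \<in> torus (lattice g)" for x by (simp add: torus_def)
  show "continuous_map euclidean (torus_top g) (coset g)"
    unfolding torus_topology_def continuous_map_to_metric
  proof (intro ballI allI impI)
    fix x :: "real^'n" and \<epsilon> :: real assume "\<epsilon> > 0"
    then show "\<exists>U. openin euclidean U \<and> x \<in> U \<and> (\<forall>y\<in>U. coset g y \<in> mball (coset g x) \<epsilon>)"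
      using mem by (intro exI[of _ "ball x \<epsilon>"]) (auto intro: le_less_trans[OF setdist_coset_le])
  qed
  show "open_map euclidean (torus_top g) (coset g)"
    unfolding open_map_def torus_topology_def openin_mtopology
  proof (intro allI impI conjI)
    fix U :: "(real^'n) set" and p assume U: "openin euclidean U" and "p \<in> coset g ` U"
    then obtain x where x: "x \<in> U" "p = coset g x" by blast
    then obtain r where r: "r > 0" "ball x r \<subseteq> U" using U by (meson open_openin openE)
    have "q \<in> coset g ` U" if "q \<in> mball p r" for q
    proof -
      have "q \<in> torus (lattice g)" "setdist p q < r" using \<open>q \<in> mball p r\<close> by auto
      then obtain y where y: "q = coset g y" "setdist (coset g x) (coset g y) < r" using x(2) by (auto simp: torus_def)
      obtain l where l: "l \<in> lattice g" "setdist (coset g x) (coset g y) = dist x (y + l)"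
        by (rule setdist_coset_attained[OF g])
      then have "y + l \<in> U" using y r by auto
      then show ?thesis using coset_add_lattice[OF l(1), of y] y(1) by (metis imageI)
    qed
    then show "\<exists>r>0. mball p r \<subseteq> coset g ` U" using r(1) by blast
  qed (auto simp: torus_def)
  show "coset g ` topspace euclidean = topspace (torus_top g)"
    by (simp add: topspace_torus_top[OF g] torus_def)
qed

lemma continuous_map_coset: "det g \<noteq> 0 \<Longrightarrow> continuous_map euclidean (torus_top g) (coset g)"
  by (rule quotient_imp_continuous_map[OF quotient_map_coset])

text \<open>The coordinates of a lift are the arguments of continuous logarithms.\<close>

theorem torus_map_lift:
  fixes g :: "real^'n^'n" and S :: "'a::real_normed_vector set"
  assumes g: "det g \<noteq> 0" and S: "convex S" and \<phi>: "continuous_map (top_of_set S) (torus_top g) \<phi>"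
  shows "\<exists>K. continuous_on S K \<and> (\<forall>x\<in>S. coset g (K x) = \<phi> x)"
proof -
  define rep where "rep p = (SOME x. coset g x = p)" for p
  \<comment> \<open>The \<open>i\<close>-th circle-valued coordinate of the torus; the exponential
    removes the dependence on the chosen representative.\<close>
  define E where "E i p = exp (2 * pi * \<i> * complex_of_real ((matrix_inv g *v rep p) $ i))" for i p
  have E: "E i (coset g x) = exp (2 * pi * \<i> * complex_of_real ((matrix_inv g *v x) $ i))" for i x
  proof -
    have "coset g (rep (coset g x)) = coset g x" unfolding rep_def by (rule someI) (rule refl)
    then have "rep (coset g x) - x \<in> lattice g" by (simp only: coset_eq_iff)
    then obtain z where z: "z \<in> int_lattice" "rep (coset g x) - x = g *v z" by blast
    have "matrix_inv g *v rep (coset g x) - matrix_inv g *v x = z"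
      using matrix_vector_mul_cancel(2)[OF g, of z] z(2) by (metis matrix_vector_mult_diff_distrib)
    then have "(matrix_inv g *v rep (coset g x)) $ i = (matrix_inv g *v x) $ i + z $ i"
      by (metis add.commute diff_add_cancel vector_add_component)
    moreover obtain k :: int where "z $ i = of_int k" using z(1) by (auto simp: int_lattice_def Ints_def)
    ultimately have "2 * pi * \<i> * complex_of_real ((matrix_inv g *v rep (coset g x)) $ i)
       = 2 * pi * \<i> * complex_of_real ((matrix_inv g *v x) $ i) + (of_int (2 * k) * pi) * \<i>"
      by (simp add: algebra_simps)
    then show ?thesis unfolding E_def exp_eq by blast
  qed
  have Ec: "continuous_map (torus_top g) euclidean (E i)" for i
  proof (rule continuous_compose_quotient_map[OF quotient_map_coset[OF g]])
    have "continuous_on UNIV (\<lambda>x. exp (2 * pi * \<i> * complex_of_real ((matrix_inv g *v x) $ i)))"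
      by (intro continuous_intros continuous_on_component matrix_vector_mult_linear_continuous_on)
    then show "continuous_map euclidean euclidean (E i \<circ> coset g)" by (simp add: o_def E)
  qed
  have "\<exists>L. continuous_on S L \<and> (\<forall>x\<in>S. E i (\<phi> x) = exp (L x))" for i
  proof -
    have "continuous_map (top_of_set S) euclidean (E i \<circ> \<phi>)"
      by (rule continuous_map_compose[OF \<phi> Ec])
    then have "continuous_on S (\<lambda>x. E i (\<phi> x))" by (simp add: o_def)
    from continuous_logarithm_on_contractible[OF this convex_imp_contractible[OF S]]
    show ?thesis by (metis E_def exp_not_eq_zero)
  qed
  then obtain L where L: "\<And>i. continuous_on S (L i)" "\<And>i x. x \<in> S \<Longrightarrow> E i (\<phi> x) = exp (L i x)" by metis
  define K where "K x = g *v (\<chi> i. Im (L i x) / (2 * pi))" for x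
  have "continuous_on S K" unfolding K_def
    by (rule continuous_on_compose2[OF matrix_vector_mult_linear_continuous_on[of UNIV g]])
      (auto intro!: continuous_intros L(1))
  moreover have "coset g (K x) = \<phi> x" if x: "x \<in> S" for x
  proof -
    have "\<phi> x \<in> torus (lattice g)"
      using continuous_map_funspace[OF \<phi>] x by (auto simp: topspace_torus_top[OF g])
    then obtain y where y: "\<phi> x = coset g y" by (auto simp: torus_def)
    have "\<exists>k::int. Im (L i x) / (2 * pi) = (matrix_inv g *v y) $ i + of_int k" for i
    proof -
      have "exp (L i x) = exp (2 * pi * \<i> * complex_of_real ((matrix_inv g *v y) $ i))"
        using L(2)[OF x, of i] by (simp add: y E)
      then obtain k :: int where "L i x = 2 * pi * \<i> * complex_of_real ((matrix_inv g *v y) $ i) + (of_int (2 * k) * pi) * \<i>"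
        unfolding exp_eq by blast
      then have "Im (L i x) = 2 * pi * ((matrix_inv g *v y) $ i + of_int k)" by (simp add: algebra_simps)
      then show ?thesis by (intro exI[of _ k]) simp
    qed
    then obtain k :: "'n \<Rightarrow> int" where k: "\<And>i. Im (L i x) / (2 * pi) = (matrix_inv g *v y) $ i + of_int (k i)" by metis
    have "(\<chi> i. Im (L i x) / (2 * pi)) = matrix_inv g *v y + (\<chi> i. of_int (k i))"
      by (simp add: vec_eq_iff k)
    then have "K x = y + g *v (\<chi> i. of_int (k i))"
      by (simp only: K_def matrix_vector_right_distrib matrix_vector_mul_cancel(1)[OF g])
    moreover have "g *v (\<chi> i. of_int (k i)) \<in> lattice g" by (intro imageI) (simp add: int_lattice_def)
    ultimately show ?thesis by (simp only: y coset_add_lattice)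
  qed
  ultimately show ?thesis by blast
qed

text \<open>In the basis \<open>g\<close> each coordinate takes integer values, hence is constant on
  a connected set. The uniqueness of lifts and the homotopy invariance of their periods rest on
  this.\<close>

lemma continuous_lattice_valued_constant:
  fixes g :: "real^'n^'n" and h :: "'a::topological_space \<Rightarrow> real^'n"
  assumes g: "det g \<noteq> 0" and S: "connected S" and h: "continuous_on S h" "\<And>x. x \<in> S \<Longrightarrow> h x \<in> lattice g"
    and xy: "x \<in> S" "y \<in> S"
  shows "h x = h y"
proof -
  have "(matrix_inv g *v h x) $ i = (matrix_inv g *v h y) $ i" for i
  proof -
    have I: "(matrix_inv g *v h u) $ i \<in> \<int>" if "u \<in> S" for u
    proof -
      obtain z where z: "z \<in> int_lattice" "h u = g *v z" using h(2)[OF \<open>u \<in> S\<close>] by blast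
      then have "matrix_inv g *v h u = z" by (simp only: matrix_vector_mul_cancel(2)[OF g])
      then show ?thesis using z(1) by (simp add: int_lattice_def)
    qed
    have "(\<lambda>u. (matrix_inv g *v h u) $ i) constant_on S"
    proof (rule continuous_discrete_range_constant[OF S])
      show "continuous_on S (\<lambda>u. (matrix_inv g *v h u) $ i)"
        by (intro continuous_on_component continuous_on_compose2[OF _ h(1), of UNIV]
            matrix_vector_mult_linear_continuous_on subset_UNIV)
      fix u assume u: "u \<in> S"
      have "1 \<le> norm ((matrix_inv g *v h v) $ i - (matrix_inv g *v h u) $ i)"
        if "v \<in> S" "(matrix_inv g *v h v) $ i \<noteq> (matrix_inv g *v h u) $ i" for v
        using Ints_nonzero_abs_ge1[OF Ints_diff[OF I[OF that(1)] I[OF u]]] that(2) by simp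
      then show "\<exists>e>0. \<forall>v. v \<in> S \<and> (matrix_inv g *v h v) $ i \<noteq> (matrix_inv g *v h u) $ i \<longrightarrow>
          e \<le> norm ((matrix_inv g *v h v) $ i - (matrix_inv g *v h u) $ i)" by (intro exI[of _ 1]) auto
    qed
    then obtain c where "\<forall>u\<in>S. (matrix_inv g *v h u) $ i = c" unfolding constant_on_def by blast
    then show ?thesis using xy by simp
  qed
  then have "matrix_inv g *v h x = matrix_inv g *v h y" by (simp add: vec_eq_iff)
  then show ?thesis by (metis matrix_vector_mul_cancel(1)[OF g])
qed

section \<open>Lifts and their equivariance\<close>

definition lifts :: "real^'n^'n \<Rightarrow> real^'n^'n \<Rightarrow> ((real^'n) set \<Rightarrow> (real^'n) set) \<Rightarrow> (real^'n \<Rightarrow> real^'n) \<Rightarrow> bool" where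
  "lifts g g' f F \<longleftrightarrow> torus_lift (lattice g) (lattice g') f F"

text \<open>The same integer coefficients \<open>z\<close> occur on both sides, so the condition
  records how ordered bases correspond, not merely how a lattice is mapped to a lattice.\<close>

definition equivariant_map :: "real^'n^'n \<Rightarrow> real^'n^'n \<Rightarrow> (real^'n \<Rightarrow> real^'n) \<Rightarrow> bool" where
  "equivariant_map g g' F \<longleftrightarrow> (\<forall>z\<in>int_lattice. \<forall>x. F (x + g *v z) = F x + g' *v z)"

lemma equivariant_mapD: "equivariant_map g g' F \<Longrightarrow> z \<in> int_lattice \<Longrightarrow> F (x + g *v z) = F x + g' *v z"
  by (simp add: equivariant_map_def)

lemma equivariant_mapI_axis:
  assumes "\<And>x i. F (x + g *v axis i 1) = F x + g' *v axis i 1"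
  shows "equivariant_map g g' F"
  unfolding equivariant_map_def
proof
  fix z :: "real^'a" assume "z \<in> int_lattice"
  then show "\<forall>x. F (x + g *v z) = F x + g' *v z"
  proof (induction rule: int_lattice_induct)
    case (add y z)
    then show ?case by (simp add: matrix_vector_right_distrib add.assoc[symmetric])
  next
    case (minus z)
    show ?case
    proof
      fix x
      have "F ((x - g *v z) + g *v z) = F (x - g *v z) + g' *v z" using minus by blast
      then show "F (x + g *v - z) = F x + g' *v - z" by (simp add: matrix_vector_mult_minus)
    qed
  qed (simp_all add: assms)
qed

lemma equivariant_map_matrix: "equivariant_map g (A ** g) (\<lambda>x. A *v x)"
  by (simp add: equivariant_map_def matrix_vector_right_distrib matrix_vector_mul_assoc)

lemma equivariant_map_compose:
  "equivariant_map g g' F \<Longrightarrow> equivariant_map g' g'' F' \<Longrightarrow> equivariant_map g g'' (F' \<circ> F)"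
  by (simp add: equivariant_map_def)

lemma equivariant_map_cancel:
  assumes "equivariant_map g g'' (F' \<circ> F)" "equivariant_map g' g'' F'" "inj F'"
  shows "equivariant_map g g' F"
  using assms unfolding equivariant_map_def by (metis comp_apply injD)

lemma liftsD: "lifts g g' f F \<Longrightarrow> continuous_on UNIV F" "lifts g g' f F \<Longrightarrow> coset g' (F x) = f (coset g x)"
  by (auto simp: lifts_def torus_lift_def)

lemma lifts_compose: "lifts g g' f F \<Longrightarrow> lifts g' g'' f' F' \<Longrightarrow> lifts g g'' (f' \<circ> f) (F' \<circ> F)"
  by (auto simp: lifts_def torus_lift_def intro: continuous_on_compose2)

lemma lift_exists:
  fixes g g' :: "real^'n^'n"
  assumes g: "det g \<noteq> 0" and g': "det g' \<noteq> 0" and f: "continuous_map (torus_top g) (torus_top g') f"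
  obtains F where "lifts g g' f F"
proof -
  have "continuous_map (top_of_set UNIV) (torus_top g') (f \<circ> coset g)"
    using continuous_map_compose[OF continuous_map_coset[OF g] f] by simp
  from torus_map_lift[OF g' convex_UNIV this]
  obtain K where "continuous_on UNIV K" "\<forall>x\<in>UNIV. coset g' (K x) = (f \<circ> coset g) x" by (elim exE conjE)
  then have "lifts g g' f K" by (simp add: lifts_def torus_lift_def)
  then show thesis by (rule that)
qed

lemma lifts_diff_constant:
  fixes g g' :: "real^'n^'n"
  assumes g': "det g' \<noteq> 0" and F: "lifts g g' f F" and F': "lifts g g' f F'"
  obtains c where "c \<in> lattice g'" "\<And>x. F' x = F x + c"
proof -
  have mem: "F' x - F x \<in> lattice g'" for x
    using liftsD(2)[OF F, of x] liftsD(2)[OF F', of x] by (simp only: coset_eq_iff[symmetric])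
  have "F' x - F x = F' 0 - F 0" for x
    by (rule continuous_lattice_valued_constant[OF g' connected_UNIV _ mem])
      (auto intro!: continuous_intros liftsD(1)[OF F] liftsD(1)[OF F'])
  then have "F' x = F x + (F' 0 - F 0)" for x by (metis add.commute diff_add_cancel)
  with mem[of 0] show thesis by (rule that)
qed

text \<open>Precomposing a lift with a lattice translation gives another lift of the same
  map.\<close>

lemma lift_translation:
  fixes g g' :: "real^'n^'n"
  assumes g': "det g' \<noteq> 0" and F: "lifts g g' f F" and l: "l \<in> lattice g"
  obtains c where "c \<in> lattice g'" "\<And>x. F (x + l) = F x + c"
proof -
  have "lifts g g' f (\<lambda>x. F (x + l))"
    unfolding lifts_def torus_lift_def
  proof (intro conjI allI)
    show "continuous_on UNIV (\<lambda>x. F (x + l))"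
      by (rule continuous_on_compose2[OF liftsD(1)[OF F]]) (auto intro!: continuous_intros)
    show "coset g' (F (x + l)) = f (coset g x)" for x
      using liftsD(2)[OF F, of "x + l"] coset_add_lattice[OF l, of x] by simp
  qed
  from lifts_diff_constant[OF g' F this] that show thesis by blast
qed

lemma equivariant_map_lift_unique:
  fixes g g' h h' :: "real^'n^'n"
  assumes "det g' \<noteq> 0" "lifts g g' f F" "lifts g g' f F'" "equivariant_map h h' F"
  shows "equivariant_map h h' F'"
proof -
  obtain c where "\<And>x. F' x = F x + c" using lifts_diff_constant[OF assms(1-3)] by blast
  then show ?thesis using assms(4) by (simp add: equivariant_map_def add_ac)
qed

section \<open>Homotopies of maps of tori\<close>

text \<open>The whole homotopy is lifted over the strip. The increment under \<open>l\<close> is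
  continuous and lattice-valued there, so it agrees at both ends and at all points.\<close>

lemma homotopic_lifts_translation:
  fixes g g' :: "real^'n^'n"
  assumes g: "det g \<noteq> 0" and g': "det g' \<noteq> 0"
    and hom: "homotopic_with (\<lambda>_. True) (torus_top g) (torus_top g') \<phi> \<psi>"
    and F: "lifts g g' \<phi> F" and G: "lifts g g' \<psi> G" and l: "l \<in> lattice g"
  shows "F (x + l) - F x = G (y + l) - G y"
proof -
  obtain h where h: "continuous_map (prod_topology (top_of_set {0..1::real}) (torus_top g)) (torus_top g') h"
    "\<And>p. h (0, p) = \<phi> p" "\<And>p. h (1, p) = \<psi> p" using hom unfolding homotopic_with_def by blast
  let ?S = "{0..1::real} \<times> (UNIV :: (real^'n) set)"
  have S: "convex ?S" by (intro convex_Times) auto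
  have "continuous_map (prod_topology (top_of_set {0..1::real}) euclidean) (prod_topology (top_of_set {0..1::real}) (torus_top g)) (\<lambda>u. (fst u, coset g (snd u)))"
    by (intro continuous_map_pairedI continuous_map_fst continuous_map_compose[OF continuous_map_snd continuous_map_coset[OF g], unfolded o_def])
  from continuous_map_compose[OF this h(1)]
  have "continuous_map (top_of_set ?S) (torus_top g') (\<lambda>u. h (fst u, coset g (snd u)))"
    using prod_topology_subtopology_eu[of "{0..1::real}" "UNIV :: (real^'n) set"] by (simp add: o_def)
  from torus_map_lift[OF g' S this] obtain K where K: "continuous_on ?S K"
    "\<And>u. u \<in> ?S \<Longrightarrow> coset g' (K u) = h (fst u, coset g (snd u))" by blast
  define D where "D u = K (fst u, snd u + l) - K u" for u
  have DS: "D u \<in> lattice g'" if "u \<in> ?S" for u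
    using K(2)[OF that] K(2)[of "(fst u, snd u + l)"] that coset_add_lattice[OF l, of "snd u"]
    unfolding D_def coset_eq_iff[symmetric] by auto
  have Dc: "continuous_on ?S D" unfolding D_def
    by (intro continuous_intros K(1) continuous_on_compose2[OF K(1)]) auto
  have D: "D u = D v" if "u \<in> ?S" "v \<in> ?S" for u v
    by (rule continuous_lattice_valued_constant[OF g' convex_connected[OF S] Dc DS that])
  have "lifts g g' \<phi> (\<lambda>x. K (0, x))" "lifts g g' \<psi> (\<lambda>x. K (1, x))"
    unfolding lifts_def torus_lift_def using K(2) h(2,3)
    by (auto intro!: continuous_on_compose2[OF K(1)] continuous_intros)
  then obtain a b where "\<And>x. K (0, x) = F x + a" "\<And>x. K (1, x) = G x + b"
    using lifts_diff_constant[OF g' F] lifts_diff_constant[OF g' G] by metis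
  then have "F (x + l) - F x = D (0, x)" "G (y + l) - G y = D (1, y)" by (simp_all add: D_def)
  then show ?thesis using D[of "(0, x)" "(1, y)"] by simp
qed

lemma homotopic_lifts_equivariant:
  fixes g g' h :: "real^'n^'n"
  assumes "det g \<noteq> 0" "det g' \<noteq> 0" "homotopic_with (\<lambda>_. True) (torus_top g) (torus_top g') \<phi> \<psi>"
    and "lifts g g' \<phi> F" "lifts g g' \<psi> G" "equivariant_map g h F"
  shows "equivariant_map g h G"
  unfolding equivariant_map_def
proof (intro ballI allI)
  fix z x :: "real^'n" assume z: "z \<in> int_lattice"
  have "F (x + g *v z) - F x = G (x + g *v z) - G x"
    by (rule homotopic_lifts_translation[OF assms(1-5)]) (use z in auto)
  then show "G (x + g *v z) = G x + h *v z" using equivariant_mapD[OF assms(6) z, of x] by (simp add: algebra_simps)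
qed

text \<open>The lifts transform alike under the lattice, so their straight-line homotopy does so too
  and descends to the torus.\<close>

theorem equivariant_lifts_homotopic:
  fixes g g' :: "real^'n^'n"
  assumes g: "det g \<noteq> 0" and g': "det g' \<noteq> 0"
    and F: "lifts g g' \<phi> F" "equivariant_map g h F" and G: "lifts g g' \<psi> G" "equivariant_map g h G"
  shows "homotopic_with (\<lambda>_. True) (torus_top g) (torus_top g') \<phi> \<psi>"
proof -
  let ?I = "top_of_set {0..1::real}"
  define k where "k = (\<lambda>(t::real, x). coset g' ((1 - t) *\<^sub>R F x + t *\<^sub>R G x))"
  define rep where "rep p = (SOME x. coset g x = p)" for p
  have kper: "k (t, x + l) = k (t, x)" if "l \<in> lattice g" for t x l
  proof -
    obtain z where z: "z \<in> int_lattice" "l = g *v z" using \<open>l \<in> lattice g\<close> by blast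
    obtain c where c: "c \<in> lattice g'" "\<And>x. F (x + l) = F x + c"
      using lift_translation[OF g' F(1) \<open>l \<in> lattice g\<close>] by blast
    \<comment> \<open>The matrix \<open>h\<close> is not assumed to generate the target lattice;
      comparison with the translation of the lift \<open>F\<close> puts \<open>h *v z\<close> into
      it.\<close>
    have "c = h *v z" using c(2)[of 0] equivariant_mapD[OF F(2) z(1), of 0] z(2) by simp
    then have "G (x + l) = G x + c" using equivariant_mapD[OF G(2) z(1), of x] z(2) by simp
    then have "(1 - t) *\<^sub>R F (x + l) + t *\<^sub>R G (x + l) = ((1 - t) *\<^sub>R F x + t *\<^sub>R G x) + c"
      by (simp only: c(2)) (simp add: algebra_simps)
    then show ?thesis using coset_add_lattice[OF c(1)] by (simp add: k_def)
  qed
  have krep: "k (t, rep (coset g x)) = k (t, x)" for t x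
  proof -
    have "coset g (rep (coset g x)) = coset g x" unfolding rep_def by (rule someI) (rule refl)
    then have "rep (coset g x) - x \<in> lattice g" by (simp only: coset_eq_iff)
    from kper[OF this, of t x] show ?thesis by simp
  qed
  \<comment> \<open>Taking the product with an identity map can destroy the quotient property; local
    compactness of the interval preserves it.\<close>
  have q: "quotient_map (prod_topology ?I euclidean) (prod_topology ?I (torus_top g)) (\<lambda>(t, x). (t, coset g x))"
  proof (rule quotient_map_prod_right[OF _ _ quotient_map_coset[OF g]])
    show "locally_compact_space ?I" by (simp add: compact_imp_locally_compact_space compact_space_subtopology)
    show "Hausdorff_space ?I \<or> regular_space ?I" by (simp add: Hausdorff_space_subtopology)
  qed
  have kc: "continuous_map (prod_topology ?I euclidean) (torus_top g') k"
  proof -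
    have "continuous_on ({0..1} \<times> UNIV) (\<lambda>u::real \<times> (real^'n). (1 - fst u) *\<^sub>R F (snd u) + fst u *\<^sub>R G (snd u))"
      by (intro continuous_intros continuous_on_compose2[OF liftsD(1)[OF F(1)]] continuous_on_compose2[OF liftsD(1)[OF G(1)]]) auto
    then have "continuous_map (prod_topology ?I euclidean) euclidean (\<lambda>u. (1 - fst u) *\<^sub>R F (snd u) + fst u *\<^sub>R G (snd u))"
      using prod_topology_subtopology_eu[of "{0..1::real}" "UNIV :: (real^'n) set"] by simp
    from continuous_map_compose[OF this continuous_map_coset[OF g']] show ?thesis
      by (simp add: k_def o_def case_prod_unfold)
  qed
  define H where "H = (\<lambda>(t, p). k (t, rep p))"
  have "continuous_map (prod_topology ?I (torus_top g)) (torus_top g') H"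
  proof (rule continuous_compose_quotient_map[OF q])
    have "H \<circ> (\<lambda>(t, x). (t, coset g x)) = k" by (auto simp: H_def krep)
    then show "continuous_map (prod_topology ?I euclidean) (torus_top g') (H \<circ> (\<lambda>(t, x). (t, coset g x)))"
      using kc by simp
  qed
  moreover have "H (0, p) = \<phi> p" "H (1, p) = \<psi> p" if p: "p \<in> topspace (torus_top g)" for p
  proof -
    obtain x where x: "p = coset g x" using p by (auto simp: topspace_torus_top[OF g] torus_def)
    show "H (0, p) = \<phi> p" "H (1, p) = \<psi> p"
      by (simp_all add: H_def x krep) (simp_all add: k_def liftsD(2)[OF F(1)] liftsD(2)[OF G(1)])
  qed
  ultimately show ?thesis by (subst homotopic_with) auto
qed

section \<open>Maps of tori induced by matrices and isometries of tori\<close>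

definition torus_matrix_map :: "real^'n^'n \<Rightarrow> (real^'n) set \<Rightarrow> (real^'n) set" where
  "torus_matrix_map A p = (\<lambda>x. A *v x) ` p"

lemma torus_matrix_map_coset: "torus_matrix_map A (coset g x) = coset (A ** g) (A *v x)"
  by (simp add: torus_matrix_map_def lattice_coset_def image_image matrix_vector_right_distrib matrix_vector_mul_assoc)

lemma lifts_torus_matrix_map: "lifts g (A ** g) (torus_matrix_map A) (\<lambda>x. A *v x)"
  unfolding lifts_def torus_lift_def
  by (simp only: torus_matrix_map_coset matrix_vector_mult_linear_continuous_on simp_thms)

lemma continuous_map_torus_matrix_map:
  fixes g A :: "real^'n^'n"
  assumes g: "det g \<noteq> 0" and A: "det A \<noteq> 0"
  shows "continuous_map (torus_top g) (torus_top (A ** g)) (torus_matrix_map A)"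
proof (rule continuous_compose_quotient_map[OF quotient_map_coset[OF g]])
  have "det (A ** g) \<noteq> 0" using g A by (simp add: det_mul)
  moreover have "continuous_map euclidean euclidean (\<lambda>x. A *v x)"
    using matrix_vector_mult_linear_continuous_on[of UNIV A] by simp
  ultimately have "continuous_map euclidean (torus_top (A ** g)) (coset (A ** g) \<circ> (\<lambda>x. A *v x))"
    by (intro continuous_map_compose[OF _ continuous_map_coset])
  moreover have "torus_matrix_map A \<circ> coset g = coset (A ** g) \<circ> (\<lambda>x. A *v x)"
    by (rule ext) (simp only: o_def torus_matrix_map_coset)
  ultimately show "continuous_map euclidean (torus_top (A ** g)) (torus_matrix_map A \<circ> coset g)" by simp
qed

lemma torus_matrix_map_inverse:
  assumes "det A \<noteq> 0"
  shows "torus_matrix_map (matrix_inv A) (torus_matrix_map A p) = p"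
    and "torus_matrix_map A (torus_matrix_map (matrix_inv A) p) = p"
  unfolding torus_matrix_map_def image_image matrix_vector_mul_cancel[OF assms] by simp_all

lemma det_matrix_inv_nonzero:
  fixes A :: "real^'n^'n"
  shows "det A \<noteq> 0 \<Longrightarrow> det (matrix_inv A) \<noteq> 0"
  by (metis det_I det_mul invertible_det_nz matrix_inv_right_real mult_zero_right zero_neq_one)

lemma homeomorphic_map_torus_matrix_map:
  fixes g A :: "real^'n^'n"
  assumes g: "det g \<noteq> 0" and A: "det A \<noteq> 0"
  shows "homeomorphic_map (torus_top g) (torus_top (A ** g)) (torus_matrix_map A)"
proof -
  have "matrix_inv A ** (A ** g) = g"
    by (metis A invertible_det_nz matrix_inv_left_real matrix_mul_assoc matrix_mul_lid)
  then have "continuous_map (torus_top (A ** g)) (torus_top g) (torus_matrix_map (matrix_inv A))"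
    using continuous_map_torus_matrix_map[of "A ** g" "matrix_inv A"] g A det_matrix_inv_nonzero[OF A]
    by (simp add: det_mul)
  then have "homeomorphic_maps (torus_top g) (torus_top (A ** g)) (torus_matrix_map A) (torus_matrix_map (matrix_inv A))"
    unfolding homeomorphic_maps_def
    using continuous_map_torus_matrix_map[OF g A] torus_matrix_map_inverse[OF A] by blast
  then show ?thesis by (rule homeomorphic_maps_imp_map)
qed

lemma torus_isometry_torus_matrix_map:
  fixes g K :: "real^'n^'n"
  assumes g: "det g \<noteq> 0" and K: "orthogonal_matrix K"
  shows "torus_isometry (lattice g) (lattice (K ** g)) (torus_matrix_map K)"
proof -
  have K0: "det K \<noteq> 0"
    using K by (metis det_I det_mul mult_zero_left orthogonal_matrix_def zero_neq_one)
  have "det (K ** g) \<noteq> 0" using g K0 by (simp add: det_mul)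
  then have "bij_betw (torus_matrix_map K) (torus (lattice g)) (torus (lattice (K ** g)))"
    using homeomorphic_map_torus_matrix_map[OF g K0] topspace_torus_top g
    by (metis bij_betw_def homeomorphic_imp_injective_map homeomorphic_imp_surjective_map)
  moreover have "setdist (torus_matrix_map K p) (torus_matrix_map K q) = setdist p q" for p q
  proof -
    have "orthogonal_transformation (\<lambda>x. K *v x)" using K by (simp add: orthogonal_transformation_matrix)
    then have d: "dist (K *v x) (K *v y) = dist x y" for x y
      by (simp add: orthogonal_transformation_isometry)
    have "{dist x y | x y. x \<in> torus_matrix_map K p \<and> y \<in> torus_matrix_map K q} = {dist x y | x y. x \<in> p \<and> y \<in> q}"
    proof (intro equalityI subsetI)
      fix a assume "a \<in> {dist x y | x y. x \<in> p \<and> y \<in> q}"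
      then obtain x y where "x \<in> p" "y \<in> q" "a = dist (K *v x) (K *v y)" by (auto simp: d)
      then show "a \<in> {dist x y | x y. x \<in> torus_matrix_map K p \<and> y \<in> torus_matrix_map K q}"
        unfolding torus_matrix_map_def by blast
    next
      fix a assume "a \<in> {dist x y | x y. x \<in> torus_matrix_map K p \<and> y \<in> torus_matrix_map K q}"
      then obtain x y where "x \<in> p" "y \<in> q" "a = dist (K *v x) (K *v y)"
        unfolding torus_matrix_map_def by blast
      then show "a \<in> {dist x y | x y. x \<in> p \<and> y \<in> q}" unfolding d by blast
    qed
    then show ?thesis by (simp add: setdist_def torus_matrix_map_def)
  qed
  ultimately show ?thesis by (simp add: torus_isometry_def)
qed

text \<open>While the images stay closer than half the lattice gap, their distance is the torus
  distance of their cosets, which is at most the distance of the sources. Continuity provides this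
  locally, and following the segment from \<open>x\<close> to \<open>y\<close> makes it
  global.\<close>

lemma lift_of_distance_preserving_map_lipschitz:
  fixes g g' :: "real^'n^'n"
  assumes g': "det g' \<noteq> 0" and H: "lifts g g' h H"
    and h: "\<And>x y. setdist (h (coset g x)) (h (coset g y)) = setdist (coset g x) (coset g y)"
  shows "dist (H x) (H y) \<le> dist x y"
proof -
  obtain r where r: "r > 0" "\<And>l. l \<in> lattice g' \<Longrightarrow> l \<noteq> 0 \<Longrightarrow> r \<le> norm l"
    using lattice_separated[OF g'] by blast
  have loc: "dist (H v) (H u) \<le> dist v u" if "dist (H v) (H u) < r / 2" for u v
  proof -
    obtain l where l: "l \<in> lattice g'" "setdist (coset g' (H v)) (coset g' (H u)) = dist (H v) (H u + l)"
      by (rule setdist_coset_attained[OF g'])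
    have "setdist (coset g' (H v)) (coset g' (H u)) = setdist (coset g v) (coset g u)"
      by (simp only: liftsD(2)[OF H] h)
    also have "\<dots> \<le> dist v u" by (rule setdist_coset_le)
    finally have le: "dist (H v) (H u + l) \<le> dist v u" using l(2) by simp
    have le2: "dist (H v) (H u + l) \<le> dist (H v) (H u)" using l(2) setdist_coset_le[of g' "H v" "H u"] by simp
    have "norm l \<le> dist (H v) (H u + l) + dist (H v) (H u)"
      using norm_triangle_ineq4[of "H v - H u" "H v - (H u + l)"] by (simp add: dist_norm)
    then have "norm l < r" using le2 that by linarith
    then have "l = 0" using r(2)[OF l(1)] by linarith
    then show ?thesis using le by simp
  qed
  define M where "M = dist x y"
  have M: "M \<ge> 0" by (simp add: M_def)
  let ?p = "\<lambda>t. x + t *\<^sub>R (y - x)"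
  have dp: "dist (?p t) (?p s) = \<bar>t - s\<bar> * M" for s t
  proof -
    have "?p t - ?p s = (t - s) *\<^sub>R (y - x)" by (simp add: algebra_simps)
    then show ?thesis by (simp add: dist_norm M_def norm_minus_commute)
  qed
  have "lipschitz_on M {0..1} (\<lambda>t. H (?p t))"
  proof (rule locally_lipschitz_imp_lipschitz)
    show "continuous_on {0..1} (\<lambda>t. H (?p t))"
      by (intro continuous_on_compose2[OF liftsD(1)[OF H]] continuous_intros) auto
    fix s t :: real assume "s < t"
    have "continuous (at (?p s)) H" using liftsD(1)[OF H] by (simp add: continuous_on_eq_continuous_at)
    then obtain d where d: "d > 0" "\<And>v. dist v (?p s) < d \<Longrightarrow> dist (H v) (H (?p s)) < r / 2"
      unfolding continuous_at_eps_delta using half_gt_zero[OF r(1)] by (metis dist_commute)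
    \<comment> \<open>The step is short enough for both points of the segment to lie within
      \<open>d\<close>; dividing by \<open>M + 1\<close> also covers \<open>M = 0\<close>.\<close>
    define z where "z = min t (s + d / (M + 1))"
    have "d / (M + 1) > 0" using d M by simp
    then have z: "z \<in> {s<..t}" "z - s \<le> d / (M + 1)" using \<open>s < t\<close> by (auto simp: z_def)
    have "\<bar>z - s\<bar> * M < d"
    proof -
      have "\<bar>z - s\<bar> * M \<le> d / (M + 1) * M" using z M by (intro mult_right_mono) auto
      also have "\<dots> < d" using d M by (simp add: field_simps)
      finally show ?thesis .
    qed
    then have "dist (H (?p z)) (H (?p s)) \<le> dist (?p z) (?p s)" by (intro loc d(2)) (simp only: dp)
    also have "\<dots> = M * (z - s)" using z(1) by (simp only: dp) simp
    finally show "\<exists>z\<in>{s<..t}. dist (H (?p z)) (H (?p s)) \<le> M * (z - s)" using z(1) by blast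
  qed (rule M)
  from lipschitz_onD[OF this, of 0 1] show ?thesis by (simp add: M_def)
qed

lemma lifts_id: "lifts g g (\<lambda>p. p) (\<lambda>x. x)"
  by (simp add: lifts_def torus_lift_def)

lemma lift_inverse:
  fixes g g' :: "real^'n^'n"
  assumes g: "det g \<noteq> 0" and F: "lifts g g' f F" and G: "lifts g' g f' G"
    and inv: "\<And>x. f' (f (coset g x)) = coset g x"
  obtains c where "\<And>x. G (F x) = x + c"
proof -
  have "lifts g g (f' \<circ> f) (G \<circ> F)" by (rule lifts_compose[OF F G])
  then have "lifts g g (\<lambda>p. p) (G \<circ> F)" by (simp add: lifts_def torus_lift_def inv)
  from lifts_diff_constant[OF g lifts_id this] obtain c where "\<And>x. (G \<circ> F) x = x + c" by blast
  then show thesis using that by simp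
qed

text \<open>Lifts of mutually inverse maps compose to lifts of the identity, which are determined
  only up to additive constants.\<close>

lemma homeomorphic_torus_inverse_lift:
  fixes g g' :: "real^'n^'n"
  assumes g: "det g \<noteq> 0" and g': "det g' \<noteq> 0"
    and f: "homeomorphic_map (torus_top g) (torus_top g') f" and F: "lifts g g' f F"
  obtains G c c' where "lifts g' g (inv_into (torus (lattice g)) f) G" "\<And>x. G (F x) = x + c" "\<And>y. F (G y) = y + c'"
    "continuous_map (torus_top g') (torus_top g) (inv_into (torus (lattice g)) f)"
proof -
  let ?i = "inv_into (torus (lattice g)) f"
  obtain k where k: "homeomorphic_maps (torus_top g) (torus_top g') f k" using f homeomorphic_map_maps by blast
  note ts = topspace_torus_top[OF g] topspace_torus_top[OF g']
  have bij: "bij_betw f (torus (lattice g)) (torus (lattice g'))"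
    using f ts by (metis bij_betw_def homeomorphic_imp_injective_map homeomorphic_imp_surjective_map)
  have i1: "?i (f (coset g x)) = coset g x" for x
    using bij by (intro inv_into_f_f) (auto simp: bij_betw_def torus_def)
  have i2: "f (?i (coset g' x)) = coset g' x" for x
    using bij by (intro f_inv_into_f) (auto simp: bij_betw_def torus_def)
  have "continuous_map (torus_top g') (torus_top g) ?i"
  proof (rule continuous_map_eq)
    show "continuous_map (torus_top g') (torus_top g) k" using k by (simp add: homeomorphic_maps_def)
    fix q assume q: "q \<in> topspace (torus_top g')"
    then have "f (k q) = q" "k q \<in> torus (lattice g)"
      using k ts by (auto simp: homeomorphic_maps_def dest: continuous_map_funspace)
    then show "k q = ?i q" using bij by (metis bij_betw_def inv_into_f_f)
  qed
  moreover from lift_exists[OF g' g this] obtain G where G: "lifts g' g ?i G" by blast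
  moreover obtain c where "\<And>x. G (F x) = x + c" using lift_inverse[OF g F G i1] by blast
  moreover obtain c' where "\<And>y. F (G y) = y + c'" using lift_inverse[OF g' G F i2] by blast
  ultimately show thesis using that by blast
qed

lemma lift_inj:
  fixes g g' :: "real^'n^'n"
  assumes "det g \<noteq> 0" "det g' \<noteq> 0" "homeomorphic_map (torus_top g) (torus_top g') f" "lifts g g' f F"
  shows "inj F"
proof -
  obtain G c where "\<And>x. G (F x) = x + c" using homeomorphic_torus_inverse_lift[OF assms] by metis
  then show ?thesis by (metis add_right_cancel injI)
qed

text \<open>The lift and a lift of the inverse both do not increase distances, so the lift is an
  isometry of Euclidean space and therefore affine with orthogonal linear part.\<close>

lemma torus_isometry_lift:
  fixes g g' :: "real^'n^'n"
  assumes g: "det g \<noteq> 0" and g': "det g' \<noteq> 0" and h: "torus_isometry (lattice g) (lattice g') h"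
  obtains H K c where "lifts g g' h H" "orthogonal_matrix K" "\<And>x. H x = K *v x + c"
    "homeomorphic_map (torus_top g) (torus_top g') h"
proof -
  have bij: "bij_betw h (torus (lattice g)) (torus (lattice g'))"
    and iso: "\<And>p q. p \<in> torus (lattice g) \<Longrightarrow> q \<in> torus (lattice g) \<Longrightarrow> setdist (h p) (h q) = setdist p q"
    using h by (auto simp: torus_isometry_def)
  interpret M: Metric_space12 "torus (lattice g)" setdist "torus (lattice g')" setdist
    by (simp add: Metric_space12_def Metric_space_torus g g')
  have hom: "homeomorphic_map (torus_top g) (torus_top g') h"
    unfolding torus_topology_def using bij iso by (intro M.isometry_imp_homeomorphic_map) (auto simp: bij_betw_def)
  have mem: "coset g x \<in> torus (lattice g)" "coset g' x \<in> torus (lattice g')" for x by (auto simp: torus_def)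
  obtain H where H: "lifts g g' h H"
    using lift_exists[OF g g' homeomorphic_imp_continuous_map[OF hom]] by blast
  let ?i = "inv_into (torus (lattice g)) h"
  obtain G c where G: "lifts g' g ?i G" and GH: "\<And>x. G (H x) = x + c"
    using homeomorphic_torus_inverse_lift[OF g g' hom H] by metis
  have isoi: "setdist (?i (coset g' x)) (?i (coset g' y)) = setdist (coset g' x) (coset g' y)" for x y
  proof -
    have "?i (coset g' u) \<in> torus (lattice g)" "h (?i (coset g' u)) = coset g' u" for u
    proof -
      have im: "coset g' u \<in> h ` torus (lattice g)" using mem(2)[of u] bij by (simp add: bij_betw_def)
      show "?i (coset g' u) \<in> torus (lattice g)" by (rule inv_into_into[OF im])
      show "h (?i (coset g' u)) = coset g' u" by (rule f_inv_into_f[OF im])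
    qed
    then show ?thesis using iso[of "?i (coset g' x)" "?i (coset g' y)"] by simp
  qed
  have "dist (H x) (H y) = dist x y" for x y
  proof (rule order_antisym)
    show "dist (H x) (H y) \<le> dist x y"
      by (rule lift_of_distance_preserving_map_lipschitz[OF g' H]) (intro iso mem)
    have "dist (G (H x)) (G (H y)) \<le> dist (H x) (H y)"
      by (rule lift_of_distance_preserving_map_lipschitz[OF g G isoi])
    then show "dist x y \<le> dist (H x) (H y)" by (simp add: GH)
  qed
  then have ot: "orthogonal_transformation (\<lambda>x. H x - H 0)"
    by (simp add: orthogonal_transformation_isometry dist_norm)
  define K where "K = matrix (\<lambda>x. H x - H 0)"
  have "orthogonal_matrix K" using ot by (simp add: K_def orthogonal_transformation_matrix)
  moreover have "H x = K *v x + H 0" for x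
    using matrix_works[of "\<lambda>x. H x - H 0" x] ot
    by (simp add: K_def orthogonal_transformation_linear linear_matrix_vector_mul_eq)
  ultimately show thesis using that H hom by blast
qed

section \<open>Markings\<close>

lemma det_integer_matrix:
  assumes "\<And>i j. (B::real^'n^'n) $ i $ j \<in> \<int>"
  shows "det B \<in> \<int>"
  unfolding det_def using assms by (intro Ints_sum Ints_mult Ints_prod) auto

lemma lattice_subset_factor:
  fixes g g' :: "real^'n^'n"
  assumes "lattice g \<subseteq> lattice g'"
  obtains B where "g = g' ** B" "det B \<in> \<int>"
proof -
  have "\<forall>i. \<exists>z\<in>int_lattice. g *v axis i 1 = g' *v z" using assms by (auto simp: image_subset_iff image_iff)
  then obtain z where z: "\<And>i. z i \<in> int_lattice" "\<And>i. g *v axis i 1 = g' *v z i" by metis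
  define B :: "real^'n^'n" where "B = (\<chi> a i. z i $ a)"
  have "B *v axis i 1 = z i" for i by (simp add: matrix_vector_mult_basis B_def column_def vec_eq_iff)
  then have "g *v axis i 1 = (g' ** B) *v axis i 1" for i by (simp add: z(2) matrix_vector_mul_assoc[symmetric])
  then have "column i g = column i (g' ** B)" for i by (simp add: matrix_vector_mult_basis)
  then have "g = g' ** B" by (simp add: vec_eq_iff column_def)
  moreover have "det B \<in> \<int>" using z(1) by (intro det_integer_matrix) (simp add: B_def int_lattice_def)
  ultimately show thesis using that by blast
qed

text \<open>The changes of basis in both directions are integral, and their determinants are
  integers with product 1.\<close>

lemma lattice_eq_imp_abs_det_eq_1:
  fixes g g' :: "real^'n^'n"
  assumes eq: "lattice g = lattice g'" and d: "\<bar>det g'\<bar> = 1"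
  shows "\<bar>det g\<bar> = 1"
proof -
  obtain B where B: "g = g' ** B" "det B \<in> \<int>" by (rule lattice_subset_factor[OF equalityD1[OF eq]])
  obtain C where C: "g' = g ** C" "det C \<in> \<int>" by (rule lattice_subset_factor[OF equalityD2[OF eq]])
  obtain b c :: int where bc: "det B = of_int b" "det C = of_int c" using B(2) C(2) by (auto simp: Ints_def)
  have "det g' = det g' * det B * det C" by (metis B(1) C(1) det_mul)
  then have "det B * det C = 1" using d by (metis abs_zero mult.assoc mult_cancel_left mult.right_neutral zero_neq_one)
  then have "b * c = 1" using bc by (metis of_int_1 of_int_eq_iff of_int_mult)
  then have "\<bar>b\<bar> = 1" using abs_zmult_eq_1[of b c] by simp
  then have "\<bar>det B\<bar> = 1" by (metis bc(1) of_int_1 of_int_abs)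
  then show ?thesis using d by (simp add: B(1) det_mul abs_mult)
qed

text \<open>One inclusion comes from injectivity of \<open>f\<close> on the torus, the other from
  injectivity of its lift. So a matrix found through equivariance alone does generate the lattice of
  the torus.\<close>

lemma equivariant_lift_lattice:
  fixes g g0 g' :: "real^'n^'n"
  assumes g0: "det g0 \<noteq> 0" and g': "det g' \<noteq> 0" and f: "homeomorphic_map (torus_top g0) (torus_top g') f"
    and F: "lifts g0 g' f F" and e: "equivariant_map g g' F"
  shows "lattice g = lattice g0"
proof (intro equalityI subsetI)
  fix l assume "l \<in> lattice g"
  then obtain z where z: "z \<in> int_lattice" "l = g *v z" by blast
  have "F (0 + l) = F 0 + g' *v z" unfolding z(2) by (rule equivariant_mapD[OF e z(1)])
  moreover have "g' *v z \<in> lattice g'" using z(1) by blast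
  ultimately have "coset g' (F (0 + l)) = coset g' (F 0)" by (simp only: coset_add_lattice)
  then have "f (coset g0 (0 + l)) = f (coset g0 0)" by (simp only: liftsD(2)[OF F])
  moreover have "inj_on f (torus (lattice g0))"
    using homeomorphic_imp_injective_map[OF f] by (simp add: topspace_torus_top[OF g0])
  ultimately have "coset g0 (0 + l) = coset g0 0" by (auto simp: inj_on_def torus_def)
  then show "l \<in> lattice g0" by (simp only: coset_eq_iff add_0 diff_zero)
next
  fix l assume l: "l \<in> lattice g0"
  obtain c where c: "c \<in> lattice g'" "\<And>x. F (x + l) = F x + c" using lift_translation[OF g' F l] by blast
  then obtain z where z: "z \<in> int_lattice" "c = g' *v z" by blast
  have "F (0 + l) = F (0 + g *v z)" using c(2) equivariant_mapD[OF e z(1)] z(2) by metis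
  then have "l = g *v z" using lift_inj[OF g0 g' f F] by (metis add_0 injD)
  then show "l \<in> lattice g" using z(1) by blast
qed

text \<open>The wanted columns are preimages of target basis vectors, so they are read off from a
  lift \<open>G\<close> of the inverse map. As \<open>G \<circ> F\<close> is a translation,
  cancelling \<open>G\<close> transfers the equivariance to \<open>F\<close>.\<close>

lemma lift_equivariant_exists:
  fixes g0 g' :: "real^'n^'n"
  assumes g0: "det g0 \<noteq> 0" and g': "det g' \<noteq> 0" and f: "homeomorphic_map (torus_top g0) (torus_top g') f"
    and F: "lifts g0 g' f F"
  obtains g where "equivariant_map g g' F"
proof -
  obtain G c c' where G: "lifts g' g0 (inv_into (torus (lattice g0)) f) G"
    and GF: "\<And>x. G (F x) = x + c" and FG: "\<And>y. F (G y) = y + c'"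
    using homeomorphic_torus_inverse_lift[OF g0 g' f F] by metis
  have "\<exists>b. \<forall>y. G (y + g' *v axis i 1) = G y + b" for i
    using lift_translation[OF g0 G, of "g' *v axis i 1"] by (metis imageI int_lattice_axis)
  then obtain b where b: "\<And>i y. G (y + g' *v axis i 1) = G y + b i" by metis
  define g :: "real^'n^'n" where "g = (\<chi> a i. b i $ a)"
  have "g *v axis i 1 = b i" for i by (simp add: matrix_vector_mult_basis g_def column_def vec_eq_iff)
  then have "equivariant_map g' g G" by (intro equivariant_mapI_axis) (simp add: b)
  moreover have "equivariant_map g g (G \<circ> F)" by (simp add: equivariant_map_def GF add_ac)
  moreover have "inj G" using FG by (metis add_right_cancel injI)
  ultimately have "equivariant_map g g' F" using equivariant_map_cancel[of g g G F g'] by blast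
  then show thesis by (rule that)
qed

lemma equivariant_map_matrix_unique:
  fixes g h g' :: "real^'n^'n"
  assumes "equivariant_map g g' F" "equivariant_map h g' F" "inj F"
  shows "g = h"
proof -
  have "F (0 + g *v axis i 1) = F (0 + h *v axis i 1)" for i
    using equivariant_mapD[OF assms(1) int_lattice_axis] equivariant_mapD[OF assms(2) int_lattice_axis] by metis
  then have "g *v axis i 1 = h *v axis i 1" for i using assms(3) by (metis add_0 injD)
  then show ?thesis by (simp add: matrix_vector_mult_basis vec_eq_iff column_def)
qed

lemma marking_matrix_iff:
  "marking_matrix (\<Lambda>, f) g \<longleftrightarrow> (\<exists>F. torus_lift \<Lambda> int_lattice f F \<and> equivariant_map g (mat 1) F)"
proof -
  have col: "column i (mat 1) = (axis i 1 :: real^'a)" for i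
    by (metis matrix_vector_mult_basis matrix_vector_mul_lid)
  have "(\<forall>x i. F (x + column i g) = F x + axis i 1) \<longleftrightarrow> equivariant_map g (mat 1) F" for F
  proof
    assume "\<forall>x i. F (x + column i g) = F x + axis i 1"
    then show "equivariant_map g (mat 1) F"
      by (intro equivariant_mapI_axis) (simp add: matrix_vector_mult_basis col)
  next
    assume e: "equivariant_map g (mat 1) F"
    show "\<forall>x i. F (x + column i g) = F x + axis i 1"
      using equivariant_mapD[OF e int_lattice_axis] by (simp add: matrix_vector_mult_basis col)
  qed
  then show ?thesis by (simp add: marking_matrix_def)
qed

lemma lifts_int_lattice: "lifts g (mat 1) f F \<longleftrightarrow> torus_lift (lattice g) int_lattice f F"
  by (simp add: lifts_def)

text \<open>Replaces the arbitrary lattice basis of the covolume condition by the marked one, which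
  generates the same lattice and hence also has determinant 1 up to sign.\<close>

lemma marked_torus_cases:
  fixes m :: "'n::finite marked_torus"
  assumes "m \<in> marked_tori"
  obtains g f F where "m = (lattice g, f)" "\<bar>det g\<bar> = 1" "homeomorphic_map (torus_top g) (torus_top (mat 1)) f"
    "lifts g (mat 1) f F" "equivariant_map g (mat 1) F" "marking_matrix m g"
proof -
  obtain \<Lambda> f where m: "m = (\<Lambda>, f)" by fastforce
  obtain g0 where g0: "\<bar>det g0\<bar> = 1" "\<Lambda> = lattice g0"
    using assms m by (auto simp: marked_tori_def unit_covolume_lattice_def)
  have f: "homeomorphic_map (torus_top g0) (torus_top (mat 1)) f"
    using assms m g0(2) by (simp add: marked_tori_def)
  obtain F where F: "lifts g0 (mat 1) f F" using assms m g0(2) by (auto simp: marked_tori_def lifts_int_lattice)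
  have nz: "det g0 \<noteq> 0" "det (mat 1 :: real^'n^'n) \<noteq> 0" using g0 by auto
  obtain g where g: "equivariant_map g (mat 1) F" using lift_equivariant_exists[OF nz f F] by blast
  have lat: "lattice g = lattice g0" by (rule equivariant_lift_lattice[OF nz f F g])
  have "marking_matrix m g" unfolding m marking_matrix_iff using F g g0(2) by (auto simp: lifts_int_lattice)
  moreover have "\<bar>det g\<bar> = 1" by (rule lattice_eq_imp_abs_det_eq_1[OF lat g0(1)])
  ultimately show thesis using that[of g f F] m g0(2) lat f F g by (simp only: lifts_def)
qed

lemma marking_matrix_unique:
  fixes m :: "'n::finite marked_torus"
  assumes m: "m \<in> marked_tori" and g: "marking_matrix m g" and h: "marking_matrix m h"
  shows "g = h"
proof -
  obtain k f F where k: "m = (lattice k, f)" "\<bar>det k\<bar> = 1" "homeomorphic_map (torus_top k) (torus_top (mat 1)) f"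
    "lifts k (mat 1) f F" using marked_torus_cases[OF m] by metis
  have nz: "det k \<noteq> 0" "det (mat 1 :: real^'n^'n) \<noteq> 0" using k(2) by auto
  have "equivariant_map a (mat 1) F" if "marking_matrix m a" for a
    using that unfolding k(1) marking_matrix_iff lifts_int_lattice[symmetric]
    using equivariant_map_lift_unique[OF nz(2) _ k(4)] by blast
  then show ?thesis using equivariant_map_matrix_unique lift_inj[OF nz k(3,4)] g h by blast
qed

lemma marked_torus_data:
  fixes m :: "'n::finite marked_torus"
  assumes "m \<in> marked_tori" "marking_matrix m g"
  obtains f F where "m = (lattice g, f)" "\<bar>det g\<bar> = 1" "homeomorphic_map (torus_top g) (torus_top (mat 1)) f"
    "lifts g (mat 1) f F" "equivariant_map g (mat 1) F" "inj F"
proof -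
  obtain h f F where h: "m = (lattice h, f)" "\<bar>det h\<bar> = 1" "homeomorphic_map (torus_top h) (torus_top (mat 1)) f"
    "lifts h (mat 1) f F" "equivariant_map h (mat 1) F" "marking_matrix m h"
    by (rule marked_torus_cases[OF assms(1)])
  have "h = g" using marking_matrix_unique assms h(6) by blast
  moreover have "inj F" by (rule lift_inj[OF _ _ h(3,4)]) (use h(2) in auto)
  ultimately show thesis using that h(1-5) by blast
qed

section \<open>Gram matrices as complete invariants of marked tori\<close>

definition gram :: "real^'n^'n \<Rightarrow> real^'n^'n" where
  "gram g = transpose g ** g"

lemma quad_form_gram: "quad_form (gram g) y = (norm (g *v y))\<^sup>2"
proof -
  have "quad_form (gram g) y = y \<bullet> (transpose g *v (g *v y))" by (simp only: gram_def matrix_vector_mul_assoc)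
  also have "\<dots> = (g *v y) \<bullet> (g *v y)" by (simp only: inner_matrix_vector_transpose transpose_transpose)
  finally show ?thesis by (simp add: power2_norm_eq_inner)
qed

lemma gram_in_posdef1:
  assumes "\<bar>det g\<bar> = 1" shows "gram g \<in> posdef1"
proof -
  have nz: "det g \<noteq> 0" using assms by auto
  have "g *v y \<noteq> 0" if "y \<noteq> 0" for y
    using that matrix_vector_mul_cancel(2)[OF nz, of y] by auto
  then have "pos_def (gram g)" unfolding pos_def_def quad_form_gram
    by (simp add: gram_def matrix_transpose_mul)
  moreover have "det (gram g) = (det g)\<^sup>2" by (simp add: gram_def det_mul power2_eq_square)
  ultimately show ?thesis using assms by (metis abs_square_eq_1 posdef1_iff)
qed

text \<open>An isometry lifts with orthogonal linear part \<open>K\<close>, and the homotopy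
  condition forces \<open>K ** g = g'\<close>, so the Gram matrices agree. Conversely, equal Gram
  matrices make \<open>g' ** matrix_inv g\<close> orthogonal, and the isometry it induces respects
  the markings up to homotopy.\<close>

theorem marking_equiv_iff_gram:
  fixes m m' :: "'n::finite marked_torus"
  assumes m: "m \<in> marked_tori" "marking_matrix m g" and m': "m' \<in> marked_tori" "marking_matrix m' g'"
  shows "(m, m') \<in> marking_equiv \<longleftrightarrow> gram g = gram g'"
proof -
  obtain f F where f: "m = (lattice g, f)" "\<bar>det g\<bar> = 1" "homeomorphic_map (torus_top g) (torus_top (mat 1)) f"
    "lifts g (mat 1) f F" "equivariant_map g (mat 1) F" "inj F" by (rule marked_torus_data[OF m])
  obtain f' F' where f': "m' = (lattice g', f')" "\<bar>det g'\<bar> = 1" "homeomorphic_map (torus_top g') (torus_top (mat 1)) f'"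
    "lifts g' (mat 1) f' F'" "equivariant_map g' (mat 1) F'" "inj F'" by (rule marked_torus_data[OF m'])
  have nz: "det g \<noteq> 0" "det g' \<noteq> 0" "det (mat 1 :: real^'n^'n) \<noteq> 0" using f(2) f'(2) by auto
  have iff: "(m, m') \<in> marking_equiv \<longleftrightarrow> (\<exists>h. torus_isometry (lattice g) (lattice g') h \<and>
       homotopic_with (\<lambda>_. True) (torus_top g) (torus_top (mat 1)) (f' \<circ> h) f)"
    using m m' f(1) f'(1) by (simp add: marking_equiv_def)
  show ?thesis
  proof
    assume "(m, m') \<in> marking_equiv"
    then obtain h where h: "torus_isometry (lattice g) (lattice g') h"
       "homotopic_with (\<lambda>_. True) (torus_top g) (torus_top (mat 1)) (f' \<circ> h) f" using iff by blast
    obtain H K c where H: "lifts g g' h H" and K: "orthogonal_matrix K" "\<And>x. H x = K *v x + c"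
      using torus_isometry_lift[OF nz(1,2) h(1)] by metis
    have "equivariant_map g (mat 1) (F' \<circ> H)"
      by (rule homotopic_lifts_equivariant[OF nz(1,3) homotopic_with_symD[OF h(2)] f(4) lifts_compose[OF H f'(4)] f(5)])
    then have "equivariant_map g g' H" using f'(5,6) by (rule equivariant_map_cancel)
    then have "equivariant_map g g' (\<lambda>x. K *v x)" by (simp add: equivariant_map_def K(2))
    then have "K *v (0 + g *v axis i 1) = K *v 0 + g' *v axis i 1" for i
      using equivariant_mapD int_lattice_axis by blast
    then have "(K ** g) *v axis i 1 = g' *v axis i 1" for i by (simp add: matrix_vector_mul_assoc)
    then have "K ** g = g'" by (simp add: matrix_vector_mult_basis vec_eq_iff column_def)
    then have "gram g' = transpose g ** (transpose K ** K) ** g"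
      by (auto simp: gram_def matrix_transpose_mul matrix_mul_assoc)
    then show "gram g = gram g'" using K(1) by (simp add: gram_def orthogonal_matrix)
  next
    assume eq: "gram g = gram g'"
    define K where "K = g' ** matrix_inv g"
    have inv: "g ** matrix_inv g = mat 1" "matrix_inv g ** g = mat 1"
      using nz(1) by (simp_all add: matrix_inv_right_real matrix_inv_left_real invertible_det_nz)
    have Kg: "K ** g = g'" by (simp add: K_def matrix_mul_assoc[symmetric] inv)
    have "transpose K ** K = transpose (matrix_inv g) ** gram g' ** matrix_inv g"
      by (simp add: K_def gram_def matrix_transpose_mul matrix_mul_assoc)
    also have "\<dots> = transpose (matrix_inv g) ** gram g ** matrix_inv g" by (simp only: eq)
    also have "\<dots> = transpose (g ** matrix_inv g) ** (g ** matrix_inv g)"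
      by (simp only: gram_def matrix_transpose_mul matrix_mul_assoc)
    finally have K: "orthogonal_matrix K" by (simp add: inv orthogonal_matrix)
    have "lifts g (mat 1) (f' \<circ> torus_matrix_map K) (F' \<circ> (\<lambda>x. K *v x))"
      using lifts_compose[OF lifts_torus_matrix_map[of g K] ] f'(4) by (simp only: Kg)
    moreover have "equivariant_map g (mat 1) (F' \<circ> (\<lambda>x. K *v x))"
      using equivariant_map_compose[OF equivariant_map_matrix[of g K]] f'(5) by (simp only: Kg)
    ultimately have "homotopic_with (\<lambda>_. True) (torus_top g) (torus_top (mat 1)) (f' \<circ> torus_matrix_map K) f"
      by (rule equivariant_lifts_homotopic[OF nz(1,3) _ _ f(4,5)])
    moreover have "torus_isometry (lattice g) (lattice g') (torus_matrix_map K)"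
      using torus_isometry_torus_matrix_map[OF nz(1) K] by (simp only: Kg)
    ultimately show "(m, m') \<in> marking_equiv" using iff by blast
  qed
qed

lemma pos_def_matrix_inv:
  fixes R :: "real^'n^'n"
  assumes R: "pos_def R"
  shows "pos_def (matrix_inv R)"
proof -
  have i: "invertible R" by (rule pos_def_imp_invertible[OF R])
  have nz: "det R \<noteq> 0" using i by (simp add: invertible_det_nz)
  have t: "transpose (matrix_inv R) = matrix_inv R"
    using R by (metis i matrix_inv_left_real matrix_inv_unique_real matrix_transpose_mul pos_def_def transpose_mat)
  have "quad_form (matrix_inv R) x > 0" if "x \<noteq> 0" for x
  proof -
    define y where "y = matrix_inv R *v x"
    have x: "R *v y = x" unfolding y_def by (rule matrix_vector_mul_cancel(1)[OF nz])
    then have "y \<noteq> 0" using that by auto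
    then have "y \<bullet> (R *v y) > 0" by (rule pos_def_inner_pos[OF R])
    then have "y \<bullet> x > 0" by (simp only: x)
    then show ?thesis by (simp add: y_def inner_commute)
  qed
  then show ?thesis using t by (simp add: pos_def_def)
qed

lemma det_pos_def: "pos_def P \<Longrightarrow> det P > 0"
proof -
  assume "pos_def P"
  then obtain Q d where Q: "orthogonal_matrix Q" "P = Q ** diag_matrix d ** transpose Q" "\<And>i. d $ i > 0"
    using pos_def_diagonalization by metis
  have "det Q * det Q = 1" by (metis Q(1) det_I det_mul det_transpose orthogonal_matrix)
  moreover have "det P = (det Q * det Q) * (\<Prod>i\<in>UNIV. d $ i)"
    by (simp add: Q(2) det_mul det_diag_matrix)
  ultimately show ?thesis using Q(3) by (simp add: prod_pos)
qed

text \<open>The matrices on the segment from \<open>B\<close> to the identity are positive definite, hence invertible.\<close>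

lemma orientation_preserving_pos_def:
  fixes B :: "real^'n^'n"
  assumes B: "pos_def B"
  shows "orientation_preserving (\<lambda>x. B *v x)"
  unfolding orientation_preserving_def
proof
  fix x :: "real^'n"
  \<comment> \<open>The segment is taken around \<open>x\<close>, so \<open>x\<close> keeps its
    image \<open>B *v x\<close> throughout; pairing the displacement with \<open>y - x\<close> shows
    that no other point reaches it. This is what a homotopy of pairs requires.\<close>
  define k where "k = (\<lambda>(t::real, y). B *v x + ((1 - t) *\<^sub>R (B *v (y - x)) + t *\<^sub>R (y - x)))"
  have "homotopic_with (\<lambda>h. h \<in> (UNIV - {x}) \<rightarrow> (UNIV - {B *v x})) euclidean euclidean
      (\<lambda>y. B *v y) (\<lambda>y. y + (B *v x - x))"
    unfolding homotopic_with_def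
  proof (intro exI[of _ k] conjI allI ballI)
    have "continuous_on ({0..1} \<times> UNIV) k" unfolding k_def case_prod_unfold
      by (intro continuous_intros continuous_on_compose2[OF matrix_vector_mult_linear_continuous_on[of UNIV]]) auto
    then show "continuous_map (prod_topology (top_of_set {0..1}) euclidean) euclidean k"
      using prod_topology_subtopology_eu[of "{0..1::real}" "UNIV :: (real^'n) set"] by simp
    show "k (0, y) = B *v y" "k (1, y) = y + (B *v x - x)" for y
      by (simp_all add: k_def matrix_vector_mult_diff_distrib)
    fix t :: real assume t: "t \<in> {0..1}"
    show "(\<lambda>y. k (t, y)) \<in> (UNIV - {x}) \<rightarrow> (UNIV - {B *v x})"
    proof
      fix y assume "y \<in> UNIV - {x}"
      define v where "v = y - x"
      have v: "v \<noteq> 0" using \<open>y \<in> UNIV - {x}\<close> by (simp add: v_def)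
      have "v \<bullet> ((1 - t) *\<^sub>R (B *v v) + t *\<^sub>R v) = (1 - t) * quad_form B v + t * (v \<bullet> v)"
        by (simp add: inner_add_right)
      moreover have "\<dots> > 0"
      proof (cases "t = 1")
        case False
        then have "(1 - t) * quad_form B v > 0" using t pos_def_inner_pos[OF B v] by simp
        then show ?thesis using t by (simp add: add_pos_nonneg)
      qed (use v in simp)
      ultimately have "(1 - t) *\<^sub>R (B *v v) + t *\<^sub>R v \<noteq> 0" by auto
      then show "k (t, y) \<in> UNIV - {B *v x}" by (simp add: k_def v_def)
    qed
  qed
  then show "hom_induced (int CARD('n)) euclidean (UNIV - {x}) euclidean (UNIV - {B *v x}) (\<lambda>x. B *v x) =
     hom_induced (int CARD('n)) euclidean (UNIV - {x}) euclidean (UNIV - {B *v x}) (\<lambda>y. y + (B *v x - x))"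
    by (rule homology_homotopy_axiom)
qed

text \<open>The symmetric square root of \<open>P\<close> is taken as the marked basis: the marking
  then lifts to its inverse, which is positive definite and so preserves orientation.\<close>

lemma marked_torus_with_gram:
  fixes P :: "real^'n^'n"
  assumes "P \<in> posdef1"
  obtains m g where "m \<in> marked_tori" "marking_matrix m g" "gram g = P"
proof -
  have P: "pos_def P" "det P = 1" using assms by (auto simp: posdef1_iff)
  obtain R where R: "pos_def R" "R ** R = P" by (rule pos_def_square_root[OF P(1)])
  have "det R * det R = 1" using P(2) by (metis R(2) det_mul)
  then have "(det R)\<^sup>2 = 1" by (simp add: power2_eq_square)
  then have d: "det R = 1" using det_pos_def[OF R(1)] by (auto simp: power2_eq_1_iff)
  have nz: "det R \<noteq> 0" "det (matrix_inv R) \<noteq> 0" using d det_matrix_inv_nonzero[of R] by auto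
  have RI: "matrix_inv R ** R = mat 1" using nz by (simp add: matrix_inv_left_real invertible_det_nz)
  define f where "f = torus_matrix_map (matrix_inv R)"
  have L: "lifts R (mat 1) f (\<lambda>x. matrix_inv R *v x)"
    using lifts_torus_matrix_map[of R "matrix_inv R"] by (simp only: RI f_def)
  have e: "equivariant_map R (mat 1) (\<lambda>x. matrix_inv R *v x)"
    using equivariant_map_matrix[of R "matrix_inv R"] by (simp only: RI)
  have h: "homeomorphic_map (torus_top R) (torus_top (mat 1)) f"
    using homeomorphic_map_torus_matrix_map[OF nz] by (simp only: RI f_def)
  have "(lattice R, f) \<in> marked_tori"
    unfolding marked_tori_def
  proof (intro CollectI case_prodI conjI exI)
    show "unit_covolume_lattice (lattice R)" unfolding unit_covolume_lattice_def using d by (intro exI[of _ R]) simp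
    show "homeomorphic_map (torus_top R) (torus_topology int_lattice) f" using h by simp
    show "torus_lift (lattice R) int_lattice f (\<lambda>x. matrix_inv R *v x)" using L by (simp only: lifts_int_lattice)
    show "orientation_preserving (\<lambda>x. matrix_inv R *v x)"
      by (rule orientation_preserving_pos_def[OF pos_def_matrix_inv[OF R(1)]])
  qed
  moreover have "marking_matrix (lattice R, f) R"
    unfolding marking_matrix_iff using L e by (auto simp: lifts_int_lattice)
  moreover have "gram R = P" using R by (simp add: gram_def pos_def_def)
  ultimately show thesis by (rule that)
qed

text \<open>A class is a full fibre of the Gram matrix on marked tori. This justifies
  \<open>the_elem\<close> in \<open>teich_to_posdef\<close> and gives injectivity at once.\<close>

lemma teich_space_class:
  fixes c :: "'n::finite marked_torus set"
  assumes c: "c \<in> teich_space"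
  shows "teich_to_posdef c \<in> posdef1"
    and "c = {m \<in> marked_tori. \<exists>g. marking_matrix m g \<and> gram g = teich_to_posdef c}"
proof -
  obtain m0 where m0: "m0 \<in> marked_tori" "c = marking_equiv `` {m0}"
    using c by (auto simp: teich_space_def quotient_def)
  obtain g0 f F where g0: "m0 = (lattice g0, f)" "\<bar>det g0\<bar> = 1" "homeomorphic_map (torus_top g0) (torus_top (mat 1)) f"
    "lifts g0 (mat 1) f F" "equivariant_map g0 (mat 1) F" "marking_matrix m0 g0"
    by (rule marked_torus_cases[OF m0(1)])
  have eq: "c = {m \<in> marked_tori. \<exists>g. marking_matrix m g \<and> gram g = gram g0}"
  proof (intro equalityI subsetI)
    fix m assume "m \<in> c"
    then have e: "(m0, m) \<in> marking_equiv" using m0(2) by blast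
    then have m: "m \<in> marked_tori" by (auto simp: marking_equiv_def)
    obtain g where g: "marking_matrix m g" using marked_torus_cases[OF m] by metis
    have "gram g0 = gram g" using marking_equiv_iff_gram[OF m0(1) g0(6) m g] e by blast
    then show "m \<in> {m \<in> marked_tori. \<exists>g. marking_matrix m g \<and> gram g = gram g0}" using m g by auto
  next
    fix m assume "m \<in> {m \<in> marked_tori. \<exists>g. marking_matrix m g \<and> gram g = gram g0}"
    then obtain g where g: "m \<in> marked_tori" "marking_matrix m g" "gram g = gram g0" by blast
    then show "m \<in> c" using marking_equiv_iff_gram[OF m0(1) g0(6) g(1,2)] m0(2) by simp
  qed
  have "(\<lambda>h. h ** transpose h) ` teich_coset c = {gram g0}"
  proof -
    have "(\<lambda>h. h ** transpose h) ` teich_coset c = {gram g | g. \<exists>m\<in>c. marking_matrix m g}"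
    proof (intro equalityI subsetI)
      fix P assume "P \<in> {gram g | g. \<exists>m\<in>c. marking_matrix m g}"
      then obtain g m where "m \<in> c" "marking_matrix m g" "P = gram g" by blast
      then have "transpose g \<in> teich_coset c" "P = transpose g ** transpose (transpose g)"
        by (auto simp: teich_coset_def gram_def)
      then show "P \<in> (\<lambda>h. h ** transpose h) ` teich_coset c" by blast
    qed (auto simp: teich_coset_def gram_def)
    moreover have uniq: "gram g = gram g0" if "m \<in> c" "marking_matrix m g" for m g
    proof -
      obtain h where h: "m \<in> marked_tori" "marking_matrix m h" "gram h = gram g0"
        using \<open>m \<in> c\<close> unfolding eq by blast
      then show ?thesis using marking_matrix_unique[OF h(1,2) \<open>marking_matrix m g\<close>] by simp
    qed
    moreover have "{gram g | g. \<exists>m\<in>c. marking_matrix m g} = {gram g0}"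
    proof (intro equalityI subsetI)
      fix P assume "P \<in> {gram g | g. \<exists>m\<in>c. marking_matrix m g}"
      then obtain g m where "m \<in> c" "marking_matrix m g" "P = gram g" by blast
      then show "P \<in> {gram g0}" using uniq by simp
    next
      fix P assume "P \<in> {gram g0}"
      moreover have "m0 \<in> c" unfolding eq using m0(1) g0(6) by blast
      ultimately show "P \<in> {gram g | g. \<exists>m\<in>c. marking_matrix m g}" using g0(6) by blast
    qed
    ultimately show ?thesis by (simp only:)
  qed
  then have P: "teich_to_posdef c = gram g0" by (simp add: teich_to_posdef_def)
  show "teich_to_posdef c \<in> posdef1" unfolding P by (rule gram_in_posdef1[OF g0(2)])
  show "c = {m \<in> marked_tori. \<exists>g. marking_matrix m g \<and> gram g = teich_to_posdef c}"
    unfolding P by (rule eq)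
qed

theorem bij_betw_teich_to_posdef:
  "bij_betw teich_to_posdef (teich_space :: 'n::finite marked_torus set set) posdef1"
  unfolding bij_betw_def
proof (intro conjI equalityI subsetI)
  show "inj_on teich_to_posdef (teich_space :: 'n marked_torus set set)"
  proof (rule inj_onI)
    fix c d :: "'n marked_torus set"
    assume c: "c \<in> teich_space" and d: "d \<in> teich_space" and eq: "teich_to_posdef c = teich_to_posdef d"
    have "c = {m \<in> marked_tori. \<exists>g. marking_matrix m g \<and> gram g = teich_to_posdef d}"
      using teich_space_class(2)[OF c] by (simp only: eq)
    also have "\<dots> = d" by (rule teich_space_class(2)[OF d, symmetric])
    finally show "c = d" .
  qed
  show "P \<in> posdef1" if "P \<in> teich_to_posdef ` (teich_space :: 'n marked_torus set set)" for P
    using that teich_space_class(1) by blast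
  fix P :: "real^'n^'n" assume "P \<in> posdef1"
  then obtain m g where m: "m \<in> marked_tori" "marking_matrix m g" "gram g = P" by (rule marked_torus_with_gram)
  let ?c = "marking_equiv `` {m}"
  have c: "?c \<in> teich_space" using m(1) by (auto simp: teich_space_def quotient_def)
  moreover have "m \<in> ?c" using marking_equiv_iff_gram[OF m(1,2,1,2)] by simp
  then obtain g' where "marking_matrix m g'" "gram g' = teich_to_posdef ?c" using teich_space_class(2)[OF c] by blast
  then have "teich_to_posdef ?c = P" using marking_matrix_unique[OF m(1,2)] m(3) by metis
  ultimately show "P \<in> teich_to_posdef ` teich_space" by blast
qed

section \<open>The Teichmueller distance\<close>

text \<open>Substituting \<open>x = g *v y\<close>, and \<open>x = g' *v y\<close> for the other
  inequality, turns the bounds between the forms into norm bounds for the comparison map and its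
  inverse.\<close>

lemma hilbert_dist_gram_le_iff:
  fixes g g' :: "real^'n^'n"
  assumes g: "\<bar>det g\<bar> = 1" and g': "\<bar>det g'\<bar> = 1"
  shows "hilbert_dist (gram g) (gram g') \<le> c \<longleftrightarrow>
    (\<forall>x. norm ((g' ** matrix_inv g) *v x) \<le> exp c * norm x) \<and>
    (\<forall>x. norm (matrix_inv (g' ** matrix_inv g) *v x) \<le> exp c * norm x)"
proof -
  have nz: "det g \<noteq> 0" "det g' \<noteq> 0" using g g' by auto
  have inv: "matrix_inv (g' ** matrix_inv g) = g ** matrix_inv g'"
    by (rule matrix_inv_unique_real)
      (metis invertible_det_nz matrix_inv_left_real matrix_inv_right_real matrix_mul_assoc matrix_mul_rid nz)
  have pd: "pos_def (gram g)" "pos_def (gram g')" using gram_in_posdef1 g g' by (auto simp: posdef1_iff)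
  have e: "exp (2 * c) * (norm v)\<^sup>2 = (exp c * norm v)\<^sup>2" for v :: "real^'n"
    by (simp add: power_mult_distrib exp_double)
  have "exp (- 2 * c) * (norm u)\<^sup>2 \<le> (norm v)\<^sup>2 \<longleftrightarrow> norm u \<le> exp c * norm v" for u v :: "real^'n"
  proof -
    have "exp (- 2 * c) * (norm u)\<^sup>2 \<le> (norm v)\<^sup>2 \<longleftrightarrow> (norm u)\<^sup>2 \<le> exp (2 * c) * (norm v)\<^sup>2"
      by (simp add: exp_minus divide_simps mult.commute)
    also have "\<dots> \<longleftrightarrow> norm u \<le> exp c * norm v" unfolding e by (simp add: abs_le_square_iff[symmetric])
    finally show ?thesis .
  qed
  moreover have "(norm u)\<^sup>2 \<le> exp (2 * c) * (norm v)\<^sup>2 \<longleftrightarrow> norm u \<le> exp c * norm v" for u v :: "real^'n"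
    unfolding e by (simp add: abs_le_square_iff[symmetric])
  ultimately have "hilbert_dist (gram g) (gram g') \<le> c \<longleftrightarrow>
      (\<forall>y. norm (g' *v y) \<le> exp c * norm (g *v y)) \<and> (\<forall>y. norm (g *v y) \<le> exp c * norm (g' *v y))"
    unfolding hilbert_dist_le_iff[OF pd] quad_form_gram by auto
  also have "(\<forall>y. norm (g' *v y) \<le> exp c * norm (g *v y)) \<longleftrightarrow> (\<forall>x. norm ((g' ** matrix_inv g) *v x) \<le> exp c * norm x)"
    by (metis matrix_vector_mul_assoc matrix_vector_mul_cancel[OF nz(1)])
  also have "(\<forall>y. norm (g *v y) \<le> exp c * norm (g' *v y)) \<longleftrightarrow> (\<forall>x. norm ((g ** matrix_inv g') *v x) \<le> exp c * norm x)"
    by (metis matrix_vector_mul_assoc matrix_vector_mul_cancel[OF nz(2)])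
  finally show ?thesis by (simp only: inv)
qed

theorem marked_teich_dist_eq:
  fixes m m' :: "'n::{finite,wellorder} marked_torus"
  assumes m: "m \<in> marked_tori" "marking_matrix m g" and m': "m' \<in> marked_tori" "marking_matrix m' g'"
  shows "marked_teich_dist m m' = hilbert_dist (gram g) (gram g')"
proof -
  obtain f F where f: "m = (lattice g, f)" "\<bar>det g\<bar> = 1" "homeomorphic_map (torus_top g) (torus_top (mat 1)) f"
    "lifts g (mat 1) f F" "equivariant_map g (mat 1) F" "inj F" by (rule marked_torus_data[OF m])
  obtain f' F' where f': "m' = (lattice g', f')" "\<bar>det g'\<bar> = 1" "homeomorphic_map (torus_top g') (torus_top (mat 1)) f'"
    "lifts g' (mat 1) f' F'" "equivariant_map g' (mat 1) F'" "inj F'" by (rule marked_torus_data[OF m'])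
  have nz: "det g \<noteq> 0" "det g' \<noteq> 0" "det (mat 1 :: real^'n::_^'n::_) \<noteq> 0" using f(2) f'(2) by auto
  define A where "A = g' ** matrix_inv g"
  have ginv: "matrix_inv g ** g = mat 1" using nz(1) by (simp add: matrix_inv_left_real invertible_det_nz)
  have Ag: "A ** g = g'" by (simp add: A_def matrix_mul_assoc[symmetric] ginv)
  have "\<bar>det A * det g\<bar> = 1" using Ag f'(2) by (metis det_mul)
  then have dA: "\<bar>det A\<bar> = 1" using f(2) by (simp add: abs_mult)
  then have nzA: "det A \<noteq> 0" by auto
  let ?i = "inv_into (torus (lattice g')) f'"
  obtain G' c c' where G': "lifts (mat 1) g' ?i G'" "\<And>x. G' (F' x) = x + c" "\<And>y. F' (G' y) = y + c'"
    using homeomorphic_torus_inverse_lift[OF nz(2,3) f'(3,4)] by metis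
  have "equivariant_map (mat 1) (mat 1) (F' \<circ> G')" by (simp add: equivariant_map_def G'(3) add_ac)
  then have G'e: "equivariant_map (mat 1) g' G'" using f'(5,6) by (rule equivariant_map_cancel)
  let ?n = "real CARD('n)"
  let ?h = "hilbert_dist (gram g) (gram g')"
  have n: "?n > 0" by simp
  have lower: "ereal (exp (?n * ?h)) \<le> \<kappa>" if "\<kappa> \<in> marked_dilatations m m'" for \<kappa>
  proof (rule ccontr)
    assume "\<not> ereal (exp (?n * ?h)) \<le> \<kappa>"
    then have "max \<kappa> 0 < ereal (exp (?n * ?h))" by simp
    \<comment> \<open>A real number is placed strictly in between because \<open>\<kappa>\<close> is
      an extended real, whereas the lower bound for dilatations expects a nonnegative real.\<close>
    then obtain K where K: "max \<kappa> 0 < ereal K" "ereal K < ereal (exp (?n * ?h))" using ereal_dense2 by blast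
    obtain H \<phi> where H: "\<kappa> = max_dilatation H" "homeomorphic_map (torus_top g) (torus_top g') \<phi>"
      "homotopic_with (\<lambda>_. True) (torus_top g) (torus_top g') \<phi> (?i \<circ> f)" "lifts g g' \<phi> H" "quasiconformal H"
      using \<open>\<kappa> \<in> marked_dilatations m m'\<close> unfolding marked_dilatations_def f(1) f'(1) lifts_def by auto
    \<comment> \<open>This composition lifts the change of marking; its equivariance passes through
      the homotopy to the lift of every competitor.\<close>
    have "equivariant_map g g' (G' \<circ> F)" by (rule equivariant_map_compose[OF f(5) G'e])
    then have He: "equivariant_map g g' H"
      by (rule homotopic_lifts_equivariant[OF nz(1,2) homotopic_with_symD[OF H(3)] lifts_compose[OF f(4) G'(1)] H(4)])
    obtain HI where HI: "homeomorphism UNIV UNIV H HI" using H(5) by (auto simp: quasiconformal_def)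
    interpret quasiperiodic_homeomorphism g A H HI
    proof
      fix l x assume "l \<in> lattice g"
      then obtain z where z: "z \<in> int_lattice" "l = g *v z" by blast
      have "A *v l = g' *v z" by (simp only: z(2) matrix_vector_mul_assoc Ag)
      then show "H (x + l) = H x + A *v l" using equivariant_mapD[OF He z(1)] z(2) by simp
    qed (use f(2) dA HI in auto)
    have K0: "K > 0" "max_dilatation H \<le> ereal K" using K(1) H(1) by auto
    \<comment> \<open>The logarithm of the \<open>n\<close>-th root of \<open>K\<close>: dilatation
      bounds involve \<open>n\<close>-th powers of norms, the Hilbert metric the norms
      themselves.\<close>
    define b where "b = ln K / ?n"
    have "exp (?n * b) = K" using K0(1) by (simp add: b_def)
    then have Kb: "K = exp b ^ CARD('n)" by (simp add: exp_of_nat_mult)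
    have root: "norm u \<le> exp b * norm v" if "norm u ^ CARD('n) \<le> K * norm v ^ CARD('n)" for u v :: "real^'n::_"
    proof (rule power_le_imp_le_base)
      show "norm u ^ Suc (CARD('n) - 1) \<le> (exp b * norm v) ^ Suc (CARD('n) - 1)"
        using that by (simp add: Kb power_mult_distrib)
    qed simp
    have "?h \<le> b"
      unfolding hilbert_dist_gram_le_iff[OF f(2) f'(2)] A_def[symmetric]
      using max_dilatation_lower_bound[OF H(5) K0(2)] K0(1) by (auto intro!: root)
    then have "exp (?n * ?h) \<le> K" using \<open>exp (?n * b) = K\<close> n by (metis exp_le_cancel_iff mult_left_mono less_imp_le)
    then show False using K(2) by simp
  qed
  have mem: "max_dilatation (\<lambda>x. A *v x) \<in> marked_dilatations m m'"
  proof -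
    have h1: "homeomorphic_map (torus_top g) (torus_top g') (torus_matrix_map A)"
      using homeomorphic_map_torus_matrix_map[OF nz(1) nzA] by (simp only: Ag)
    have l1: "lifts g g' (torus_matrix_map A) (\<lambda>x. A *v x)"
      using lifts_torus_matrix_map[of g A] by (simp only: Ag)
    have e1: "equivariant_map g g' (\<lambda>x. A *v x)" using equivariant_map_matrix[of g A] by (simp only: Ag)
    have "homotopic_with (\<lambda>_. True) (torus_top g) (torus_top g') (torus_matrix_map A) (?i \<circ> f)"
      by (rule equivariant_lifts_homotopic[OF nz(1,2) l1 e1 lifts_compose[OF f(4) G'(1)] equivariant_map_compose[OF f(5) G'e]])
    then show ?thesis using h1 l1 quasiconformal_linear[OF dA]
      unfolding marked_dilatations_def f(1) f'(1) lifts_def by auto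
  qed
  have "max_dilatation (\<lambda>x. A *v x) \<le> ereal (exp ?h ^ CARD('n))"
    using hilbert_dist_gram_le_iff[OF f(2) f'(2), of ?h]
    by (intro max_dilatation_linear_le[OF dA]) (auto simp: A_def)
  also have "exp ?h ^ CARD('n) = exp (?n * ?h)" by (simp add: exp_of_nat_mult)
  finally have "Inf (marked_dilatations m m') \<le> ereal (exp (?n * ?h))" using mem by (meson Inf_lower2)
  moreover have "ereal (exp (?n * ?h)) \<le> Inf (marked_dilatations m m')" using lower by (rule Inf_greatest)
  ultimately have "Inf (marked_dilatations m m') = ereal (exp (?n * ?h))" by (rule antisym)
  then show ?thesis using n by (simp add: marked_teich_dist_def)
qed

theorem teich_dist_eq_hilbert_dist:
  fixes x y :: "'n::{finite,wellorder} marked_torus set"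
  assumes x: "x \<in> teich_space" and y: "y \<in> teich_space"
  shows "teich_dist x y = hilbert_dist (teich_to_posdef x) (teich_to_posdef y)"
proof -
  have ne: "\<exists>m. m \<in> c" if "c \<in> teich_space" for c :: "'n marked_torus set"
  proof -
    obtain m g where "m \<in> marked_tori" "marking_matrix m g" "gram g = teich_to_posdef c"
      using marked_torus_with_gram[OF teich_space_class(1)[OF \<open>c \<in> teich_space\<close>]] by blast
    then show ?thesis using teich_space_class(2)[OF \<open>c \<in> teich_space\<close>] by blast
  qed
  have d: "marked_teich_dist m m' = hilbert_dist (teich_to_posdef x) (teich_to_posdef y)" if "m \<in> x" "m' \<in> y" for m m'
  proof -
    obtain g where "m \<in> marked_tori" "marking_matrix m g" "gram g = teich_to_posdef x"
      using \<open>m \<in> x\<close> teich_space_class(2)[OF x] by blast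
    moreover obtain g' where "m' \<in> marked_tori" "marking_matrix m' g'" "gram g' = teich_to_posdef y"
      using \<open>m' \<in> y\<close> teich_space_class(2)[OF y] by blast
    ultimately show ?thesis using marked_teich_dist_eq by metis
  qed
  have "(\<lambda>(m, m'). marked_teich_dist m m') ` (x \<times> y) = {hilbert_dist (teich_to_posdef x) (teich_to_posdef y)}"
    using d ne[OF x] ne[OF y] by (auto simp: image_iff) (metis SigmaI)
  then show ?thesis by (simp add: teich_dist_def)
qed

theorem proposition7p4:
  assumes "CARD('n::{finite,wellorder}) \<ge> 2"
  shows
    "bij_betw teich_to_posdef (teich_space :: 'n marked_torus set set) posdef1 \<and>
     (\<forall>x\<in>(teich_space :: 'n marked_torus set set). \<forall>y\<in>teich_space.
        teich_dist x y = hilbert_dist (teich_to_posdef x) (teich_to_posdef y)) \<and>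
     finsler_metric (posdef1 :: (real^'n::_^'n::_) set) posdef1_tangent teich_norm \<and>
     (\<forall>x\<in>(teich_space :: 'n marked_torus set set). \<forall>y\<in>teich_space.
        teich_dist x y = path_distance posdef1 teich_norm (teich_to_posdef x) (teich_to_posdef y)) \<and>
     (\<forall>X\<in>(traceless_sym :: (real^'n::_^'n::_) set).
        geodesic (teich_space :: 'n marked_torus set set) teich_dist
          (\<lambda>t. inv_into teich_space teich_to_posdef (matrix_exp (t *\<^sub>R X))))"
proof (intro conjI ballI)
  let ?T = "teich_space :: 'n marked_torus set set"
  show bij: "bij_betw teich_to_posdef ?T posdef1" by (rule bij_betw_teich_to_posdef)
  show "finsler_metric (posdef1 :: (real^'n::_^'n::_) set) posdef1_tangent teich_norm"
    by (rule finsler_metric_teich_norm)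
  fix x y assume xy: "x \<in> ?T" "y \<in> ?T"
  show "teich_dist x y = hilbert_dist (teich_to_posdef x) (teich_to_posdef y)"
    by (rule teich_dist_eq_hilbert_dist[OF xy])
  show "teich_dist x y = path_distance posdef1 teich_norm (teich_to_posdef x) (teich_to_posdef y)"
    using teich_dist_eq_hilbert_dist[OF xy]
      path_distance_teich_norm[OF teich_space_class(1)[OF xy(1)] teich_space_class(1)[OF xy(2)]] by simp
next
  let ?T = "teich_space :: 'n marked_torus set set"
  fix X :: "real^'n::_^'n::_" assume X: "X \<in> traceless_sym"
  let ?\<gamma> = "\<lambda>t. inv_into ?T teich_to_posdef (matrix_exp (t *\<^sub>R X))"
  note bij = bij_betw_teich_to_posdef[where 'n = 'n]
  have mem: "?\<gamma> t \<in> ?T" and val: "teich_to_posdef (?\<gamma> t) = matrix_exp (t *\<^sub>R X)" for t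
  proof -
    have "matrix_exp (t *\<^sub>R X) \<in> teich_to_posdef ` ?T"
      using hilbert_dist_matrix_exp(1)[OF X] bij by (simp add: bij_betw_def)
    then show "?\<gamma> t \<in> ?T" "teich_to_posdef (?\<gamma> t) = matrix_exp (t *\<^sub>R X)"
      by (rule inv_into_into, rule f_inv_into_f)
  qed
  have "teich_dist (?\<gamma> t) (?\<gamma> u) = \<bar>t - u\<bar> * teich_dist (?\<gamma> 0) (?\<gamma> 1)" for t u
    unfolding teich_dist_eq_hilbert_dist[OF mem mem] val by (rule hilbert_dist_matrix_exp(2)[OF X])
  then show "geodesic ?T teich_dist ?\<gamma>" using mem by (auto simp: geodesic_def)
qed

end
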